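(* Let $n\ge 1$ and let $V_n=\bigoplus_{k\ge0}V_n(k)\subseteq\mathbb{C}[x_1,\dots,x_{n+1}]$ be the graded $S_{n+1}$-module spanned by the polynomials $p(G)$, $G$ a slim subgraph of $K_{n+1}$. Then: $V_n(0)$ carries the trivial representation of $S_{n+1}$; $V_n(1)$ carries the reflection representation of $S_{n+1}$ (the irreducible representation indexed by $(n,1)$); for every $k<n$, $V_n(k)=\mathrm{Sym}^k(V_n(1))$, i.e. $V_n(k)$ equals the span of all products of $k$ elements of $V_n(1)$; and the top degree component $V_n\big(\binom{n}{2}\big)$ is isomorphic as an $S_{n+1}$-module to $\mathrm{Lie}_n\otimes\mathrm{sign}$.
   Context: $K_{n+1}$ is the complete graph on $[n+1]$. For an edge $e=\{i<j\}$, $p(e)=x_i-x_j$, and for a subgraph $G$ (edge set), $p(G)=\prod_{e\in G}p(e)$. $G$ is slim if $K_{n+1}-G$ is a connected graph on vertex set $[n+1]$. $V_n(k)$ denotes the homogeneous degree-$k$ part of $V_n$; $S_{n+1}$ acts by permuting variables. $C_{n+1}$ is the cyclic subgroup of $S_{n+1}$ generated by $c=(1,2,\dots,n+1)$, $\zeta$ is the one-dimensional representation of $C_{n+1}$ sending $c$ to $e^{2\pi i/(n+1)}$, and $\mathrm{Lie}_n:=\mathrm{Ind}_{C_{n+1}}^{S_{n+1}}(\zeta)$. $\mathrm{sign}$ is the sign representation of $S_{n+1}$.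
   Formalization: The clause that V_n(1) carries the reflection representation is stated only for n ≥ 2, because for n = 1 the only slim subgraph of K_2 is empty, so V_1(1) = 0 while the representation indexed by (1,1) is one-dimensional; all other clauses hold for n ≥ 1. *)

theory Defs
  imports
    Complex_Main
    "HOL-Library.Poly_Mapping"
    "HOL-Library.Function_Algebras"
    "HOL-Algebra.Sym_Groups"
begin

section \<open>Representations over the complex numbers\<close>

record ('g, 'v) rep =
  rep_scale :: "complex \<Rightarrow> 'v \<Rightarrow> 'v"
  rep_space :: "'v set"
  rep_act :: "'g \<Rightarrow> 'v \<Rightarrow> 'v"

text \<open>The representation space is a linear subspace of the ambient type; the action is only
  constrained on that subspace.\<close>

definition representation ::
    "('g, 'm) monoid_scheme \<Rightarrow> ('g, 'v::ab_group_add) rep \<Rightarrow> bool" where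
  "representation G R \<longleftrightarrow>
     group G \<and> vector_space (rep_scale R) \<and> module.subspace (rep_scale R) (rep_space R) \<and>
     (\<forall>g\<in>carrier G. \<forall>v\<in>rep_space R. rep_act R g v \<in> rep_space R) \<and>
     (\<forall>g\<in>carrier G. \<forall>v\<in>rep_space R. \<forall>w\<in>rep_space R.
        rep_act R g (v + w) = rep_act R g v + rep_act R g w) \<and>
     (\<forall>g\<in>carrier G. \<forall>a. \<forall>v\<in>rep_space R.
        rep_act R g (rep_scale R a v) = rep_scale R a (rep_act R g v)) \<and>
     (\<forall>v\<in>rep_space R. rep_act R \<one>\<^bsub>G\<^esub> v = v) \<and>
     (\<forall>g\<in>carrier G. \<forall>h\<in>carrier G. \<forall>v\<in>rep_space R.
        rep_act R (g \<otimes>\<^bsub>G\<^esub> h) v = rep_act R g (rep_act R h v))"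

definition rep_isomorphic ::
    "('g, 'm) monoid_scheme \<Rightarrow> ('g, 'v::ab_group_add) rep \<Rightarrow> ('g, 'w::ab_group_add) rep \<Rightarrow> bool"
  where
  "rep_isomorphic G R S \<longleftrightarrow>
     representation G R \<and> representation G S \<and>
     (\<exists>\<phi>. bij_betw \<phi> (rep_space R) (rep_space S) \<and>
        (\<forall>v\<in>rep_space R. \<forall>w\<in>rep_space R. \<phi> (v + w) = \<phi> v + \<phi> w) \<and>
        (\<forall>a. \<forall>v\<in>rep_space R. \<phi> (rep_scale R a v) = rep_scale S a (\<phi> v)) \<and>
        (\<forall>g\<in>carrier G. \<forall>v\<in>rep_space R. \<phi> (rep_act R g v) = rep_act S g (\<phi> v)))"

definition irreducible_rep ::
    "('g, 'm) monoid_scheme \<Rightarrow> ('g, 'v::ab_group_add) rep \<Rightarrow> bool" where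
  "irreducible_rep G R \<longleftrightarrow>
     representation G R \<and> rep_space R \<noteq> {0} \<and>
     (\<forall>W. module.subspace (rep_scale R) W \<and> W \<subseteq> rep_space R \<and>
          (\<forall>g\<in>carrier G. \<forall>w\<in>W. rep_act R g w \<in> W) \<longrightarrow> W = {0} \<or> W = rep_space R)"

definition char_rep :: "('g \<Rightarrow> complex) \<Rightarrow> ('g, complex) rep" where
  "char_rep \<chi> = \<lparr>rep_scale = (*), rep_space = UNIV, rep_act = (\<lambda>g z. \<chi> g * z)\<rparr>"

text \<open>The tensor product with the one-dimensional representation \<open>char_rep \<chi>\<close>, on the
  space of \<open>R\<close> itself (via \<open>v \<otimes> 1 \<mapsto> v\<close>).\<close>

definition tensor_char :: "('g, 'v) rep \<Rightarrow> ('g \<Rightarrow> complex) \<Rightarrow> ('g, 'v) rep" where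
  "tensor_char R \<chi> =
     \<lparr>rep_scale = rep_scale R, rep_space = rep_space R,
      rep_act = (\<lambda>g v. rep_scale R (\<chi> g) (rep_act R g v))\<rparr>"

text \<open>The representation of \<open>G\<close> induced from the representation \<open>R\<close> of the subgroup \<open>H\<close>:
  maps \<open>f\<close> from \<open>G\<close> to \<open>R\<close> with \<open>f (g h) = h\<inverse> (f g)\<close> for \<open>h \<in> H\<close>, where \<open>s \<in> G\<close> acts by
  \<open>(s f) g = f (s\<inverse> g)\<close>. (This is the usual model for finite \<open>G\<close>; the maps are extended
  by \<open>0\<close> outside the carrier.)\<close>

definition induced_rep ::
    "('g, 'm) monoid_scheme \<Rightarrow> 'g set \<Rightarrow> ('g, 'w::zero) rep \<Rightarrow> ('g, 'g \<Rightarrow> 'w) rep" where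
  "induced_rep G H R =
     \<lparr>rep_scale = (\<lambda>a f g. rep_scale R a (f g)),
      rep_space = {f. (\<forall>g\<in>carrier G. f g \<in> rep_space R) \<and> (\<forall>g. g \<notin> carrier G \<longrightarrow> f g = 0) \<and>
        (\<forall>g\<in>carrier G. \<forall>h\<in>H. f (g \<otimes>\<^bsub>G\<^esub> h) = rep_act R (inv\<^bsub>G\<^esub> h) (f g))},
      rep_act = (\<lambda>s f g. if g \<in> carrier G then f (inv\<^bsub>G\<^esub> s \<otimes>\<^bsub>G\<^esub> g) else 0)\<rparr>"


section \<open>Representations of the symmetric group\<close>

definition sign_char :: "(nat \<Rightarrow> nat) \<Rightarrow> complex" where
  "sign_char \<sigma> = of_int (sign \<sigma>)"

text \<open>The reflection representation of \<open>S\<^sub>N\<close>: the vectors in \<open>\<complex>\<^sup>N\<close> with coordinate sum \<open>0\<close>,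
  with \<open>\<sigma> e\<^sub>i = e\<^sub>\<sigma>\<^sub>i\<close>.\<close>

definition reflection_rep :: "nat \<Rightarrow> (nat \<Rightarrow> nat, nat \<Rightarrow> complex) rep" where
  "reflection_rep N =
     \<lparr>rep_scale = (\<lambda>a v i. a * v i),
      rep_space = {v. (\<forall>i. i \<notin> {1..N} \<longrightarrow> v i = 0) \<and> (\<Sum>i=1..N. v i) = 0},
      rep_act = (\<lambda>\<sigma> v i. v (inv' \<sigma> i))\<rparr>"

text \<open>Specht modules. A partition is given by its list of parts, cells are pairs (row, column)
  counted from \<open>0\<close>, and a tabloid is the map sending a row index to its set of entries.
  The permutation module on tabloids consists of complex functions of tabloids.\<close>

definition cells :: "nat list \<Rightarrow> (nat \<times> nat) set" where
  "cells lam = {(r, c). r < length lam \<and> c < lam ! r}"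

definition tableaux :: "nat list \<Rightarrow> (nat \<times> nat \<Rightarrow> nat) set" where
  "tableaux lam = {T. bij_betw T (cells lam) {1..sum_list lam}}"

definition tabloid :: "nat list \<Rightarrow> (nat \<times> nat \<Rightarrow> nat) \<Rightarrow> nat \<Rightarrow> nat set" where
  "tabloid lam T r = {T (r, c) |c. (r, c) \<in> cells lam}"

definition tableau_column :: "nat list \<Rightarrow> (nat \<times> nat \<Rightarrow> nat) \<Rightarrow> nat \<Rightarrow> nat set" where
  "tableau_column lam T c = {T (r, c) |r. (r, c) \<in> cells lam}"

definition column_stabilizer :: "nat list \<Rightarrow> (nat \<times> nat \<Rightarrow> nat) \<Rightarrow> (nat \<Rightarrow> nat) set" where
  "column_stabilizer lam T =
     {\<pi>. \<pi> permutes {1..sum_list lam} \<and> (\<forall>c. \<pi> ` tableau_column lam T c = tableau_column lam T c)}"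

definition tabloid_act :: "(nat \<Rightarrow> nat) \<Rightarrow> (nat \<Rightarrow> nat set) \<Rightarrow> nat \<Rightarrow> nat set" where
  "tabloid_act \<sigma> t r = \<sigma> ` t r"

definition polytabloid :: "nat list \<Rightarrow> (nat \<times> nat \<Rightarrow> nat) \<Rightarrow> (nat \<Rightarrow> nat set) \<Rightarrow> complex" where
  "polytabloid lam T t =
     (\<Sum>\<pi>\<in>column_stabilizer lam T. if tabloid_act \<pi> (tabloid lam T) = t then sign_char \<pi> else 0)"

definition specht_rep :: "nat list \<Rightarrow> (nat \<Rightarrow> nat, (nat \<Rightarrow> nat set) \<Rightarrow> complex) rep" where
  "specht_rep lam =
     \<lparr>rep_scale = (\<lambda>a f t. a * f t),
      rep_space = module.span (\<lambda>a f t. a * f t) (polytabloid lam ` tableaux lam),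
      rep_act = (\<lambda>\<sigma> f t. f (tabloid_act (inv' \<sigma>) t))\<rparr>"

definition long_cycle :: "nat \<Rightarrow> nat \<Rightarrow> nat" where
  "long_cycle N = cycle_of_list [1..<Suc N]"

definition cyclic_subgroup :: "nat \<Rightarrow> (nat \<Rightarrow> nat) set" where
  "cyclic_subgroup N = generate (sym_group N) {long_cycle N}"

text \<open>The character \<open>c ^ k \<mapsto> exp (2 \<pi> i k / N)\<close> of the cyclic subgroup.\<close>

definition zeta :: "nat \<Rightarrow> (nat \<Rightarrow> nat) \<Rightarrow> complex" where
  "zeta N \<sigma> = exp (2 * of_real pi * \<i> / of_nat N) ^ (LEAST k. \<sigma> = long_cycle N ^^ k)"

lemma long_cycle_funpow_eq_iff:
  assumes "N \<ge> 1"
  shows "long_cycle N ^^ j = long_cycle N ^^ k \<longleftrightarrow> j mod N = k mod N"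
proof
  let ?c = "[1..<Suc N]"
  have rot: "map (long_cycle N ^^ k) ?c = rotate k ?c" for k
    unfolding long_cycle_def by (rule cyclic_rotation) simp
  have hd: "(long_cycle N ^^ k) 1 = Suc (k mod N)" for k
  proof -
    have "(long_cycle N ^^ k) 1 = map (long_cycle N ^^ k) ?c ! 0"
      using assms by (simp add: nth_map nth_append del: upt_Suc)
    also have "\<dots> = rotate k ?c ! 0" by (simp only: rot)
    also have "\<dots> = Suc (k mod N)"
      using assms by (subst nth_rotate) (simp_all del: upt_Suc)
    finally show ?thesis .
  qed
  show "j mod N = k mod N" if "long_cycle N ^^ j = long_cycle N ^^ k"
    using hd[of j] hd[of k] that by simp
  show "long_cycle N ^^ j = long_cycle N ^^ k" if "j mod N = k mod N"
  proof -
    have id: "long_cycle N ^^ N = id"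
      using cycle_is_id_root[of ?c] unfolding long_cycle_def by (simp del: upt_Suc)
    have "long_cycle N ^^ k = long_cycle N ^^ (k mod N)" for k
    proof -
      have "long_cycle N ^^ k = long_cycle N ^^ (N * (k div N) + k mod N)" by simp
      also have "\<dots> = (long_cycle N ^^ N) ^^ (k div N) \<circ> long_cycle N ^^ (k mod N)"
        by (simp only: funpow_add funpow_mult)
      finally show ?thesis by (simp add: id)
    qed
    then show ?thesis using that by metis
  qed
qed

lemma zeta_long_cycle_funpow:
  assumes "N \<ge> 1"
  shows "zeta N (long_cycle N ^^ k) = exp (2 * of_real pi * \<i> / of_nat N) ^ k"
proof -
  let ?w = "exp (2 * of_real pi * \<i> / of_nat N) :: complex"
  have w: "?w ^ N = 1"
    using assms by (simp flip: exp_of_nat_mult add: exp_two_pi_i)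
  have red: "?w ^ j = ?w ^ (j mod N)" for j
  proof -
    have "?w ^ j = ?w ^ (N * (j div N) + j mod N)" by simp
    also have "\<dots> = (?w ^ N) ^ (j div N) * ?w ^ (j mod N)" by (simp only: power_add power_mult)
    finally show ?thesis by (simp only: w power_one mult_1)
  qed
  define l where "l = (LEAST j. long_cycle N ^^ k = long_cycle N ^^ j)"
  have "long_cycle N ^^ k = long_cycle N ^^ l"
    unfolding l_def by (rule LeastI) (rule refl)
  then have "k mod N = l mod N" using long_cycle_funpow_eq_iff[OF assms] by blast
  then have "?w ^ l = ?w ^ k" using red by metis
  then show ?thesis by (simp add: zeta_def l_def)
qed

definition Lie_rep :: "nat \<Rightarrow> (nat \<Rightarrow> nat, (nat \<Rightarrow> nat) \<Rightarrow> complex) rep" where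
  "Lie_rep n = induced_rep (sym_group (n + 1)) (cyclic_subgroup (n + 1)) (char_rep (zeta (n + 1)))"


section \<open>Polynomials\<close>

type_synonym cpoly = "(nat \<Rightarrow>\<^sub>0 nat) \<Rightarrow>\<^sub>0 complex"

definition poly_var :: "nat \<Rightarrow> cpoly" where
  "poly_var i = Poly_Mapping.single (Poly_Mapping.single i 1) 1"

definition poly_const :: "complex \<Rightarrow> cpoly" where
  "poly_const a = Poly_Mapping.single 0 a"

definition poly_scale :: "complex \<Rightarrow> cpoly \<Rightarrow> cpoly" where
  "poly_scale a p = poly_const a * p"

definition homogeneous :: "nat \<Rightarrow> cpoly \<Rightarrow> bool" where
  "homogeneous k p \<longleftrightarrow>
     (\<forall>m\<in>Poly_Mapping.keys p. (\<Sum>i\<in>Poly_Mapping.keys m. Poly_Mapping.lookup m i) = k)"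

text \<open>Substitution of \<open>x\<^sub>\<sigma>\<^sub>i\<close> for \<open>x\<^sub>i\<close>.\<close>

definition permute_vars :: "(nat \<Rightarrow> nat) \<Rightarrow> cpoly \<Rightarrow> cpoly" where
  "permute_vars \<sigma> p =
     (\<Sum>m\<in>Poly_Mapping.keys p. poly_const (Poly_Mapping.lookup p m) *
        (\<Prod>i\<in>Poly_Mapping.keys m. poly_var (\<sigma> i) ^ Poly_Mapping.lookup m i))"


section \<open>Slim subgraphs\<close>

definition complete_edges :: "nat \<Rightarrow> nat set set" where
  "complete_edges N = {e. e \<subseteq> {1..N} \<and> card e = 2}"

definition connected_graph :: "nat set \<Rightarrow> nat set set \<Rightarrow> bool" where
  "connected_graph A E \<longleftrightarrow> (\<forall>u\<in>A. \<forall>v\<in>A. (u, v) \<in> {(a, b). {a, b} \<in> E}\<^sup>*)"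

definition slim :: "nat \<Rightarrow> nat set set \<Rightarrow> bool" where
  "slim n G \<longleftrightarrow>
     G \<subseteq> complete_edges (n + 1) \<and> connected_graph {1..n + 1} (complete_edges (n + 1) - G)"

definition edge_poly :: "nat set \<Rightarrow> cpoly" where
  "edge_poly e = poly_var (Min e) - poly_var (Max e)"

definition graph_poly :: "nat set set \<Rightarrow> cpoly" where
  "graph_poly G = (\<Prod>e\<in>G. edge_poly e)"

definition slim_module :: "nat \<Rightarrow> cpoly set" where
  "slim_module n = module.span poly_scale {graph_poly G |G. slim n G}"

definition V_deg :: "nat \<Rightarrow> nat \<Rightarrow> cpoly set" where
  "V_deg n k = {p \<in> slim_module n. homogeneous k p}"

definition V_rep :: "nat \<Rightarrow> nat \<Rightarrow> (nat \<Rightarrow> nat, cpoly) rep" where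
  "V_rep n k = \<lparr>rep_scale = poly_scale, rep_space = V_deg n k, rep_act = permute_vars\<rparr>"

lemma vector_space_poly_scale: "vector_space poly_scale"
  by unfold_locales
    (simp_all add: poly_scale_def poly_const_def distrib_left distrib_right single_add mult_single
      flip: mult.assoc)

lemma homogeneous_mult:
  assumes "homogeneous j p" "homogeneous k q"
  shows "homogeneous (j + k) (p * q)"
  unfolding homogeneous_def
proof
  let ?d = "\<lambda>m :: nat \<Rightarrow>\<^sub>0 nat. \<Sum>i\<in>Poly_Mapping.keys m. Poly_Mapping.lookup m i"
  have d_add: "?d (a + b) = ?d a + ?d b" for a b
  proof -
    let ?K = "Poly_Mapping.keys a \<union> Poly_Mapping.keys b"
    have d: "?d m = (\<Sum>i\<in>?K. Poly_Mapping.lookup m i)" if "Poly_Mapping.keys m \<subseteq> ?K" for m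
      using that by (intro sum.mono_neutral_left) (auto simp: in_keys_iff)
    show ?thesis
      using d[of a] d[of b] d[of "a + b"] keys_add[of a b] by (simp add: lookup_add sum.distrib)
  qed
  fix m assume "m \<in> Poly_Mapping.keys (p * q)"
  then obtain a b where "m = a + b" "a \<in> Poly_Mapping.keys p" "b \<in> Poly_Mapping.keys q"
    using keys_mult[of p q] by blast
  then show "?d m = j + k"
    using assms d_add[of a b] by (auto simp: homogeneous_def)
qed

lemma homogeneous_edge_poly: "homogeneous 1 (edge_poly e)"
  using keys_diff[of "poly_var (Min e)" "poly_var (Max e)"]
  by (auto simp: homogeneous_def edge_poly_def poly_var_def)

lemma homogeneous_graph_poly:
  assumes "finite G"
  shows "homogeneous (card G) (graph_poly G)"
  using assms
proof (induction G rule: finite_induct)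
  case empty
  show ?case by (simp add: homogeneous_def graph_poly_def)
next
  case (insert e G)
  then show ?case
    using homogeneous_mult[OF homogeneous_edge_poly, of "card G" "graph_poly G" e]
    by (simp add: graph_poly_def)
qed

lemma slim_module_graded: "slim_module n = module.span poly_scale (\<Union>k. V_deg n k)"
proof -
  interpret vector_space poly_scale by (rule vector_space_poly_scale)
  have "graph_poly G \<in> V_deg n (card G)" if "slim n G" for G
  proof -
    have "finite G"
      using that by (intro finite_subset[of G "Pow {1..n+1}"]) (auto simp: slim_def complete_edges_def)
    then show ?thesis
      using that homogeneous_graph_poly[of G] by (auto simp: V_deg_def slim_module_def intro: span_base)
  qed
  then have "{graph_poly G |G. slim n G} \<subseteq> (\<Union>k. V_deg n k)" by blast
  then have "slim_module n \<subseteq> span (\<Union>k. V_deg n k)"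
    unfolding slim_module_def by (rule span_mono)
  moreover have "span (\<Union>k. V_deg n k) \<subseteq> slim_module n"
    unfolding slim_module_def
    by (rule span_minimal) (auto simp: V_deg_def slim_module_def subspace_span)
  ultimately show ?thesis by blast
qed

end

theory Submission
  imports Defs
begin

text \<open>In degree \<open>k < n\<close> every graph with \<open>k\<close> edges is slim, and a repeated edge can be replaced by
  a detour through an unused vertex, so products of \<open>k\<close> linear forms are spanned by slim graphs.

  In top degree the complement of \<open>G\<close> is a spanning tree, so up to the Vandermonde product (which
  accounts for the sign) the module is spanned by the inverses of the products of \<open>x\<^sub>i - x\<^sub>j\<close> over
  the edges of a tree. Partial fractions reduce these to the paths starting at \<open>1\<close>, which are
  linearly independent. With \<open>N = n + 1\<close> and \<open>\<omega> = exp (2 \<pi> i / N)\<close>, the map sending a path \<open>w\<close> to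
  \<open>\<omega>\<close> to the power \<open>- maj w\<close> (up to a constant) respects partial fractions, because it is the
  restriction to paths of a product formula over the edges of a tree. As adding \<open>1\<close> modulo \<open>N\<close> to
  all letters lowers \<open>maj\<close> by \<open>1\<close>, this functional defines by Frobenius reciprocity a map to the
  induced representation. Rotating the positions of \<open>w\<close> changes \<open>maj\<close> by the number of cyclic
  descents, which is \<open>1\<close> only for the rotations of the identity; hence the \<open>\<omega>\<close>-twisted sum over
  these rotations is mapped to a generator of the induced representation (Klyachko's argument),
  and both sides have dimension \<open>n!\<close>.\<close>

text \<open>A functional on the top degree may be chosen freely on the paths from \<open>1\<close>,
  but equivariance under the long cycle, which moves \<open>1\<close>, involves its values on paths
  with \<open>1\<close> in any position. So the values are prescribed on all trees rooted at
  \<open>1\<close>, by the hook length product for the major index over the linear extensions of a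
  tree, specialised to q = \<omega>. The root would contribute 1 - \<omega>^N = 0 and is left out;
  every other subtree has a size strictly between 0 and N, so no denominator vanishes. Deleting an
  edge leaves parts of sizes s and N - s, and since \<omega>^N = 1 the weight of a reversed edge
  differs only by a sign, the same sign as that of reversing x_i - x_j. Hence the weight of a path
  is given by one formula wherever \<open>1\<close> lies on it.

  The words fixing \<open>1\<close> play two roles: they index the basis of paths, and they
  represent the cosets of the cyclic subgroup. The translates of Klyachko's element by these words
  therefore have disjointly supported images, which yields independence, injectivity and
  surjectivity together.\<close>

interpretation cpoly: vector_space poly_scale
  by (rule vector_space_poly_scale)

section \<open>Substitution homomorphisms\<close>

definition monomial_value :: "(nat \<Rightarrow> 'a::comm_ring_1) \<Rightarrow> (nat \<Rightarrow>\<^sub>0 nat) \<Rightarrow> 'a" where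
  "monomial_value x m = (\<Prod>i\<in>Poly_Mapping.keys m. x i ^ Poly_Mapping.lookup m i)"

text \<open>The coefficient map is a parameter so that two substitutions share one theory: with
  \<open>poly_const\<close> it renames variables, as in \<open>permute_vars\<close>; with the
  identity it evaluates at complex numbers, as the limit argument for linear independence
  requires.\<close>

definition poly_subst :: "(complex \<Rightarrow> 'a) \<Rightarrow> (nat \<Rightarrow> 'a) \<Rightarrow> cpoly \<Rightarrow> 'a::comm_ring_1" where
  "poly_subst \<kappa> x p = (\<Sum>m\<in>Poly_Mapping.keys p. \<kappa> (Poly_Mapping.lookup p m) * monomial_value x m)"

lemma monomial_value_superset:
  assumes "finite K" "Poly_Mapping.keys m \<subseteq> K"
  shows "monomial_value x m = (\<Prod>i\<in>K. x i ^ Poly_Mapping.lookup m i)"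
  unfolding monomial_value_def using assms
  by (intro prod.mono_neutral_left) (auto simp: in_keys_iff)

lemma monomial_value_zero [simp]: "monomial_value x 0 = 1"
  by (simp add: monomial_value_def)

lemma monomial_value_single [simp]: "monomial_value x (Poly_Mapping.single i k) = x i ^ k"
  by (cases "k = 0") (simp_all add: monomial_value_def)

lemma monomial_value_add: "monomial_value x (a + b) = monomial_value x a * monomial_value x b"
proof -
  let ?K = "Poly_Mapping.keys a \<union> Poly_Mapping.keys b"
  have "monomial_value x (a + b) = (\<Prod>i\<in>?K. x i ^ Poly_Mapping.lookup (a + b) i)"
    using keys_add[of a b] by (intro monomial_value_superset) auto
  also have "\<dots> = (\<Prod>i\<in>?K. x i ^ Poly_Mapping.lookup a i) * (\<Prod>i\<in>?K. x i ^ Poly_Mapping.lookup b i)"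
    by (simp add: lookup_add power_add prod.distrib)
  also have "\<dots> = monomial_value x a * monomial_value x b"
    by (subst (1 2) monomial_value_superset[of ?K]) auto
  finally show ?thesis .
qed

lemma sum_single_lookup: "p = (\<Sum>m\<in>Poly_Mapping.keys p. Poly_Mapping.single m (Poly_Mapping.lookup p m))"
  by (rule poly_mapping_eqI)
    (auto simp: lookup_sum lookup_single when_def sum.delta' in_keys_iff)

locale coefficient_hom =
  fixes \<kappa> :: "complex \<Rightarrow> 'a::comm_ring_1"
  assumes hom_zero: "\<kappa> 0 = 0" and hom_one: "\<kappa> 1 = 1"
    and hom_add: "\<kappa> (a + b) = \<kappa> a + \<kappa> b" and hom_mult: "\<kappa> (a * b) = \<kappa> a * \<kappa> b"
begin

lemma subst_superset:
  assumes "finite K" "Poly_Mapping.keys p \<subseteq> K"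
  shows "poly_subst \<kappa> x p = (\<Sum>m\<in>K. \<kappa> (Poly_Mapping.lookup p m) * monomial_value x m)"
  unfolding poly_subst_def using assms
  by (intro sum.mono_neutral_left) (auto simp: in_keys_iff hom_zero)

lemma subst_zero [simp]: "poly_subst \<kappa> x 0 = 0"
  by (simp add: poly_subst_def)

lemma subst_single: "poly_subst \<kappa> x (Poly_Mapping.single m a) = \<kappa> a * monomial_value x m"
  by (cases "a = 0") (simp_all add: poly_subst_def hom_zero)

lemma subst_one [simp]: "poly_subst \<kappa> x 1 = 1"
  using subst_single[of x 0 1] by (simp add: hom_one)

lemma subst_const [simp]: "poly_subst \<kappa> x (poly_const a) = \<kappa> a"
  by (simp add: poly_const_def subst_single)

lemma subst_var [simp]: "poly_subst \<kappa> x (poly_var i) = x i"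
  by (simp add: poly_var_def subst_single hom_one)

lemma subst_add: "poly_subst \<kappa> x (p + q) = poly_subst \<kappa> x p + poly_subst \<kappa> x q"
proof -
  let ?K = "Poly_Mapping.keys p \<union> Poly_Mapping.keys q"
  have "poly_subst \<kappa> x (p + q) = (\<Sum>m\<in>?K. \<kappa> (Poly_Mapping.lookup (p + q) m) * monomial_value x m)"
    using keys_add[of p q] by (intro subst_superset) auto
  also have "\<dots> = (\<Sum>m\<in>?K. \<kappa> (Poly_Mapping.lookup p m) * monomial_value x m)
      + (\<Sum>m\<in>?K. \<kappa> (Poly_Mapping.lookup q m) * monomial_value x m)"
    by (simp add: lookup_add hom_add distrib_right sum.distrib)
  also have "\<dots> = poly_subst \<kappa> x p + poly_subst \<kappa> x q"
    by (subst (1 2) subst_superset[of ?K]) auto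
  finally show ?thesis .
qed

lemma subst_sum: "poly_subst \<kappa> x (\<Sum>i\<in>A. f i) = (\<Sum>i\<in>A. poly_subst \<kappa> x (f i))"
  by (induction A rule: infinite_finite_induct) (simp_all add: subst_add)

lemma subst_minus: "poly_subst \<kappa> x (- p) = - poly_subst \<kappa> x p"
  using subst_add[of x p "- p"] by (simp add: add_eq_0_iff)

lemma subst_diff: "poly_subst \<kappa> x (p - q) = poly_subst \<kappa> x p - poly_subst \<kappa> x q"
  using subst_add[of x p "- q"] by (simp add: subst_minus)

lemma subst_mult: "poly_subst \<kappa> x (p * q) = poly_subst \<kappa> x p * poly_subst \<kappa> x q"
proof -
  have "poly_subst \<kappa> x (p * q) = poly_subst \<kappa> x
     ((\<Sum>a\<in>Poly_Mapping.keys p. Poly_Mapping.single a (Poly_Mapping.lookup p a))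
      * (\<Sum>b\<in>Poly_Mapping.keys q. Poly_Mapping.single b (Poly_Mapping.lookup q b)))"
    by (simp flip: sum_single_lookup)
  also have "\<dots> = (\<Sum>a\<in>Poly_Mapping.keys p. \<Sum>b\<in>Poly_Mapping.keys q.
      (\<kappa> (Poly_Mapping.lookup p a) * monomial_value x a) *
      (\<kappa> (Poly_Mapping.lookup q b) * monomial_value x b))"
    by (simp add: sum_product mult_single subst_sum subst_single hom_mult monomial_value_add ac_simps)
  also have "\<dots> = poly_subst \<kappa> x p * poly_subst \<kappa> x q"
    by (simp add: poly_subst_def sum_product)
  finally show ?thesis .
qed

lemma subst_prod: "poly_subst \<kappa> x (\<Prod>i\<in>A. f i) = (\<Prod>i\<in>A. poly_subst \<kappa> x (f i))"
  by (induction A rule: infinite_finite_induct) (simp_all add: subst_mult)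

lemma subst_power: "poly_subst \<kappa> x (p ^ k) = poly_subst \<kappa> x p ^ k"
  by (induction k) (simp_all add: subst_mult)

lemma subst_scale: "poly_subst \<kappa> x (poly_scale a p) = \<kappa> a * poly_subst \<kappa> x p"
  by (simp add: poly_scale_def subst_mult)

end

interpretation const_hom: coefficient_hom poly_const
  by unfold_locales (simp_all add: poly_const_def single_add mult_single)

interpretation eval_hom: coefficient_hom "\<lambda>a. a"
  by unfold_locales simp_all

lemma permute_vars_eq_subst: "permute_vars \<sigma> = poly_subst poly_const (\<lambda>i. poly_var (\<sigma> i))"
  by (rule ext) (simp add: permute_vars_def poly_subst_def monomial_value_def)

lemma permute_vars_var [simp]: "permute_vars \<sigma> (poly_var i) = poly_var (\<sigma> i)"
  by (simp add: permute_vars_eq_subst)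

lemma permute_vars_const [simp]: "permute_vars \<sigma> (poly_const a) = poly_const a"
  by (simp add: permute_vars_eq_subst)

lemmas permute_vars_hom =
  const_hom.subst_add[of "\<lambda>i. poly_var (\<sigma> i)" for \<sigma>, folded permute_vars_eq_subst]
  const_hom.subst_minus[of "\<lambda>i. poly_var (\<sigma> i)" for \<sigma>, folded permute_vars_eq_subst]
  const_hom.subst_diff[of "\<lambda>i. poly_var (\<sigma> i)" for \<sigma>, folded permute_vars_eq_subst]
  const_hom.subst_mult[of "\<lambda>i. poly_var (\<sigma> i)" for \<sigma>, folded permute_vars_eq_subst]
  const_hom.subst_sum[of "\<lambda>i. poly_var (\<sigma> i)" for \<sigma>, folded permute_vars_eq_subst]
  const_hom.subst_prod[of "\<lambda>i. poly_var (\<sigma> i)" for \<sigma>, folded permute_vars_eq_subst]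
  const_hom.subst_power[of "\<lambda>i. poly_var (\<sigma> i)" for \<sigma>, folded permute_vars_eq_subst]
  const_hom.subst_scale[of "\<lambda>i. poly_var (\<sigma> i)" for \<sigma>, folded permute_vars_eq_subst poly_scale_def]
  const_hom.subst_one[of "\<lambda>i. poly_var (\<sigma> i)" for \<sigma>, folded permute_vars_eq_subst]
  const_hom.subst_zero[of "\<lambda>i. poly_var (\<sigma> i)" for \<sigma>, folded permute_vars_eq_subst]

lemma poly_subst_id: "poly_subst poly_const poly_var p = p"
proof -
  have mono: "monomial_value poly_var m = Poly_Mapping.single m 1" for m
  proof (induction m rule: update_induct)
    case const
    then show ?case by simp
  next
    case (update m i k)
    have "Poly_Mapping.update i k m = Poly_Mapping.single i k + m"
      using update by (intro poly_mapping_eqI)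
        (auto simp: lookup_update lookup_add lookup_single when_def in_keys_iff)
    moreover have "poly_var i ^ k = Poly_Mapping.single (Poly_Mapping.single i k) 1" for k
      by (induction k) (simp_all add: poly_var_def mult_single flip: single_add)
    ultimately show ?case using update by (simp add: monomial_value_add mult_single)
  qed
  have "poly_subst poly_const poly_var p
      = (\<Sum>m\<in>Poly_Mapping.keys p. Poly_Mapping.single m (Poly_Mapping.lookup p m))"
    by (simp add: poly_subst_def mono poly_const_def mult_single)
  then show ?thesis by (simp flip: sum_single_lookup)
qed

lemma permute_vars_id [simp]: "permute_vars id p = p" "permute_vars (\<lambda>x. x) p = p"
  by (simp_all add: permute_vars_eq_subst poly_subst_id)

lemma permute_vars_comp: "permute_vars (\<sigma> \<circ> \<tau>) p = permute_vars \<sigma> (permute_vars \<tau> p)"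
  by (simp add: permute_vars_def[of "\<sigma> \<circ> \<tau>"] permute_vars_def[of \<tau>] permute_vars_hom)

section \<open>Homogeneous components of the slim module\<close>

abbreviation monomial_degree :: "(nat \<Rightarrow>\<^sub>0 nat) \<Rightarrow> nat" where
  "monomial_degree m \<equiv> \<Sum>i\<in>Poly_Mapping.keys m. Poly_Mapping.lookup m i"

definition homogeneous_part :: "nat \<Rightarrow> cpoly \<Rightarrow> cpoly" where
  "homogeneous_part k p = Poly_Mapping.mapp (\<lambda>m a. a when monomial_degree m = k) p"

lemma lookup_homogeneous_part:
  "Poly_Mapping.lookup (homogeneous_part k p) m = (Poly_Mapping.lookup p m when monomial_degree m = k)"
  by (auto simp: homogeneous_part_def lookup_mapp when_def in_keys_iff)

lemma lookup_poly_scale [simp]: "Poly_Mapping.lookup (poly_scale a p) m = a * Poly_Mapping.lookup p m"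
proof -
  have "poly_scale a p = Poly_Mapping.map ((*) a) p"
    by (simp add: poly_scale_def poly_const_def mult_map_scale_conv_mult)
  then show ?thesis by (simp add: Poly_Mapping.map.rep_eq when_def)
qed

lemma homogeneous_part_linear: "Vector_Spaces.linear poly_scale poly_scale (homogeneous_part k)"
  by unfold_locales
    (auto intro!: poly_mapping_eqI simp: lookup_homogeneous_part lookup_add when_def)

lemma homogeneous_part_homogeneous:
  assumes "homogeneous j p"
  shows "homogeneous_part k p = (if j = k then p else 0)"
  using assms by (intro poly_mapping_eqI)
    (auto simp: lookup_homogeneous_part homogeneous_def when_def in_keys_iff)

lemma subspace_homogeneous: "cpoly.subspace {p. homogeneous k p}"
  unfolding cpoly.subspace_def homogeneous_def
  by (auto simp: in_keys_iff lookup_add dest!: set_mp[OF keys_add]) 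

lemma finite_complete_edges [simp]: "finite (complete_edges N)"
  by (rule finite_subset[of _ "Pow {1..N}"]) (auto simp: complete_edges_def)

lemma card_complete_edges: "card (complete_edges N) = N choose 2"
  using n_subsets[of "{1..N}" 2] by (simp add: complete_edges_def)

lemma slim_finite: "slim n G \<Longrightarrow> finite G"
  by (auto simp: slim_def intro: finite_subset)

text \<open>The projection to degree \<open>k\<close> is linear and either fixes a generator or
  kills it. Applied to an element of \<open>V_deg n k\<close>, which it fixes, it removes from any
  expansion the graphs whose number of edges is not \<open>k\<close>.\<close>

lemma V_deg_eq_span: "V_deg n k = cpoly.span {graph_poly G |G. slim n G \<and> card G = k}"
proof
  interpret Vector_Spaces.linear poly_scale poly_scale "homogeneous_part k"
    by (rule homogeneous_part_linear)
  let ?S = "{graph_poly G |G. slim n G}" and ?T = "{graph_poly G |G. slim n G \<and> card G = k}"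
  show "V_deg n k \<subseteq> cpoly.span ?T"
  proof
    fix p assume p: "p \<in> V_deg n k"
    then have "p \<in> cpoly.span ?S" "homogeneous_part k p = p"
      using homogeneous_part_homogeneous[of k p k] by (auto simp: V_deg_def slim_module_def)
    then have "p \<in> homogeneous_part k ` cpoly.span ?S" by (intro image_eqI[of p]) simp_all
    then have "p \<in> cpoly.span (homogeneous_part k ` ?S)" by (simp only: span_image)
    moreover have "homogeneous_part k ` ?S \<subseteq> cpoly.span ?T"
    proof clarify
      fix G assume G: "slim n G"
      show "homogeneous_part k (graph_poly G) \<in> cpoly.span ?T"
        using homogeneous_part_homogeneous[OF homogeneous_graph_poly[OF slim_finite[OF G]], of k] G
        by (auto intro: cpoly.span_base cpoly.span_zero)
    qed
    ultimately show "p \<in> cpoly.span ?T"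
      using cpoly.span_minimal[OF _ cpoly.subspace_span] by blast
  qed
  have "?T \<subseteq> {p. homogeneous k p}"
    by (auto intro: homogeneous_graph_poly slim_finite)
  then have "cpoly.span ?T \<subseteq> {p. homogeneous k p}"
    by (rule cpoly.span_minimal[OF _ subspace_homogeneous])
  moreover have "cpoly.span ?T \<subseteq> cpoly.span ?S" by (rule cpoly.span_mono) auto
  ultimately show "cpoly.span ?T \<subseteq> V_deg n k" by (auto simp: V_deg_def slim_module_def)
qed

lemma subspace_V_deg: "cpoly.subspace (V_deg n k)"
  by (simp add: V_deg_eq_span cpoly.subspace_span)

lemma graph_poly_in_V_deg: "slim n G \<Longrightarrow> graph_poly G \<in> V_deg n (card G)"
  by (auto simp: V_deg_eq_span intro: cpoly.span_base)

section \<open>The action of permutations on slim graphs\<close>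

definition unit_sign :: "bool \<Rightarrow> 'a::comm_ring_1" where
  "unit_sign b = (if b then 1 else - 1)"

lemma unit_sign_square [simp]: "unit_sign b * unit_sign b = 1" "unit_sign b * (unit_sign b * x) = x"
  by (auto simp: unit_sign_def)

lemma unit_sign_mult_in_span:
  "p \<in> cpoly.span S \<Longrightarrow> unit_sign b * p \<in> cpoly.span S"
  by (auto simp: unit_sign_def intro: cpoly.span_neg)

lemma edge_poly_pair:
  assumes "a \<noteq> b"
  shows "edge_poly {a, b} = unit_sign (a < b) * (poly_var a - poly_var b)"
  using assms by (auto simp: edge_poly_def unit_sign_def min_def max_def)

lemma complete_edgesE:
  assumes "e \<in> complete_edges N"
  obtains a b where "e = {a, b}" "a < b" "a \<in> {1..N}" "b \<in> {1..N}"
proof -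
  obtain a b where "e = {a, b}" "a \<noteq> b" using assms by (auto simp: complete_edges_def card_2_iff)
  then show ?thesis using assms that[of a b] that[of b a]
    by (cases "a < b") (auto simp: complete_edges_def insert_commute)
qed

lemma pair_in_complete_edges: "{a, b} \<in> complete_edges N \<longleftrightarrow> a \<noteq> b \<and> a \<in> {1..N} \<and> b \<in> {1..N}"
  by (auto simp: complete_edges_def card_insert_if)

lemma permute_vars_edge_poly:
  assumes "inj \<sigma>" "e \<in> complete_edges N"
  shows "\<exists>b. permute_vars \<sigma> (edge_poly e) = unit_sign b * edge_poly (\<sigma> ` e)"
proof -
  obtain i j where e: "e = {i, j}" "i < j" using assms(2) by (rule complete_edgesE)
  then have ne: "\<sigma> i \<noteq> \<sigma> j" using assms(1) by (auto dest: injD)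
  have "permute_vars \<sigma> (edge_poly e) = poly_var (\<sigma> i) - poly_var (\<sigma> j)"
    using e by (simp add: edge_poly_pair unit_sign_def permute_vars_hom)
  also have "\<dots> = unit_sign (\<sigma> i < \<sigma> j) * edge_poly (\<sigma> ` e)"
    using e ne by (simp add: edge_poly_pair)
  finally show ?thesis by blast
qed

lemma inj_image_image: "inj \<sigma> \<Longrightarrow> inj ((`) \<sigma>)"
  by (rule injI) (simp add: inj_image_eq_iff)

text \<open>Renaming vertices may turn the edges against the orientation from \<open>Min\<close> to
  \<open>Max\<close> built into \<open>edge_poly\<close>. The resulting sign is left existential,
  since spans absorb it.\<close>

lemma permute_vars_graph_poly:
  assumes "inj \<sigma>" "G \<subseteq> complete_edges N"
  shows "\<exists>b. permute_vars \<sigma> (graph_poly G) = unit_sign b * graph_poly ((`) \<sigma> ` G)"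
proof -
  have "finite G" using assms(2) by (rule finite_subset) simp
  then show ?thesis using assms(2)
  proof (induction G rule: finite_induct)
    case empty
    have "permute_vars \<sigma> (graph_poly {}) = unit_sign True * graph_poly ((`) \<sigma> ` {})"
      by (simp add: graph_poly_def permute_vars_hom unit_sign_def)
    then show ?case by blast
  next
    case (insert e G)
    then obtain b where b: "permute_vars \<sigma> (graph_poly G) = unit_sign b * graph_poly ((`) \<sigma> ` G)"
      by auto
    obtain c where c: "permute_vars \<sigma> (edge_poly e) = unit_sign c * edge_poly (\<sigma> ` e)"
      using permute_vars_edge_poly[OF assms(1)] insert.prems by blast
    have "\<sigma> ` e \<notin> (`) \<sigma> ` G"
      using insert.hyps inj_image_image[OF assms(1)] by (simp add: inj_image_mem_iff)
    then have "permute_vars \<sigma> (graph_poly (insert e G))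
        = unit_sign b * unit_sign c * graph_poly ((`) \<sigma> ` insert e G)"
      using insert.hyps b c by (simp add: graph_poly_def permute_vars_hom ac_simps)
    moreover have "unit_sign b * unit_sign c = (unit_sign (b = c) :: cpoly)"
      by (auto simp: unit_sign_def)
    ultimately show ?case by metis
  qed
qed

lemma image_complete_edges:
  assumes "\<sigma> permutes {1..N}"
  shows "(`) \<sigma> ` complete_edges N = complete_edges N"
proof -
  have sub: "(`) \<tau> ` complete_edges N \<subseteq> complete_edges N" if "\<tau> permutes {1..N}" for \<tau>
    using that permutes_inj[OF that]
    by (auto simp: complete_edges_def card_image inj_on_subset permutes_in_image)
      (metis in_mono permutes_in_image atLeastAtMost_iff)+
  have "e \<in> (`) \<sigma> ` complete_edges N" if "e \<in> complete_edges N" for e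
  proof
    show "e = \<sigma> ` inv' \<sigma> ` e"
      using permutes_surj[OF assms] by (simp add: image_comp surj_iff)
    show "inv' \<sigma> ` e \<in> complete_edges N"
      using sub[OF permutes_inv[OF assms]] that by blast
  qed
  then show ?thesis using sub[OF assms] by blast
qed

lemma connected_graph_image:
  assumes "connected_graph A E" "f ` A = B"
  shows "connected_graph B ((`) f ` E)"
  unfolding connected_graph_def
proof (intro ballI)
  have "(f u, f v) \<in> {(a, b). {a, b} \<in> (`) f ` E}\<^sup>*" if "(u, v) \<in> {(a, b). {a, b} \<in> E}\<^sup>*" for u v
    using that
  proof induction
    case (step y z)
    then have "(f y, f z) \<in> {(a, b). {a, b} \<in> (`) f ` E}"
      by (auto intro!: image_eqI[of _ _ "{y, z}"])
    then show ?case using step.IH by (rule rtrancl_into_rtrancl[rotated])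
  qed simp
  then show "(u, v) \<in> {(a, b). {a, b} \<in> (`) f ` E}\<^sup>*" if "u \<in> B" "v \<in> B" for u v
    using that assms unfolding connected_graph_def by blast
qed

lemma slim_image:
  assumes "slim n G" "\<sigma> permutes {1..n + 1}"
  shows "slim n ((`) \<sigma> ` G)"
proof -
  have inj: "inj ((`) \<sigma>)" using inj_image_image[OF permutes_inj[OF assms(2)]] .
  have "complete_edges (n + 1) - (`) \<sigma> ` G = (`) \<sigma> ` (complete_edges (n + 1) - G)"
    using image_complete_edges[OF assms(2)] by (simp add: image_set_diff[OF inj])
  moreover have "(`) \<sigma> ` G \<subseteq> complete_edges (n + 1)"
    using assms image_complete_edges[OF assms(2)] unfolding slim_def by blast
  ultimately show ?thesis
    using assms connected_graph_image[OF _ permutes_image[OF assms(2)]] by (simp add: slim_def)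
qed

lemma permute_vars_linear: "Vector_Spaces.linear poly_scale poly_scale (permute_vars \<sigma>)"
  by unfold_locales (simp_all add: permute_vars_hom)

lemma permute_vars_V_deg:
  assumes "\<sigma> permutes {1..n + 1}" "p \<in> V_deg n k"
  shows "permute_vars \<sigma> p \<in> V_deg n k"
proof -
  interpret Vector_Spaces.linear poly_scale poly_scale "permute_vars \<sigma>"
    by (rule permute_vars_linear)
  let ?T = "{graph_poly G |G. slim n G \<and> card G = k}"
  have "permute_vars \<sigma> ` ?T \<subseteq> cpoly.span ?T"
  proof clarify
    fix G assume G: "slim n G" "k = card G"
    have inj: "inj \<sigma>" by (rule permutes_inj[OF assms(1)])
    obtain b where "permute_vars \<sigma> (graph_poly G) = unit_sign b * graph_poly ((`) \<sigma> ` G)"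
      using permute_vars_graph_poly[OF inj, of G "n + 1"] G(1) unfolding slim_def by blast
    moreover have "card ((`) \<sigma> ` G) = card G"
      by (rule card_image) (rule inj_on_subset[OF inj_image_image[OF inj] subset_UNIV])
    then have "graph_poly ((`) \<sigma> ` G) \<in> cpoly.span {graph_poly H |H. slim n H \<and> card H = card G}"
      using slim_image[OF G(1) assms(1)] by (intro cpoly.span_base) blast
    ultimately show "permute_vars \<sigma> (graph_poly G)
        \<in> cpoly.span {graph_poly H |H. slim n H \<and> card H = card G}"
      by (simp add: unit_sign_mult_in_span)
  qed
  then have "cpoly.span (permute_vars \<sigma> ` ?T) \<subseteq> cpoly.span ?T"
    by (simp add: cpoly.span_minimal cpoly.subspace_span)
  then show ?thesis using assms(2) by (auto simp: V_deg_eq_span span_image)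
qed

lemma representation_V_rep: "representation (sym_group (n + 1)) (V_rep n k)"
  using permute_vars_V_deg
  by (auto simp: representation_def V_rep_def sym_group_is_group sym_group_carrier sym_group_mult
      sym_group_one vector_space_poly_scale subspace_V_deg permute_vars_hom permute_vars_comp)

section \<open>Low degrees\<close>

text \<open>Pigeonhole: if each of the other \<open>n - 1\<close> vertices were joined to
  \<open>u\<close> or \<open>v\<close>, picking one such edge for each would inject them into the
  edges of \<open>G\<close> other than \<open>{u, v}\<close>.\<close>

lemma exists_common_non_neighbour:
  assumes "finite G" "u \<noteq> v" "u \<in> {1..n + 1}" "v \<in> {1..n + 1}" "card (G - {{u, v}}) < n - 1"
  obtains w where "w \<in> {1..n + 1}" "w \<noteq> u" "w \<noteq> v" "{u, w} \<notin> G" "{v, w} \<notin> G"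
proof (rule ccontr)
  assume "\<not> thesis"
  with that have all: "{u, w} \<in> G \<or> {v, w} \<in> G" if "w \<in> {1..n + 1} - {u, v}" for w
    using that by blast
  define f where "f w = (if {u, w} \<in> G then {u, w} else {v, w})" for w
  have "inj_on f ({1..n + 1} - {u, v})"
    by (auto simp: inj_on_def f_def doubleton_eq_iff split: if_splits)
  moreover have "f ` ({1..n + 1} - {u, v}) \<subseteq> G - {{u, v}}"
  proof
    fix e assume "e \<in> f ` ({1..n + 1} - {u, v})"
    then obtain w where "w \<in> {1..n + 1} - {u, v}" "e = f w" by blast
    then show "e \<in> G - {{u, v}}" using all[of w] by (auto simp: f_def doubleton_eq_iff)
  qed
  ultimately have "card ({1..n + 1} - {u, v}) \<le> card (G - {{u, v}})"
    using assms(1) by (intro card_inj_on_le) auto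
  moreover have "card ({1..n + 1} - {u, v}) = n - 1"
    using assms by (subst card_Diff_subset) auto
  ultimately show False using assms(5) by simp
qed

text \<open>The complement has diameter at most 2. Two vertices not joined there use up the edge
  between them, so \<open>G\<close> has fewer than \<open>n - 1\<close> further edges and a common
  neighbour in the complement exists.\<close>

lemma slim_of_card_less:
  assumes "G \<subseteq> complete_edges (n + 1)" "card G < n"
  shows "slim n G"
  unfolding slim_def connected_graph_def
proof (intro conjI ballI)
  have fin: "finite G" using assms(1) by (rule finite_subset) simp
  let ?R = "{(a, b). {a, b} \<in> complete_edges (n + 1) - G}"
  fix u v assume uv: "u \<in> {1..n + 1}" "v \<in> {1..n + 1}"
  consider "u = v" | "u \<noteq> v" "{u, v} \<notin> G" | "u \<noteq> v" "{u, v} \<in> G" by blast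
  then show "(u, v) \<in> ?R\<^sup>*"
  proof cases
    case 2
    then have "(u, v) \<in> ?R" using uv by (simp add: pair_in_complete_edges)
    then show ?thesis by blast
  next
    case 3
    then have "card G > 0" using fin by (auto simp: card_gt_0_iff)
    then have "card (G - {{u, v}}) < n - 1" using 3 fin assms(2) by simp
    then obtain w where "w \<in> {1..n + 1}" "w \<noteq> u" "w \<noteq> v" "{u, w} \<notin> G" "{v, w} \<notin> G"
      using exists_common_non_neighbour[OF fin] 3 uv by metis
    then have "(u, w) \<in> ?R" "(w, v) \<in> ?R"
      using uv by (auto simp: pair_in_complete_edges insert_commute)
    then show ?thesis by (meson r_into_rtrancl rtrancl_trans)
  qed simp
qed (rule assms(1))

lemma span_mult_mem:
  assumes "\<And>s t. s \<in> S \<Longrightarrow> t \<in> T \<Longrightarrow> s * t \<in> cpoly.span U"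
    and "p \<in> cpoly.span S" "q \<in> cpoly.span T"
  shows "p * q \<in> cpoly.span U"
  using assms(2)
proof (induction rule: cpoly.span_induct_alt)
  case base
  then show ?case by (simp add: cpoly.span_zero)
next
  case (step c s p)
  have "s * q \<in> cpoly.span U"
    using assms(3)
  proof (induction rule: cpoly.span_induct_alt)
    case base
    then show ?case by (simp add: cpoly.span_zero)
  next
    case (step d t q)
    have "s * (poly_scale d t + q) = poly_scale d (s * t) + s * q"
      by (simp add: poly_scale_def algebra_simps)
    then show ?case using step assms(1)[OF \<open>s \<in> S\<close> \<open>t \<in> T\<close>]
      by (simp add: cpoly.span_add cpoly.span_scale)
  qed
  moreover have "(poly_scale c s + p) * q = poly_scale c (s * q) + p * q"
    by (simp add: poly_scale_def algebra_simps)
  ultimately show ?case using step by (simp add: cpoly.span_add cpoly.span_scale)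
qed

lemma graph_poly_insert: "finite G \<Longrightarrow> e \<notin> G \<Longrightarrow> graph_poly (insert e G) = edge_poly e * graph_poly G"
  by (simp add: graph_poly_def)

text \<open>A repeated edge \<open>{i, j}\<close> is removed by routing it through a vertex \<open>v\<close> joined to neither
  end: \<open>x\<^sub>i - x\<^sub>j = (x\<^sub>i - x\<^sub>v) + (x\<^sub>v - x\<^sub>j)\<close>.\<close>

lemma V_deg_mult:
  assumes "Suc k < n" "p \<in> V_deg n 1" "q \<in> V_deg n k"
  shows "p * q \<in> V_deg n (Suc k)"
  unfolding V_deg_eq_span
proof (rule span_mult_mem[OF _ assms(2,3)[unfolded V_deg_eq_span]])
  let ?U = "{graph_poly G |G. slim n G \<and> card G = Suc k}"
  have ins: "edge_poly e * graph_poly G \<in> cpoly.span ?U"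
    if "e \<in> complete_edges (n + 1)" "e \<notin> G" "slim n G" "card G = k" for e G
  proof -
    have "finite G" using that by (simp add: slim_finite)
    then have card: "card (insert e G) = Suc k" using that by simp
    moreover have "slim n (insert e G)"
      using that assms(1) card by (intro slim_of_card_less) (auto simp: slim_def)
    ultimately have "graph_poly (insert e G) \<in> cpoly.span ?U" by (intro cpoly.span_base) blast
    then show ?thesis using graph_poly_insert[OF \<open>finite G\<close> that(2)] by simp
  qed
  fix s t assume "s \<in> {graph_poly G |G. slim n G \<and> card G = 1}"
    and "t \<in> {graph_poly G |G. slim n G \<and> card G = k}"
  then obtain E G where E: "s = graph_poly E" "slim n E" "card E = 1"
    and G: "t = graph_poly G" "slim n G" "card G = k" by blast
  then obtain e where e: "E = {e}" using card_1_singletonE by blast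
  then have e': "e \<in> complete_edges (n + 1)" "s = edge_poly e"
    using E by (auto simp: slim_def graph_poly_def)
  show "s * t \<in> cpoly.span ?U"
  proof (cases "e \<in> G")
    case False
    then show ?thesis using ins e' G by simp
  next
    case True
    obtain i j where ij: "e = {i, j}" "i < j" "i \<in> {1..n + 1}" "j \<in> {1..n + 1}"
      using e'(1) by (rule complete_edgesE)
    have "card (G - {{i, j}}) < n - 1"
      using True ij G assms(1) slim_finite[OF G(2)] by simp
    then obtain v where v: "v \<in> {1..n + 1}" "v \<noteq> i" "v \<noteq> j" "{i, v} \<notin> G" "{j, v} \<notin> G"
      using exists_common_non_neighbour[OF slim_finite[OF G(2)]] ij by (metis less_irrefl)
    have "edge_poly e = unit_sign (i < v) * edge_poly {i, v} - unit_sign (j < v) * edge_poly {j, v}"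
      using ij v by (simp add: edge_poly_pair) (simp add: unit_sign_def)
    then have "s * t = unit_sign (i < v) * (edge_poly {i, v} * t) - unit_sign (j < v) * (edge_poly {j, v} * t)"
      by (simp add: e'(2) left_diff_distrib mult.assoc)
    then show ?thesis
      using ins[of "{i, v}"] ins[of "{j, v}"] ij v G
      by (simp add: cpoly.span_diff unit_sign_mult_in_span pair_in_complete_edges)
  qed
qed

lemma V_deg_0: "V_deg n 0 = cpoly.span {1}" if "n \<ge> 1"
proof -
  have "slim n {}" using that by (intro slim_of_card_less) auto
  then have "{graph_poly G |G. slim n G \<and> card G = 0} = {1}"
    using slim_finite[of n] by (auto simp: graph_poly_def intro!: exI[of _ "{}"])
  then show ?thesis by (simp add: V_deg_eq_span)
qed

lemma edge_poly_in_V_deg_1: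
  assumes "n \<ge> 2" "e \<in> complete_edges (n + 1)"
  shows "edge_poly e \<in> V_deg n 1"
  using graph_poly_in_V_deg[of n "{e}"] slim_of_card_less[of "{e}" n] assms
  by (simp add: graph_poly_def)

lemma V_deg_eq_span_products:
  assumes "k < n"
  shows "V_deg n k = cpoly.span {(\<Prod>i<k. f i) |f. \<forall>i<k. f i \<in> V_deg n 1}"
proof
  let ?P = "{(\<Prod>i<k. f i) |f. \<forall>i<k. f i \<in> V_deg n 1}"
  have "graph_poly G \<in> ?P" if G: "slim n G" "card G = k" for G
  proof -
    obtain h where h: "bij_betw h {..<k} G"
      using ex_bij_betw_nat_finite[OF slim_finite[OF G(1)]] G(2) by (auto simp: atLeast0LessThan)
    \<comment> \<open>A factor exists only for \<open>0 < k\<close>, and then \<open>k < n\<close>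
      gives \<open>n >= 2\<close>, so a single edge is slim.\<close>
    have "edge_poly (h i) \<in> V_deg n 1" if "i < k" for i
      using h G that assms by (intro edge_poly_in_V_deg_1) (auto simp: slim_def bij_betw_def)
    moreover have "graph_poly G = (\<Prod>i<k. edge_poly (h i))"
      unfolding graph_poly_def by (rule prod.reindex_bij_betw[OF h, symmetric])
    ultimately show ?thesis by blast
  qed
  then show "V_deg n k \<subseteq> cpoly.span ?P"
    unfolding V_deg_eq_span by (intro cpoly.span_mono) blast
  have "(\<Prod>i<j. f i) \<in> V_deg n j" if "\<forall>i<j. f i \<in> V_deg n 1" "j < n" for f j
    using that
  proof (induction j)
    case 0
    then show ?case by (simp add: V_deg_0 cpoly.span_base)
  next
    case (Suc j)
    then show ?case using V_deg_mult[of j n "f j" "\<Prod>i<j. f i"] by (simp add: mult.commute)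
  qed
  then have "?P \<subseteq> V_deg n k" using assms by blast
  then show "cpoly.span ?P \<subseteq> V_deg n k" by (rule cpoly.span_minimal[OF _ subspace_V_deg])
qed

section \<open>Isomorphisms of representations\<close>

lemma vector_space_fun_scale: "vector_space (\<lambda>(a::complex) (f::'b \<Rightarrow> complex) i. a * f i)"
  by unfold_locales (auto simp: algebra_simps)

text \<open>The map is linear on the whole ambient space but bijective only between the
  representation spaces. That \<open>S\<close> is a representation is transported from
  \<open>R\<close> rather than assumed, so it has to be checked for one side of each isomorphism
  only.\<close>

lemma rep_isomorphic_of_linear:
  fixes R :: "('g, 'v::ab_group_add) rep" and S :: "('g, 'w::ab_group_add) rep"
  assumes R: "representation G R"
    and lin: "Vector_Spaces.linear (rep_scale R) (rep_scale S) \<phi>"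
    and inj: "inj_on \<phi> (rep_space R)" and img: "\<phi> ` rep_space R = rep_space S"
    and equi: "\<And>g v. g \<in> carrier G \<Longrightarrow> v \<in> rep_space R \<Longrightarrow> rep_act S g (\<phi> v) = \<phi> (rep_act R g v)"
  shows "rep_isomorphic G R S"
proof -
  interpret \<phi>: Vector_Spaces.linear "rep_scale R" "rep_scale S" \<phi> by (rule lin)
  note R' = R[unfolded representation_def]
  have sub: "module.subspace (rep_scale S) (rep_space S)"
    using \<phi>.subspace_image R' img by metis
  have "group G" using R' by blast
  then have G: "\<one>\<^bsub>G\<^esub> \<in> carrier G" "g \<in> carrier G \<Longrightarrow> h \<in> carrier G \<Longrightarrow> g \<otimes>\<^bsub>G\<^esub> h \<in> carrier G" for g h
    by (auto simp: group_def monoid.one_closed monoid.m_closed)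
  have act: "rep_act R g v \<in> rep_space R" if "g \<in> carrier G" "v \<in> rep_space R" for g v
    using R' that by blast
  have add: "v + w \<in> rep_space R" if "v \<in> rep_space R" "w \<in> rep_space R" for v w
    using R' that by (simp add: \<phi>.vs1.subspace_add)
  have scale: "rep_scale R a v \<in> rep_space R" if "v \<in> rep_space R" for a v
    using R' that by (simp add: \<phi>.vs1.subspace_scale)
  have "rep_act S g (\<phi> v + \<phi> w) = rep_act S g (\<phi> v) + rep_act S g (\<phi> w)"
    if "g \<in> carrier G" "v \<in> rep_space R" "w \<in> rep_space R" for g v w
  proof -
    have "rep_act R g (v + w) = rep_act R g v + rep_act R g w" using R' that by blast
    then have "rep_act S g (\<phi> (v + w)) = \<phi> (rep_act R g v) + \<phi> (rep_act R g w)"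
      using equi[OF that(1) add[OF that(2,3)]] by (simp add: \<phi>.add)
    then show ?thesis using that by (simp add: equi \<phi>.add)
  qed
  moreover have "rep_act S g (rep_scale S a (\<phi> v)) = rep_scale S a (rep_act S g (\<phi> v))"
    if "g \<in> carrier G" "v \<in> rep_space R" for g a v
  proof -
    have "rep_act R g (rep_scale R a v) = rep_scale R a (rep_act R g v)" using R' that by blast
    then have "rep_act S g (\<phi> (rep_scale R a v)) = rep_scale S a (\<phi> (rep_act R g v))"
      using equi[OF that(1) scale[OF that(2)]] by (simp add: \<phi>.scale)
    then show ?thesis using that by (simp add: equi \<phi>.scale)
  qed
  moreover have "rep_act S \<one>\<^bsub>G\<^esub> (\<phi> v) = \<phi> v" if "v \<in> rep_space R" for v
    using R' that G by (simp add: equi)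
  moreover have "rep_act S (g \<otimes>\<^bsub>G\<^esub> h) (\<phi> v) = rep_act S g (rep_act S h (\<phi> v))"
    if "g \<in> carrier G" "h \<in> carrier G" "v \<in> rep_space R" for g h v
    using R' that G act by (simp add: equi)
  ultimately have "representation G S"
    unfolding representation_def
    using \<open>group G\<close> \<phi>.vs2.vector_space_axioms sub act
    by (auto simp: equi simp flip: img)
  then show ?thesis
    using R inj img by (auto simp: rep_isomorphic_def bij_betw_def \<phi>.add \<phi>.scale equi intro!: exI[of _ \<phi>])
qed

text \<open>The inverse is additive and homogeneous on the representation space alone, so it is
  compared with the definition directly instead of being treated as a linear map of ambient
  spaces.\<close>

lemma rep_isomorphic_sym:
  assumes "rep_isomorphic G R S"
  shows "rep_isomorphic G S R"
proof -
  obtain \<phi> where RS: "representation G R" "representation G S"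
    and bij: "bij_betw \<phi> (rep_space R) (rep_space S)"
    and add: "\<And>v w. v \<in> rep_space R \<Longrightarrow> w \<in> rep_space R \<Longrightarrow> \<phi> (v + w) = \<phi> v + \<phi> w"
    and scale: "\<And>a v. v \<in> rep_space R \<Longrightarrow> \<phi> (rep_scale R a v) = rep_scale S a (\<phi> v)"
    and act: "\<And>g v. g \<in> carrier G \<Longrightarrow> v \<in> rep_space R \<Longrightarrow> \<phi> (rep_act R g v) = rep_act S g (\<phi> v)"
    using assms unfolding rep_isomorphic_def by blast
  interpret R: vector_space "rep_scale R" using RS(1) by (simp add: representation_def)
  let ?\<psi> = "inv_into (rep_space R) \<phi>"
  have sub: "R.subspace (rep_space R)" using RS by (simp add: representation_def)
  have \<psi>: "?\<psi> v \<in> rep_space R" "\<phi> (?\<psi> v) = v" if "v \<in> rep_space S" for v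
    using bij that by (auto simp: bij_betw_def inv_into_into f_inv_into_f)
  have inv: "?\<psi> w = v" if "v \<in> rep_space R" "\<phi> v = w" for v w
    using that bij by (auto simp: bij_betw_def inv_into_f_f)
  have "?\<psi> (v + w) = ?\<psi> v + ?\<psi> w" if "v \<in> rep_space S" "w \<in> rep_space S" for v w
    using \<psi> that sub by (intro inv) (auto simp: add R.subspace_add)
  moreover have "?\<psi> (rep_scale S a v) = rep_scale R a (?\<psi> v)" if "v \<in> rep_space S" for a v
    using \<psi> that sub by (intro inv) (auto simp: scale R.subspace_scale)
  moreover have "?\<psi> (rep_act S g v) = rep_act R g (?\<psi> v)" if "g \<in> carrier G" "v \<in> rep_space S" for g v
    using \<psi> that RS(1) by (intro inv) (auto simp: act representation_def)
  ultimately show ?thesis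
    using RS bij_betw_inv_into[OF bij] unfolding rep_isomorphic_def by blast
qed

lemma rep_isomorphic_trans:
  assumes "rep_isomorphic G R S" "rep_isomorphic G S T"
  shows "rep_isomorphic G R T"
proof -
  obtain \<phi> where \<phi>: "bij_betw \<phi> (rep_space R) (rep_space S)"
    "\<forall>v\<in>rep_space R. \<forall>w\<in>rep_space R. \<phi> (v + w) = \<phi> v + \<phi> w"
    "\<forall>a. \<forall>v\<in>rep_space R. \<phi> (rep_scale R a v) = rep_scale S a (\<phi> v)"
    "\<forall>g\<in>carrier G. \<forall>v\<in>rep_space R. \<phi> (rep_act R g v) = rep_act S g (\<phi> v)"
    using assms(1) unfolding rep_isomorphic_def by blast
  obtain \<psi> where \<psi>: "bij_betw \<psi> (rep_space S) (rep_space T)"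
    "\<forall>v\<in>rep_space S. \<forall>w\<in>rep_space S. \<psi> (v + w) = \<psi> v + \<psi> w"
    "\<forall>a. \<forall>v\<in>rep_space S. \<psi> (rep_scale S a v) = rep_scale T a (\<psi> v)"
    "\<forall>g\<in>carrier G. \<forall>v\<in>rep_space S. \<psi> (rep_act S g v) = rep_act T g (\<psi> v)"
    using assms(2) unfolding rep_isomorphic_def by blast
  have "\<phi> v \<in> rep_space S" if "v \<in> rep_space R" for v using \<phi>(1) that by (auto simp: bij_betw_def)
  then have "bij_betw (\<psi> \<circ> \<phi>) (rep_space R) (rep_space T) \<and>
      (\<forall>v\<in>rep_space R. \<forall>w\<in>rep_space R. (\<psi> \<circ> \<phi>) (v + w) = (\<psi> \<circ> \<phi>) v + (\<psi> \<circ> \<phi>) w) \<and>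
      (\<forall>a. \<forall>v\<in>rep_space R. (\<psi> \<circ> \<phi>) (rep_scale R a v) = rep_scale T a ((\<psi> \<circ> \<phi>) v)) \<and>
      (\<forall>g\<in>carrier G. \<forall>v\<in>rep_space R. (\<psi> \<circ> \<phi>) (rep_act R g v) = rep_act T g ((\<psi> \<circ> \<phi>) v))"
    using \<phi> \<psi> bij_betw_trans[OF \<phi>(1) \<psi>(1)] by simp
  then show ?thesis using assms unfolding rep_isomorphic_def by blast
qed

lemma irreducible_rep_transfer:
  assumes "rep_isomorphic G R S" "irreducible_rep G S"
  shows "irreducible_rep G R"
proof -
  obtain \<phi> where RS: "representation G R" "representation G S"
    and bij: "bij_betw \<phi> (rep_space R) (rep_space S)"
    and add: "\<And>v w. v \<in> rep_space R \<Longrightarrow> w \<in> rep_space R \<Longrightarrow> \<phi> (v + w) = \<phi> v + \<phi> w"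
    and scale: "\<And>a v. v \<in> rep_space R \<Longrightarrow> \<phi> (rep_scale R a v) = rep_scale S a (\<phi> v)"
    and act: "\<And>g v. g \<in> carrier G \<Longrightarrow> v \<in> rep_space R \<Longrightarrow> \<phi> (rep_act R g v) = rep_act S g (\<phi> v)"
    using assms(1) unfolding rep_isomorphic_def by blast
  interpret R: vector_space "rep_scale R" using RS(1) by (simp add: representation_def)
  interpret S: vector_space "rep_scale S" using RS(2) by (simp add: representation_def)
  have zero: "0 \<in> rep_space R"
    using RS(1) R.subspace_0 by (simp add: representation_def)
  then have \<phi>0: "\<phi> 0 = 0" using add[of 0 0] by simp
  have img: "\<phi> ` rep_space R = rep_space S" and inj: "inj_on \<phi> (rep_space R)"
    using bij by (auto simp: bij_betw_def)
  have ne: "rep_space R \<noteq> {0}"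
    using assms(2) img \<phi>0 by (auto simp: irreducible_rep_def)
  have "W = {0} \<or> W = rep_space R"
    if W: "R.subspace W" "W \<subseteq> rep_space R" "\<forall>g\<in>carrier G. \<forall>w\<in>W. rep_act R g w \<in> W" for W
  proof -
    have WR: "w \<in> rep_space R" if "w \<in> W" for w using W(2) that by blast
    have "S.subspace (\<phi> ` W)"
    proof (rule S.subspaceI)
      show "0 \<in> \<phi> ` W" using R.subspace_0[OF W(1)] \<phi>0 by force
      show "x + y \<in> \<phi> ` W" if xy: "x \<in> \<phi> ` W" "y \<in> \<phi> ` W" for x y
      proof -
        obtain v w where "v \<in> W" "w \<in> W" "x = \<phi> v" "y = \<phi> w" using xy by blast
        then have "x + y = \<phi> (v + w)" "v + w \<in> W"
          using add WR R.subspace_add[OF W(1)] by auto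
        then show ?thesis by blast
      qed
      show "rep_scale S c x \<in> \<phi> ` W" if "x \<in> \<phi> ` W" for x c
      proof -
        obtain v where "v \<in> W" "x = \<phi> v" using \<open>x \<in> \<phi> ` W\<close> by blast
        then have "rep_scale S c x = \<phi> (rep_scale R c v)" "rep_scale R c v \<in> W"
          using scale WR R.subspace_scale[OF W(1)] by auto
        then show ?thesis by blast
      qed
    qed
    moreover have "\<phi> ` W \<subseteq> rep_space S" using W(2) img by blast
    moreover have "\<forall>g\<in>carrier G. \<forall>x\<in>\<phi> ` W. rep_act S g x \<in> \<phi> ` W"
      using act W WR by (auto simp flip: act)
    ultimately have "\<phi> ` W = {0} \<or> \<phi> ` W = rep_space S"
      using assms(2) unfolding irreducible_rep_def by blast
    then show ?thesis
    proof
      assume "\<phi> ` W = {0}"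
      then have "w = 0" if "w \<in> W" for w
        using that inj zero WR \<phi>0 by (metis imageI inj_onD singletonD)
      then show ?thesis using R.subspace_0[OF W(1)] by blast
    next
      assume "\<phi> ` W = rep_space S"
      then show ?thesis using inj_on_image_eq_iff[OF inj W(2) order_refl] img by simp
    qed
  qed
  then show ?thesis using RS(1) ne by (auto simp: irreducible_rep_def)
qed

section \<open>The trivial representation in degree zero\<close>

lemma rep_isomorphic_V_rep_0:
  assumes "n \<ge> 1"
  shows "rep_isomorphic (sym_group (n + 1)) (V_rep n 0) (char_rep (\<lambda>_. 1))"
proof (rule rep_isomorphic_sym, rule rep_isomorphic_of_linear[where \<phi> = "\<lambda>a. poly_scale a 1"])
  have vs: "vector_space ((*) :: complex \<Rightarrow> complex \<Rightarrow> complex)"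
    by unfold_locales (simp_all add: algebra_simps)
  interpret C: vector_space "(*) :: complex \<Rightarrow> complex \<Rightarrow> complex" by (rule vs)
  show "representation (sym_group (n + 1)) (char_rep (\<lambda>_. 1))"
    by (auto simp: representation_def char_rep_def sym_group_is_group C.subspace_UNIV
        intro: vs)
  show "Vector_Spaces.linear (rep_scale (char_rep (\<lambda>_. 1))) (rep_scale (V_rep n 0)) (\<lambda>a. poly_scale a 1)"
    unfolding char_rep_def V_rep_def rep.simps
    by unfold_locales (simp_all add: cpoly.scale_left_distrib)
  have "a = b" if "poly_scale a 1 = poly_scale b 1" for a b
    using arg_cong[OF that, of "\<lambda>p. Poly_Mapping.lookup p 0"] by simp
  then show "inj_on (\<lambda>a. poly_scale a 1) (rep_space (char_rep (\<lambda>_. 1)))" by (auto simp: inj_on_def)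
  show "(\<lambda>a. poly_scale a 1) ` rep_space (char_rep (\<lambda>_. 1)) = rep_space (V_rep n 0)"
    using assms by (simp add: char_rep_def V_rep_def V_deg_0 cpoly.span_singleton)
qed (simp_all add: char_rep_def V_rep_def permute_vars_hom)

section \<open>The reflection representation\<close>

definition unit_vec :: "nat \<Rightarrow> nat \<Rightarrow> complex" where
  "unit_vec i = (\<lambda>j. if j = i then 1 else 0)"

abbreviation sum_zero_space :: "nat \<Rightarrow> (nat \<Rightarrow> complex) set" where
  "sum_zero_space N \<equiv> rep_space (reflection_rep N)"

interpretation cvec: vector_space "\<lambda>(a::complex) (v::nat \<Rightarrow> complex) i. a * v i"
  by (rule vector_space_fun_scale)

lemma subspace_sum_zero_space: "cvec.subspace (sum_zero_space N)"
  by (auto simp: cvec.subspace_def reflection_rep_def sum.distrib simp flip: sum_distrib_left)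

lemma permutes_inv_eq_zero:
  assumes "\<sigma> permutes {1..N}" "v \<in> sum_zero_space N" "i \<notin> {1..N}"
  shows "v (inv' \<sigma> i) = 0"
  using assms permutes_not_in[OF permutes_inv[OF assms(1)] assms(3)] by (auto simp: reflection_rep_def)

lemma representation_reflection_rep: "representation (sym_group N) (reflection_rep N)"
proof -
  have "(\<Sum>i=1..N. v (inv' \<sigma> i)) = (\<Sum>i=1..N. v i)" if "\<sigma> permutes {1..N}" for \<sigma> and v :: "nat \<Rightarrow> complex"
    using sum.permute[OF permutes_inv[OF that], of v] by (simp add: comp_def)
  then have "(\<lambda>i. v (inv' \<sigma> i)) \<in> sum_zero_space N"
    if "\<sigma> permutes {1..N}" "v \<in> sum_zero_space N" for \<sigma> v
    using that permutes_inv_eq_zero[OF that] by (simp add: reflection_rep_def)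
  moreover have "inv' (\<sigma> \<circ> \<tau>) = inv' \<tau> \<circ> inv' \<sigma>" if "\<sigma> permutes {1..N}" "\<tau> permutes {1..N}" for \<sigma> \<tau> :: "nat \<Rightarrow> nat"
    using that by (intro o_inv_distrib permutes_bij)
  moreover note subspace_sum_zero_space[of N] cvec.vector_space_axioms
  ultimately show ?thesis
    by (auto simp: representation_def sym_group_is_group sym_group_carrier sym_group_mult
        sym_group_one) (auto simp: reflection_rep_def fun_eq_iff)
qed

lemma unit_vec_diff_in_sum_zero_space:
  "a \<in> {1..N} \<Longrightarrow> b \<in> {1..N} \<Longrightarrow> unit_vec a - unit_vec b \<in> sum_zero_space N"
  by (auto simp: reflection_rep_def unit_vec_def sum_subtractf)

lemma sum_zero_space_expand:
  assumes "v \<in> sum_zero_space N" "N \<ge> 1"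
  shows "v = (\<Sum>a=1..N. (\<lambda>j. v a * (unit_vec a - unit_vec 1) j))"
proof
  fix j
  have "(\<Sum>a=1..N. (\<lambda>j. v a * (unit_vec a - unit_vec 1) j)) j
      = (\<Sum>a=1..N. v a * unit_vec a j) - (\<Sum>a=1..N. v a) * unit_vec 1 j"
    by (induction N) (simp_all add: algebra_simps)
  also have "\<dots> = (\<Sum>a=1..N. v a * unit_vec a j)"
    using assms(1) by (simp add: reflection_rep_def)
  also have "\<dots> = (\<Sum>a=1..N. if a = j then v a else 0)"
    by (rule sum.cong) (auto simp: unit_vec_def)
  also have "\<dots> = v j" using assms(1) by (auto simp: reflection_rep_def sum.delta')
  finally show "v j = (\<Sum>a=1..N. (\<lambda>j. v a * (unit_vec a - unit_vec 1) j)) j" by simp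
qed

text \<open>Serves three times: \<open>W\<close> is an invariant subspace in the proof of
  irreducibility, and a preimage under a linear map when the images in degree one and in the Specht
  module are determined.\<close>

lemma sum_zero_space_subset:
  assumes "cvec.subspace W" "N \<ge> 1" "\<And>a. a \<in> {2..N} \<Longrightarrow> unit_vec a - unit_vec 1 \<in> W"
  shows "sum_zero_space N \<subseteq> W"
proof
  fix v assume v: "v \<in> sum_zero_space N"
  have "unit_vec a - unit_vec 1 \<in> W" if "a \<in> {1..N}" for a
    using assms(3)[of a] that cvec.subspace_0[OF assms(1)] by (cases "a = 1") auto
  then have "(\<Sum>a=1..N. (\<lambda>j. v a * (unit_vec a - unit_vec 1) j)) \<in> W"
    by (intro cvec.subspace_sum assms(1) cvec.subspace_scale)
  then show "v \<in> W" using sum_zero_space_expand[OF v assms(2)] by simp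
qed

lemma exists_permutes_two_points:
  assumes "a \<in> S" "b \<in> S" "a \<noteq> b" "c \<in> S" "d \<in> S" "c \<noteq> d"
  obtains \<pi> where "\<pi> permutes S" "\<pi> c = a" "\<pi> d = b"
proof
  \<comment> \<open>The second transposition to act is \<open>transpose c a\<close>, so
    \<open>d\<close> must first be moved to the point which that one sends to
    \<open>b\<close>.\<close>
  define b' where "b' = transpose c a b"
  have "b' \<in> S" "b' \<noteq> c" using assms by (auto simp: b'_def transpose_def)
  then show "(transpose c a \<circ> transpose d b') permutes S"
    using assms by (intro permutes_compose permutes_swap_id)
  show "(transpose c a \<circ> transpose d b') c = a" "(transpose c a \<circ> transpose d b') d = b"
    using assms \<open>b' \<noteq> c\<close> by (auto simp: b'_def transpose_def)
qed

text \<open>A nonzero vector with coordinate sum 0 is not constant on \<open>{1..N}\<close>. If its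
  coordinates at \<open>i\<close> and \<open>j\<close> differ, subtracting its image under the
  transposition of \<open>i\<close> and \<open>j\<close> leaves a nonzero multiple of
  \<open>unit_vec i - unit_vec j\<close>, and the images of that difference under permutations span
  everything.\<close>

lemma irreducible_reflection_rep:
  assumes "N \<ge> 2"
  shows "irreducible_rep (sym_group N) (reflection_rep N)"
  unfolding irreducible_rep_def
proof (intro conjI allI impI)
  show "representation (sym_group N) (reflection_rep N)" by (rule representation_reflection_rep)
  have "unit_vec 1 - unit_vec 2 \<in> sum_zero_space N" "unit_vec 1 - unit_vec 2 \<noteq> 0"
    using unit_vec_diff_in_sum_zero_space[of 1 N 2] assms
    by (auto simp: unit_vec_def fun_eq_iff split: if_splits)
  then show "sum_zero_space N \<noteq> {0}" by blast
  fix W assume "module.subspace (rep_scale (reflection_rep N)) W \<and> W \<subseteq> sum_zero_space N \<and>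
      (\<forall>g\<in>carrier (sym_group N). \<forall>w\<in>W. rep_act (reflection_rep N) g w \<in> W)"
  then have W: "cvec.subspace W" "W \<subseteq> sum_zero_space N"
    and inv: "\<And>\<sigma> w. \<sigma> permutes {1..N} \<Longrightarrow> w \<in> W \<Longrightarrow> (\<lambda>i. w (inv' \<sigma> i)) \<in> W"
    by (auto simp: reflection_rep_def sym_group_carrier)
  show "W = {0} \<or> W = sum_zero_space N"
  proof (cases "W = {0}")
    case False
    then obtain w where w: "w \<in> W" "w \<noteq> 0" using cvec.subspace_0[OF W(1)] by blast
    then have wZ: "w \<in> sum_zero_space N" using W by blast
    have "\<exists>i\<in>{1..N}. \<exists>j\<in>{1..N}. w i \<noteq> w j"
    proof (rule ccontr)
      assume "\<not> ?thesis"
      moreover have "1 \<in> {1..N}" using assms by simp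
      ultimately have c: "w i = w 1" if "i \<in> {1..N}" for i using that by blast
      have "(\<Sum>i=1..N. w i) = (\<Sum>i=1..N. w 1)" by (rule sum.cong[OF refl c])
      then have "w 1 = 0" using wZ assms by (simp add: reflection_rep_def)
      then have "w i = 0" for i
        using c[of i] wZ by (cases "i \<in> {1..N}") (simp, auto simp: reflection_rep_def)
      then show False using w by (simp add: fun_eq_iff)
    qed
    then obtain i j where ij: "i \<in> {1..N}" "j \<in> {1..N}" "w i \<noteq> w j" by blast
    have "w - (\<lambda>k. w (inv' (transpose i j) k)) \<in> W"
      using ij w by (intro cvec.subspace_diff W inv permutes_swap_id)
    then have "(\<lambda>k. inverse (w i - w j) * (w - (\<lambda>k. w (inv' (transpose i j) k))) k) \<in> W"
      by (intro cvec.subspace_scale W)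
    moreover have "(\<lambda>k. inverse (w i - w j) * (w - (\<lambda>k. w (inv' (transpose i j) k))) k)
        = unit_vec i - unit_vec j"
      using ij by (auto simp: fun_eq_iff unit_vec_def transpose_def field_simps)
    ultimately have e: "unit_vec i - unit_vec j \<in> W" by simp
    have "unit_vec a - unit_vec 1 \<in> W" if "a \<in> {2..N}" for a
    proof -
      have a: "a \<in> {1..N}" "1 \<in> {1..N}" "a \<noteq> 1" using that by auto
      obtain \<pi> where \<pi>: "\<pi> permutes {1..N}" "\<pi> i = a" "\<pi> j = 1"
        using exists_permutes_two_points[OF a ij(1,2)] ij(3) by metis
      have "(\<lambda>k. (unit_vec i - unit_vec j) (inv' \<pi> k)) = unit_vec a - unit_vec 1"
        using \<pi> by (auto simp: fun_eq_iff unit_vec_def permutes_inv_eq)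
      then show ?thesis using inv[OF \<pi>(1) e] by simp
    qed
    then have "sum_zero_space N \<subseteq> W" using sum_zero_space_subset[OF W(1)] assms by simp
    then show ?thesis using W by blast
  qed simp
qed

section \<open>The reflection representation as linear forms\<close>

definition linear_form :: "nat \<Rightarrow> (nat \<Rightarrow> complex) \<Rightarrow> cpoly" where
  "linear_form N v = (\<Sum>i=1..N. poly_scale (v i) (poly_var i))"

lemma linear_form_linear:
  "Vector_Spaces.linear (\<lambda>(a::complex) (v::nat \<Rightarrow> complex) i. a * v i) poly_scale (linear_form N)"
  by unfold_locales
    (simp_all add: linear_form_def cpoly.scale_left_distrib sum.distrib cpoly.scale_sum_right)

lemma linear_form_unit_vec_diff:
  assumes "a \<in> {1..N}" "b \<in> {1..N}"
  shows "linear_form N (unit_vec a - unit_vec b) = poly_var a - poly_var b"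
proof -
  interpret Vector_Spaces.linear "\<lambda>(a::complex) (v::nat \<Rightarrow> complex) i. a * v i" poly_scale "linear_form N"
    by (rule linear_form_linear)
  have "linear_form N (unit_vec a) = poly_var a" if "a \<in> {1..N}" for a
  proof -
    have "linear_form N (unit_vec a) = (\<Sum>i=1..N. if i = a then poly_var i else 0)"
      unfolding linear_form_def by (rule sum.cong) (auto simp: unit_vec_def)
    then show ?thesis using that by (simp add: sum.delta')
  qed
  then show ?thesis using assms by (simp add: diff)
qed

lemma single_one_eq_iff:
  "Poly_Mapping.single a (Suc 0) = Poly_Mapping.single b (Suc 0) \<longleftrightarrow> a = b"
proof
  assume "Poly_Mapping.single a (Suc 0) = Poly_Mapping.single b (Suc 0)"
  then have "Poly_Mapping.keys (Poly_Mapping.single a (Suc 0)) = Poly_Mapping.keys (Poly_Mapping.single b (Suc 0))"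
    by simp
  then show "a = b" by simp
qed simp

lemma lookup_linear_form:
  assumes "v \<in> sum_zero_space N"
  shows "Poly_Mapping.lookup (linear_form N v) (Poly_Mapping.single i 1) = v i"
proof -
  have "Poly_Mapping.lookup (poly_var j) (Poly_Mapping.single i 1) = (if j = i then 1 else 0)" for j
    by (simp add: poly_var_def lookup_single single_one_eq_iff)
  then have "Poly_Mapping.lookup (linear_form N v) (Poly_Mapping.single i 1) = (\<Sum>j=1..N. if j = i then v j else 0)"
    unfolding linear_form_def lookup_sum by (intro sum.cong) auto
  then show ?thesis using assms by (auto simp: reflection_rep_def sum.delta')
qed

lemma rep_isomorphic_reflection_V_rep:
  assumes "n \<ge> 2"
  shows "rep_isomorphic (sym_group (n + 1)) (reflection_rep (n + 1)) (V_rep n 1)"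
proof (rule rep_isomorphic_of_linear[where \<phi> = "linear_form (n + 1)"])
  let ?N = "n + 1"
  interpret L: Vector_Spaces.linear "\<lambda>(a::complex) (v::nat \<Rightarrow> complex) i. a * v i" poly_scale "linear_form ?N"
    by (rule linear_form_linear)
  show "representation (sym_group ?N) (reflection_rep ?N)" by (rule representation_reflection_rep)
  show "Vector_Spaces.linear (rep_scale (reflection_rep ?N)) (rep_scale (V_rep n 1)) (linear_form ?N)"
    using linear_form_linear by (simp add: reflection_rep_def V_rep_def)
  show "inj_on (linear_form ?N) (sum_zero_space ?N)"
    by (rule inj_onI) (metis ext lookup_linear_form)
  show "linear_form ?N ` sum_zero_space ?N = rep_space (V_rep n 1)"
  proof
    have "sum_zero_space ?N \<subseteq> linear_form ?N -` V_deg n 1"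
    proof (rule sum_zero_space_subset)
      fix a assume a: "a \<in> {2..?N}"
      have "edge_poly {1, a} \<in> V_deg n 1"
        using a assms by (intro edge_poly_in_V_deg_1) (auto simp: pair_in_complete_edges)
      then have "- edge_poly {1, a} \<in> V_deg n 1" by (rule cpoly.subspace_neg[OF subspace_V_deg])
      moreover have "linear_form ?N (unit_vec a - unit_vec 1) = - edge_poly {1, a}"
        using a by (subst linear_form_unit_vec_diff) (auto simp: edge_poly_pair unit_sign_def)
      ultimately show "unit_vec a - unit_vec 1 \<in> linear_form ?N -` V_deg n 1" by simp
    qed (use L.subspace_vimage[OF subspace_V_deg] in auto)
    then show "linear_form ?N ` sum_zero_space ?N \<subseteq> rep_space (V_rep n 1)" by (auto simp: V_rep_def)
    have "V_deg n 1 \<subseteq> linear_form ?N ` sum_zero_space ?N"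
      unfolding V_deg_eq_span
    proof (rule cpoly.span_minimal)
      show "{graph_poly G |G. slim n G \<and> card G = 1} \<subseteq> linear_form ?N ` sum_zero_space ?N"
      proof clarify
        fix G assume "slim n G" "card G = 1"
        then obtain e where e: "G = {e}" "e \<in> complete_edges ?N"
          by (auto simp: slim_def card_1_singleton_iff)
        then obtain a b where ab: "e = {a, b}" "a < b" "a \<in> {1..?N}" "b \<in> {1..?N}"
          by (auto elim: complete_edgesE)
        have "graph_poly G = linear_form ?N (unit_vec a - unit_vec b)"
          using e ab by (simp add: graph_poly_def edge_poly_pair unit_sign_def linear_form_unit_vec_diff del: One_nat_def)
        then show "graph_poly G \<in> linear_form ?N ` sum_zero_space ?N"
          using unit_vec_diff_in_sum_zero_space[OF ab(3,4)] by blast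
      qed
    qed (rule L.subspace_image[OF subspace_sum_zero_space])
    then show "rep_space (V_rep n 1) \<subseteq> linear_form ?N ` sum_zero_space ?N" by (simp add: V_rep_def)
  qed
  fix \<sigma> v assume "\<sigma> \<in> carrier (sym_group ?N)" "v \<in> sum_zero_space ?N"
  then have \<sigma>: "\<sigma> permutes {1..?N}" by (simp only: sym_group_carrier)
  have "linear_form ?N (\<lambda>i. v (inv' \<sigma> i)) = (\<Sum>i=1..?N. poly_scale (v i) (poly_var (\<sigma> i)))"
    unfolding linear_form_def using sum.permute[OF \<sigma>, of "\<lambda>i. poly_scale (v (inv' \<sigma> i)) (poly_var i)"] \<sigma>
    by (simp add: comp_def permutes_inverses(2))
  then show "rep_act (V_rep n 1) \<sigma> (linear_form ?N v) = linear_form ?N (rep_act (reflection_rep ?N) \<sigma> v)"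
    by (simp add: V_rep_def reflection_rep_def linear_form_def permute_vars_hom)
qed

section \<open>The Specht module of shape (n, 1)\<close>

definition hook_tabloid :: "nat \<Rightarrow> nat \<Rightarrow> nat \<Rightarrow> nat set" where
  "hook_tabloid n b r = (if r = 0 then {1..n + 1} - {b} else if r = 1 then {b} else {})"

lemma hook_tabloid_inj: "hook_tabloid n a = hook_tabloid n b \<longleftrightarrow> a = b"
  by (auto simp: hook_tabloid_def fun_eq_iff split: if_splits)

lemma tabloid_act_hook_tabloid:
  assumes "\<sigma> permutes {1..n + 1}"
  shows "tabloid_act \<sigma> (hook_tabloid n b) = hook_tabloid n (\<sigma> b)"
proof
  fix r
  have "\<sigma> ` ({1..n + 1} - {b}) = {1..n + 1} - {\<sigma> b}"
    using permutes_image[OF assms] by (simp add: image_set_diff[OF permutes_inj[OF assms]])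
  then show "tabloid_act \<sigma> (hook_tabloid n b) r = hook_tabloid n (\<sigma> b) r"
    by (simp add: tabloid_act_def hook_tabloid_def)
qed

lemma tabloid_act_inverse:
  assumes "\<sigma> permutes S"
  shows "tabloid_act (inv' \<sigma>) t = u \<longleftrightarrow> t = tabloid_act \<sigma> u"
proof -
  have "tabloid_act \<sigma> (tabloid_act (inv' \<sigma>) t) = t" "tabloid_act (inv' \<sigma>) (tabloid_act \<sigma> u) = u"
    by (simp_all add: tabloid_act_def fun_eq_iff image_comp permutes_inv_o[OF assms])
  then show ?thesis by metis
qed

lemma cells_hook: "cells [n, Suc 0] = insert (Suc 0, 0) ((\<lambda>c. (0, c)) ` {..<n})"
  by (auto simp: cells_def less_Suc_eq)

lemma tableaux_hookD:
  assumes "n \<ge> 1" "T \<in> tableaux [n, 1]"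
  shows "T (0, 0) \<in> {1..n + 1}" "T (1, 0) \<in> {1..n + 1}" "T (0, 0) \<noteq> T (1, 0)"
    and "{T (0, c) |c. c < n} = {1..n + 1} - {T (1, 0)}"
    and "\<And>c. 0 < c \<Longrightarrow> c < n \<Longrightarrow> T (0, c) \<noteq> T (0, 0)"
proof -
  have bij: "bij_betw T (insert (1, 0) ((\<lambda>c. (0, c)) ` {..<n})) {1..n + 1}"
    using assms(2) by (simp add: tableaux_def cells_hook)
  then have inj: "inj_on T (insert (1, 0) ((\<lambda>c. (0, c)) ` {..<n}))"
    and img: "insert (T (1, 0)) ((\<lambda>c. T (0, c)) ` {..<n}) = {1..n + 1}"
    by (simp_all add: bij_betw_def image_image)
  have ne: "T (0, c) \<noteq> T (1, 0)" if "c < n" for c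
    using inj_onD[OF inj, of "(0, c)" "(1, 0)"] that by auto
  show "T (0, 0) \<in> {1..n + 1}" "T (1, 0) \<in> {1..n + 1}" using img assms(1) by auto
  show "T (0, 0) \<noteq> T (1, 0)" using ne[of 0] assms(1) by auto
  show "{T (0, c) |c. c < n} = {1..n + 1} - {T (1, 0)}" using img ne by auto
  show "T (0, c) \<noteq> T (0, 0)" if "0 < c" "c < n" for c
    using inj_onD[OF inj, of "(0, c)" "(0, 0)"] that by auto
qed

lemma tabloid_hook:
  assumes "n \<ge> 1" "T \<in> tableaux [n, 1]"
  shows "tabloid [n, 1] T = hook_tabloid n (T (1, 0))"
proof
  fix r
  have "tabloid [n, 1] T 0 = {T (0, c) |c. c < n}" by (auto simp: tabloid_def cells_hook)
  then have "tabloid [n, 1] T 0 = {1..n + 1} - {T (1, 0)}"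
    using tableaux_hookD(4)[OF assms] by simp
  moreover have "tabloid [n, 1] T 1 = {T (1, 0)}" by (auto simp: tabloid_def cells_hook)
  moreover have "tabloid [n, 1] T r = {}" if "r > 1" using that by (auto simp: tabloid_def cells_hook)
  ultimately show "tabloid [n, 1] T r = hook_tabloid n (T (1, 0)) r"
    by (cases "r > 1") (auto simp: hook_tabloid_def not_less le_Suc_eq)
qed

text \<open>Every column but the first is a single cell, so its entry is fixed; only the two entries
  of the first column may be exchanged. Hence a polytabloid of this shape is a difference of two
  tabloids.\<close>

lemma column_stabilizer_hook:
  assumes "n \<ge> 1" "T \<in> tableaux [n, 1]"
  shows "column_stabilizer [n, 1] T = {id, transpose (T (0, 0)) (T (1, 0))}"
proof -
  define a b where "a = T (0, 0)" and "b = T (1, 0)"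
  note T = tableaux_hookD[OF assms, folded a_def b_def]
  have col0: "tableau_column [n, 1] T 0 = {a, b}"
    using assms(1) by (auto simp: tableau_column_def cells_hook a_def b_def)
  have col: "tableau_column [n, 1] T c = (if c < n then {T (0, c)} else {})" if "c > 0" for c
    using that by (auto simp: tableau_column_def cells_hook)
  have "\<pi> = id \<or> \<pi> = transpose a b"
    if \<pi>: "\<pi> permutes {1..n + 1}" "\<forall>c. \<pi> ` tableau_column [n, 1] T c = tableau_column [n, 1] T c" for \<pi>
  proof -
    have fixed: "\<pi> x = x" if x: "x \<notin> {a, b}" for x
    proof (cases "x \<in> {1..n + 1}")
      case True
      then obtain c where c: "x = T (0, c)" "c < n" using T(4) x by blast
      then have "c > 0" using x by (cases c) (auto simp: a_def)
      then show ?thesis using \<pi>(2)[rule_format, of c] c unfolding col[OF \<open>c > 0\<close>] by simp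
    next
      case False
      then show ?thesis using \<pi>(1) by (simp add: permutes_not_in)
    qed
    have "{\<pi> a, \<pi> b} = {a, b}" using \<pi>(2)[rule_format, of 0] unfolding col0 by simp
    then consider "\<pi> a = a" "\<pi> b = b" | "\<pi> a = b" "\<pi> b = a" by (auto simp: doubleton_eq_iff)
    then show ?thesis
    proof cases
      case 1
      then have "\<pi> x = x" for x using fixed[of x] by (cases "x \<in> {a, b}") auto
      then show ?thesis by (simp add: fun_eq_iff)
    next
      case 2
      then have "\<pi> x = transpose a b x" for x using fixed[of x] by (auto simp: transpose_def)
      then show ?thesis by (simp add: fun_eq_iff)
    qed
  qed
  moreover have "transpose a b ` tableau_column [n, 1] T c = tableau_column [n, 1] T c" for c
  proof (cases "c = 0")
    case False
    then have "T (0, c) \<notin> {a, b}" if "c < n"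
      using T(4,5) that by auto
    moreover have "c > 0" using False by simp
    ultimately show ?thesis unfolding col[OF \<open>c > 0\<close>] by (auto simp: transpose_def)
  qed (simp only: col0, auto)
  moreover have "transpose a b permutes {1..n + 1}" using T by (intro permutes_swap_id)
  ultimately show ?thesis
    unfolding column_stabilizer_def a_def[symmetric] b_def[symmetric] by (auto simp: permutes_id)
qed

text \<open>A tabloid of shape \<open>[n, 1]\<close> is determined by the entry of its second row,
  so the permutation module on tabloids is the one on points; under this identification polytabloids
  are differences of unit vectors.\<close>

definition tabloid_form :: "nat \<Rightarrow> (nat \<Rightarrow> complex) \<Rightarrow> (nat \<Rightarrow> nat set) \<Rightarrow> complex" where
  "tabloid_form n v t = (\<Sum>i=1..n + 1. if t = hook_tabloid n i then v i else 0)"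

lemma tabloid_form_hook_tabloid:
  "tabloid_form n v (hook_tabloid n i) = (if i \<in> {1..n + 1} then v i else 0)"
  by (simp add: tabloid_form_def hook_tabloid_inj sum.delta del: One_nat_def)

lemma tabloid_form_linear: "Vector_Spaces.linear (\<lambda>(a::complex) (v::nat \<Rightarrow> complex) i. a * v i)
    (\<lambda>(a::complex) (f::(nat \<Rightarrow> nat set) \<Rightarrow> complex) t. a * f t) (tabloid_form n)"
proof -
  interpret vector_space "\<lambda>(a::complex) (f::(nat \<Rightarrow> nat set) \<Rightarrow> complex) t. a * f t"
    by (rule vector_space_fun_scale)
  show ?thesis
    by (unfold_locales; rule ext)
      (auto simp: tabloid_form_def sum_distrib_left simp flip: sum.distrib simp del: sum.cl_ivl_Suc
        intro!: sum.cong)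
qed

lemma tabloid_form_unit_vec:
  assumes "a \<in> {1..n + 1}" 
  shows "tabloid_form n (unit_vec a) t = (if hook_tabloid n a = t then 1 else 0)"
proof -
  have "tabloid_form n (unit_vec a) t = (\<Sum>i=1..n + 1. if i = a then if hook_tabloid n a = t then 1 else 0 else 0)"
    unfolding tabloid_form_def by (rule sum.cong) (auto simp: unit_vec_def)
  then show ?thesis using assms by (simp add: sum.delta')
qed

lemma polytabloid_hook:
  assumes "n \<ge> 1" "T \<in> tableaux [n, 1]"
  shows "polytabloid [n, 1] T = tabloid_form n (unit_vec (T (1, 0)) - unit_vec (T (0, 0)))"
proof
  fix t
  define a b where "a = T (0, 0)" and "b = T (1, 0)"
  note T = tableaux_hookD[OF assms, folded a_def b_def]
  interpret Vector_Spaces.linear "\<lambda>(a::complex) (v::nat \<Rightarrow> complex) i. a * v i"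
    "\<lambda>(a::complex) (f::(nat \<Rightarrow> nat set) \<Rightarrow> complex) t. a * f t" "tabloid_form n"
    by (rule tabloid_form_linear)
  have tr: "transpose a b permutes {1..n + 1}" using T by (intro permutes_swap_id)
  have ne: "id \<noteq> transpose a b" using T(3) by (metis id_apply transpose_apply_first)
  have "polytabloid [n, 1] T t = (if hook_tabloid n b = t then 1 else 0) - (if hook_tabloid n a = t then 1 else 0)"
    unfolding polytabloid_def column_stabilizer_hook[OF assms] tabloid_hook[OF assms]
      a_def[symmetric] b_def[symmetric]
    using ne T(3) tabloid_act_hook_tabloid[OF permutes_id, of n b]
    by (simp add: tabloid_act_hook_tabloid[OF tr] sign_char_def sign_swap_id del: One_nat_def)
  then show "polytabloid [n, 1] T t = tabloid_form n (unit_vec (T (1, 0)) - unit_vec (T (0, 0))) t"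
    using T by (simp add: diff tabloid_form_unit_vec flip: a_def b_def del: One_nat_def)
qed

lemma exists_tableau_hook:
  assumes "a \<in> {1..n + 1}" "b \<in> {1..n + 1}" "a \<noteq> b" "n \<ge> 1"
  obtains T where "T \<in> tableaux [n, 1]" "T (0, 0) = a" "T (1, 0) = b"
proof -
  obtain \<pi> where \<pi>: "\<pi> permutes {1..n + 1}" "\<pi> 1 = a" "\<pi> (n + 1) = b"
    using exists_permutes_two_points[of a "{1..n + 1}" b 1 "n + 1"] assms by auto
  \<comment> \<open>The row-by-row filling has \<open>1\<close> and \<open>n + 1\<close> in its
    first column; renaming its entries by \<open>\<pi>\<close> puts \<open>a\<close> and
    \<open>b\<close> there.\<close>
  define T0 where "T0 = (\<lambda>(r::nat, c). if r = 0 then c + 1 else n + 1)"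
  have "bij_betw T0 (cells [n, 1]) {1..n + 1}"
  proof (rule bij_betw_byWitness[where f' = "\<lambda>i. if i = n + 1 then (1, 0) else (0, i - 1)"])
    show "T0 ` cells [n, 1] \<subseteq> {1..n + 1}" by (auto simp: cells_hook T0_def)
    show "(\<lambda>i. if i = n + 1 then (1, 0) else (0, i - 1)) ` {1..n + 1} \<subseteq> cells [n, 1]"
      by (auto simp: cells_hook)
  qed (auto simp: cells_hook T0_def)
  then have "bij_betw (\<pi> \<circ> T0) (cells [n, 1]) {1..n + 1}"
    using permutes_imp_bij[OF \<pi>(1)] by (rule bij_betw_trans)
  then have "\<pi> \<circ> T0 \<in> tableaux [n, 1]" by (simp add: tableaux_def)
  then show ?thesis using that[of "\<pi> \<circ> T0"] \<pi> by (simp add: T0_def)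
qed

lemma rep_isomorphic_reflection_specht:
  assumes "n \<ge> 1"
  shows "rep_isomorphic (sym_group (n + 1)) (reflection_rep (n + 1)) (specht_rep [n, 1])"
proof (rule rep_isomorphic_of_linear[where \<phi> = "tabloid_form n"])
  let ?N = "n + 1"
  interpret L: Vector_Spaces.linear "\<lambda>(a::complex) (v::nat \<Rightarrow> complex) i. a * v i"
    "\<lambda>(a::complex) (f::(nat \<Rightarrow> nat set) \<Rightarrow> complex) t. a * f t" "tabloid_form n"
    by (rule tabloid_form_linear)
  show "representation (sym_group ?N) (reflection_rep ?N)" by (rule representation_reflection_rep)
  show "Vector_Spaces.linear (rep_scale (reflection_rep ?N)) (rep_scale (specht_rep [n, 1])) (tabloid_form n)"
    using tabloid_form_linear by (simp add: reflection_rep_def specht_rep_def)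
  show "inj_on (tabloid_form n) (sum_zero_space ?N)"
  proof (rule inj_onI, rule ext)
    fix v w i assume "v \<in> sum_zero_space ?N" "w \<in> sum_zero_space ?N" "tabloid_form n v = tabloid_form n w"
    then show "v i = w i"
      using tabloid_form_hook_tabloid[of n v i] tabloid_form_hook_tabloid[of n w i]
      by (cases "i \<in> {1..?N}") (auto simp: reflection_rep_def)
  qed
  show "tabloid_form n ` sum_zero_space ?N = rep_space (specht_rep [n, 1])"
  proof
    have "sum_zero_space ?N \<subseteq> tabloid_form n -` L.vs2.span (polytabloid [n, 1] ` tableaux [n, 1])"
    proof (rule sum_zero_space_subset)
      fix a assume "a \<in> {2..?N}"
      then have "1 \<in> {1..n + 1}" "a \<in> {1..n + 1}" "1 \<noteq> a" by auto
      then obtain T where "T \<in> tableaux [n, 1]" "T (0, 0) = 1" "T (1, 0) = a"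
        using assms by (rule exists_tableau_hook)
      then have "tabloid_form n (unit_vec a - unit_vec 1) \<in> polytabloid [n, 1] ` tableaux [n, 1]"
        using polytabloid_hook[OF assms, of T] by (metis imageI)
      then show "unit_vec a - unit_vec 1 \<in> tabloid_form n -` L.vs2.span (polytabloid [n, 1] ` tableaux [n, 1])"
        by (simp add: L.vs2.span_base)
    qed (use L.subspace_vimage[OF L.vs2.subspace_span] in auto)
    then show "tabloid_form n ` sum_zero_space ?N \<subseteq> rep_space (specht_rep [n, 1])"
      by (auto simp: specht_rep_def)
    have "polytabloid [n, 1] ` tableaux [n, 1] \<subseteq> tabloid_form n ` sum_zero_space ?N"
    proof
      fix f assume "f \<in> polytabloid [n, 1] ` tableaux [n, 1]"
      then obtain T where T: "T \<in> tableaux [n, 1]" "f = polytabloid [n, 1] T" by blast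
      show "f \<in> tabloid_form n ` sum_zero_space ?N"
        unfolding T(2) polytabloid_hook[OF assms T(1)]
        by (intro imageI unit_vec_diff_in_sum_zero_space tableaux_hookD[OF assms T(1)])
    qed
    then have "L.vs2.span (polytabloid [n, 1] ` tableaux [n, 1]) \<subseteq> tabloid_form n ` sum_zero_space ?N"
      by (rule L.vs2.span_minimal) (rule L.subspace_image[OF subspace_sum_zero_space])
    then show "rep_space (specht_rep [n, 1]) \<subseteq> tabloid_form n ` sum_zero_space ?N"
      by (simp add: specht_rep_def)
  qed
  fix \<sigma> v assume "\<sigma> \<in> carrier (sym_group ?N)" "v \<in> sum_zero_space ?N"
  then have \<sigma>: "\<sigma> permutes {1..?N}" by (simp only: sym_group_carrier)
  have "tabloid_form n v (tabloid_act (inv' \<sigma>) t) = tabloid_form n (\<lambda>i. v (inv' \<sigma> i)) t" for t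
  proof -
    have "tabloid_form n v (tabloid_act (inv' \<sigma>) t)
        = (\<Sum>i=1..n + 1. if t = hook_tabloid n (\<sigma> i) then v (inv' \<sigma> (\<sigma> i)) else 0)"
      unfolding tabloid_form_def tabloid_act_inverse[OF \<sigma>] tabloid_act_hook_tabloid[OF \<sigma>]
      by (intro sum.cong) (simp_all add: permutes_inverses(2)[OF \<sigma>])
    also have "\<dots> = tabloid_form n (\<lambda>i. v (inv' \<sigma> i)) t"
      unfolding tabloid_form_def
      using sum.permute[OF \<sigma>, of "\<lambda>i. if t = hook_tabloid n i then v (inv' \<sigma> i) else 0"]
      by (simp add: comp_def del: sum.cl_ivl_Suc)
    finally show ?thesis .
  qed
  then show "rep_act (specht_rep [n, 1]) \<sigma> (tabloid_form n v)
      = tabloid_form n (rep_act (reflection_rep ?N) \<sigma> v)"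
    by (simp add: specht_rep_def reflection_rep_def fun_eq_iff)
qed

section \<open>The Vandermonde product\<close>

abbreviation vandermonde :: "nat \<Rightarrow> cpoly" where
  "vandermonde N \<equiv> graph_poly (complete_edges N)"

lemma poly_var_eq_iff [simp]: "poly_var a = poly_var b \<longleftrightarrow> a = b"
proof
  assume "poly_var a = poly_var b"
  then have "Poly_Mapping.keys (poly_var a) = Poly_Mapping.keys (poly_var b)" by simp
  then show "a = b" by (simp add: poly_var_def single_one_eq_iff)
qed simp

text \<open>As \<open>1\<close> and \<open>2\<close> are neighbours in the order, exchanging them
  preserves the order within every other pair. So all other factors are permuted without signs, and
  only the factor of \<open>{1, 2}\<close> is negated. Other transpositions follow by
  conjugation.\<close>

lemma permute_vars_vandermonde_12:
  assumes "N \<ge> 2"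
  shows "permute_vars (transpose 1 2) (vandermonde N) = - vandermonde N"
proof -
  let ?\<tau> = "transpose 1 2 :: nat \<Rightarrow> nat" and ?e = "{1, 2} :: nat set"
  let ?G = "complete_edges N - {?e}"
  have \<tau>: "?\<tau> permutes {1..N}" using assms by (intro permutes_swap_id) auto
  have inj: "inj ((`) ?\<tau>)" using inj_image_image[OF permutes_inj[OF \<tau>]] .
  have e: "?e \<in> complete_edges N" using assms by (auto simp: pair_in_complete_edges)
  have \<tau>e: "?\<tau> ` ?e = ?e" by auto
  have img: "(`) ?\<tau> ` ?G = ?G"
    unfolding image_set_diff[OF inj] image_complete_edges[OF \<tau>] image_insert by (simp add: insert_commute)
  have "permute_vars ?\<tau> (edge_poly f) = edge_poly (?\<tau> ` f)" if "f \<in> ?G" for f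
  proof -
    have "f \<in> complete_edges N" using that by blast
    then obtain a b where ab: "f = {a, b}" "a < b" "a \<in> {1..N}" "b \<in> {1..N}"
      by (rule complete_edgesE)
    then have "?\<tau> a < ?\<tau> b" using that by (auto simp: transpose_def)
    then show ?thesis using ab by (simp add: edge_poly_pair unit_sign_def permute_vars_hom)
  qed
  then have "permute_vars ?\<tau> (graph_poly ?G) = (\<Prod>f\<in>?G. edge_poly (?\<tau> ` f))"
    by (simp add: graph_poly_def permute_vars_hom)
  also have "\<dots> = (\<Prod>f\<in>(`) ?\<tau> ` ?G. edge_poly f)"
    by (subst prod.reindex[OF inj_on_subset[OF inj subset_UNIV]]) simp
  finally have "permute_vars ?\<tau> (graph_poly ?G) = graph_poly ?G"
    unfolding img graph_poly_def .
  moreover have "permute_vars ?\<tau> (edge_poly ?e) = - edge_poly ?e"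
    by (simp add: edge_poly_pair unit_sign_def permute_vars_hom)
  moreover have "vandermonde N = edge_poly ?e * graph_poly ?G"
    using prod.remove[OF _ e, of edge_poly] by (simp add: graph_poly_def)
  ultimately show ?thesis by (simp add: permute_vars_hom)
qed

lemma permute_vars_vandermonde_transpose:
  assumes "a \<in> {1..N}" "b \<in> {1..N}" "a \<noteq> b"
  shows "permute_vars (transpose a b) (vandermonde N) = - vandermonde N"
proof -
  have N: "N \<ge> 2" using assms by auto
  then have "(1::nat) \<in> {1..N}" "2 \<in> {1..N}" by auto
  then obtain \<pi> where \<pi>: "\<pi> permutes {1..N}" "\<pi> 1 = a" "\<pi> 2 = b"
    using exists_permutes_two_points[OF assms, of 1 2] by auto
  have conj: "transpose a b \<circ> \<pi> = \<pi> \<circ> transpose 1 2"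
    using transpose_comp_eq[of \<pi> 1 2] \<pi> permutes_inj[OF \<pi>(1)] permutes_bij[OF \<pi>(1)]
    by (auto simp: fun_eq_iff transpose_def dest: injD)
  \<comment> \<open>The sign of the conjugating permutation is still unknown here, but it appears on
    both sides and cancels.\<close>
  obtain s where s: "permute_vars \<pi> (vandermonde N) = unit_sign s * vandermonde N"
    using permute_vars_graph_poly[OF permutes_inj[OF \<pi>(1)] order_refl, of N]
    by (auto simp: image_complete_edges[OF \<pi>(1)])
  have sg: "permute_vars \<tau> (unit_sign s * p) = unit_sign s * permute_vars \<tau> p" for \<tau> p
    by (auto simp: unit_sign_def permute_vars_hom)
  have "permute_vars (transpose a b \<circ> \<pi>) (vandermonde N) = - unit_sign s * vandermonde N"
    unfolding conj permute_vars_comp permute_vars_vandermonde_12[OF N] permute_vars_hom s by simp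
  then have "unit_sign s * permute_vars (transpose a b) (vandermonde N) = unit_sign s * (- vandermonde N)"
    by (simp add: permute_vars_comp s sg)
  from arg_cong[OF this, of "(*) (unit_sign s)"] show ?thesis by (simp only: unit_sign_square)
qed

lemma permute_vars_vandermonde:
  assumes "\<sigma> permutes {1..N}"
  shows "permute_vars \<sigma> (vandermonde N) = poly_scale (sign_char \<sigma>) (vandermonde N)"
  using assms finite_atLeastAtMost
proof (induction rule: permutes_induct)
  case id
  then show ?case by (simp add: sign_char_def)
next
  case (swap a b p)
  have "permutation p" using swap by (auto simp: permutation_permutes)
  then have sgn: "sign_char (transpose a b \<circ> p) = - sign_char p"
    using swap by (simp add: sign_char_def sign_compose permutation_swap_id sign_swap_id)
  show ?case
    unfolding sgn permute_vars_comp swap.IH permute_vars_hom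
      permute_vars_vandermonde_transpose[OF swap.hyps(1-3)] by simp
qed

section \<open>Spanning trees rooted at 1\<close>

text \<open>A spanning tree of \<open>{1..N}\<close> is given by the parents of the vertices other than the root
  \<open>1\<close>; \<open>z v\<close> is the number of descendants of \<open>v\<close> (including \<open>v\<close>). The recursion for \<open>z\<close> already
  excludes cycles.\<close>

definition weighted_tree :: "nat \<Rightarrow> (nat \<Rightarrow> nat) \<Rightarrow> (nat \<Rightarrow> nat) \<Rightarrow> bool" where
  "weighted_tree N par z \<longleftrightarrow> (\<forall>v\<in>{2..N}. par v \<in> {1..N}) \<and>
     (\<forall>v\<in>{1..N}. z v = 1 + (\<Sum>u\<in>{u\<in>{2..N}. par u = v}. z u))"

lemma weighted_tree_parent: "weighted_tree N par z \<Longrightarrow> v \<in> {2..N} \<Longrightarrow> par v \<in> {1..N}"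
  by (simp add: weighted_tree_def)

lemma weighted_tree_less_parent:
  assumes "weighted_tree N par z" "v \<in> {2..N}"
  shows "z v < z (par v)"
proof -
  have "z v \<le> (\<Sum>u\<in>{u\<in>{2..N}. par u = par v}. z u)"
    using assms(2) by (intro member_le_sum) auto
  moreover have "z (par v) = 1 + (\<Sum>u\<in>{u\<in>{2..N}. par u = par v}. z u)"
    using assms by (simp only: weighted_tree_def)
  ultimately show ?thesis by simp
qed

lemma weighted_tree_parent_neq: "weighted_tree N par z \<Longrightarrow> v \<in> {2..N} \<Longrightarrow> par v \<noteq> v"
  using weighted_tree_less_parent by fastforce

text \<open>Sum the recursion over all vertices: each vertex other than \<open>1\<close> is a child
  exactly once, so its weight occurs on both sides and only \<open>z 1\<close> and the
  \<open>N\<close> ones remain.\<close>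

lemma weighted_tree_root:
  assumes "weighted_tree N par z" "N \<ge> 1"
  shows "z 1 = N"
proof -
  have "(\<Sum>v=1..N. z v) = (\<Sum>v=1..N. 1 + (\<Sum>u\<in>{u\<in>{2..N}. par u = v}. z u))"
    using assms(1) by (intro sum.cong) (auto simp: weighted_tree_def)
  also have "\<dots> = N + (\<Sum>v=1..N. \<Sum>u\<in>{u\<in>{2..N}. par u = v}. z u)"
    by (simp only: sum.distrib) simp
  also have "(\<Sum>v=1..N. \<Sum>u\<in>{u\<in>{2..N}. par u = v}. z u) = (\<Sum>u=2..N. z u)"
    using assms(1) by (intro sum.group) (auto simp: weighted_tree_def)
  also have "(\<Sum>v=1..N. z v) = z 1 + (\<Sum>u=2..N. z u)"
    using assms(2) by (simp add: sum.atLeast_Suc_atMost numeral_2_eq_2)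
  finally show ?thesis by simp
qed

text \<open>Weights grow strictly towards the parent, so the maximum is attained at the root and
  equals \<open>N\<close>. The strict bounds later guarantee that the powers of \<omega> with these
  exponents differ from 1.\<close>

lemma weighted_tree_bounds:
  assumes "weighted_tree N par z" "v \<in> {2..N}"
  shows "0 < z v" "z v < N"
proof -
  show "0 < z v" using assms unfolding weighted_tree_def by auto
  define M where "M = Max (z ` {1..N})"
  have le: "z u \<le> M" if "u \<in> {1..N}" for u
    unfolding M_def using that by (intro Max_ge) auto
  have "M \<in> z ` {1..N}" unfolding M_def using assms(2) by (intro Max_in) auto
  then obtain u where u: "u \<in> {1..N}" "z u = M" by auto
  have "u = 1"
  proof (rule ccontr)
    assume "u \<noteq> 1"
    then have "u \<in> {2..N}" using u by auto
    then show False
      using weighted_tree_less_parent[OF assms(1)] le[OF weighted_tree_parent[OF assms(1)], of u] u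
      by fastforce
  qed
  then have "M = N" using u weighted_tree_root[OF assms(1)] assms(2) by auto
  then show "z v < N"
    using weighted_tree_less_parent[OF assms] le[OF weighted_tree_parent[OF assms]] by simp
qed

text \<open>A height \<open>d\<close> that drops along parents excludes cycles, so the recursion for
  the weights can be solved by iteration from 0.\<close>

lemma exists_weighted_tree:
  fixes d :: "nat \<Rightarrow> nat"
  assumes "\<And>v. v \<in> {2..N} \<Longrightarrow> par v \<in> {1..N} \<and> d (par v) < d v"
  shows "\<exists>z. weighted_tree N par z"
proof -
  define M where "M = Max (d ` {1..N})"
  have le: "d v \<le> M" if "v \<in> {1..N}" for v
    unfolding M_def using that by (intro Max_ge) auto
  \<comment> \<open>\<open>f k v\<close> counts the descendants of \<open>v\<close> at distance less
    than \<open>k\<close>. As heights are at most \<open>M\<close>, it is stationary once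
    \<open>k + d v > M\<close>.\<close>
  define f where "f k = rec_nat (\<lambda>_. 0::nat) (\<lambda>_ g v. 1 + (\<Sum>u\<in>{u\<in>{2..N}. par u = v}. g u)) k" for k :: nat
  have f_Suc: "f (Suc k) v = 1 + (\<Sum>u\<in>{u\<in>{2..N}. par u = v}. f k u)" for k v
    by (simp add: f_def)
  have "f (Suc k) v = f k v" if "v \<in> {1..N}" "k + d v > M" for k v
    using that
  proof (induction k arbitrary: v)
    case 0
    then show ?case using le[of v] by simp
  next
    case (Suc k)
    have "f (Suc k) u = f k u" if "u \<in> {u\<in>{2..N}. par u = v}" for u
      using that assms[of u] Suc.prems by (intro Suc.IH) auto
    then show ?case unfolding f_Suc[of "Suc k"] f_Suc[of k v] by (intro arg_cong2[of _ _ _ _ "(+)"] refl sum.cong)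
  qed
  then have "f (Suc M) v = 1 + (\<Sum>u\<in>{u\<in>{2..N}. par u = v}. f (Suc M) u)" if "v \<in> {1..N}" for v
    using that f_Suc[of "Suc M" v] by simp
  then show ?thesis using assms unfolding weighted_tree_def by blast
qed

definition tree_edges :: "nat \<Rightarrow> (nat \<Rightarrow> nat) \<Rightarrow> nat set set" where
  "tree_edges N par = (\<lambda>v. {v, par v}) ` {2..N}"

lemma tree_edges_subset:
  assumes "weighted_tree N par z"
  shows "tree_edges N par \<subseteq> complete_edges N"
  using weighted_tree_parent[OF assms] weighted_tree_parent_neq[OF assms]
  by (fastforce simp: tree_edges_def pair_in_complete_edges)

lemma inj_on_tree_edges:
  assumes "weighted_tree N par z"
  shows "inj_on (\<lambda>v. {v, par v}) {2..N}"
proof (rule inj_onI)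
  fix u v assume "u \<in> {2..N}" "v \<in> {2..N}" "{u, par u} = {v, par v}"
  then show "u = v"
    using weighted_tree_less_parent[OF assms, of u] weighted_tree_less_parent[OF assms, of v]
    by (auto simp: doubleton_eq_iff)
qed

lemma card_tree_edges: "weighted_tree N par z \<Longrightarrow> card (tree_edges N par) = N - 1"
  unfolding tree_edges_def by (subst card_image[OF inj_on_tree_edges]) auto

lemma connected_tree_edges:
  assumes "weighted_tree N par z"
  shows "connected_graph {1..N} (tree_edges N par)"
proof -
  let ?R = "{(a, b). {a, b} \<in> tree_edges N par}"
  have to_root: "(v, 1) \<in> ?R\<^sup>*" if "v \<in> {1..N}" for v
    using that
  proof (induction "N - z v" arbitrary: v rule: less_induct)
    case less
    show ?case
    proof (cases "v = 1")
      case False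
      then have v: "v \<in> {2..N}" using less.prems by auto
      then have "(v, par v) \<in> ?R" by (auto simp: tree_edges_def)
      moreover have "(par v, 1) \<in> ?R\<^sup>*"
        using v weighted_tree_less_parent[OF assms v] weighted_tree_bounds[OF assms v]
        by (intro less.hyps weighted_tree_parent[OF assms v]) auto
      ultimately show ?thesis by (rule converse_rtrancl_into_rtrancl)
    qed simp
  qed
  have "sym ?R" by (auto simp: sym_def insert_commute)
  then have "sym (?R\<^sup>*)" by (rule sym_rtrancl)
  then show ?thesis using to_root unfolding connected_graph_def by (meson rtrancl_trans symD)
qed

text \<open>Sending each vertex to a neighbour that is closer to \<open>1\<close> gives a spanning tree.\<close>

lemma connected_graph_spanning_tree:
  assumes "connected_graph {1..N} E" "E \<subseteq> complete_edges N"
  obtains par z where "weighted_tree N par z" "tree_edges N par \<subseteq> E"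
proof -
  let ?R = "{(a, b). {a, b} \<in> E}"
  define d where "d v = (LEAST k. (1, v) \<in> ?R ^^ k)" for v
  have "\<exists>u. u \<in> {1..N} \<and> d u < d v \<and> {v, u} \<in> E" if v: "v \<in> {2..N}" for v
  proof -
    have "(1, v) \<in> ?R\<^sup>*" using assms(1) v unfolding connected_graph_def by auto
    then have "\<exists>k. (1, v) \<in> ?R ^^ k" by (simp add: rtrancl_power)
    then have dv: "(1, v) \<in> ?R ^^ d v" unfolding d_def by (rule LeastI_ex)
    show ?thesis
    proof (cases "d v")
      case 0
      then show ?thesis using dv v by simp
    next
      case (Suc k)
      then obtain u where u: "(1, u) \<in> ?R ^^ k" "{u, v} \<in> E" using dv by auto
      then have "d u \<le> k" unfolding d_def by (intro Least_le)
      moreover have "u \<in> {1..N}" using u(2) assms(2) pair_in_complete_edges by blast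
      ultimately show ?thesis using u Suc by (auto simp: insert_commute intro!: exI[of _ u])
    qed
  qed
  then obtain par where par: "\<And>v. v \<in> {2..N} \<Longrightarrow> par v \<in> {1..N} \<and> d (par v) < d v \<and> {v, par v} \<in> E"
    by metis
  then obtain z where "weighted_tree N par z" using exists_weighted_tree[of N par d] by blast
  moreover have "tree_edges N par \<subseteq> E" using par by (auto simp: tree_edges_def)
  ultimately show ?thesis by (rule that)
qed

text \<open>The complement contains a spanning tree, which has \<open>n\<close> edges; this leaves
  at most \<open>(n + 1 choose 2) - n\<close> edges for \<open>G\<close>, and equality forces the
  complement to be that tree.\<close>

lemma slim_card_le:
  assumes "slim n G"
  obtains par z where "weighted_tree (n + 1) par z" "card G \<le> n choose 2"
    "card G = n choose 2 \<Longrightarrow> G = complete_edges (n + 1) - tree_edges (n + 1) par"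
proof -
  let ?K = "complete_edges (n + 1)"
  have G: "G \<subseteq> ?K" using assms by (simp add: slim_def)
  obtain par z where tree: "weighted_tree (n + 1) par z" "tree_edges (n + 1) par \<subseteq> ?K - G"
    using assms connected_graph_spanning_tree[of "n + 1" "?K - G"] by (auto simp: slim_def)
  have K: "card ?K = (n choose 2) + n" by (simp add: card_complete_edges numeral_2_eq_2)
  have sub: "G \<subseteq> ?K - tree_edges (n + 1) par" using tree(2) G by blast
  have card: "card (?K - tree_edges (n + 1) par) = n choose 2"
    using tree_edges_subset[OF tree(1)] card_tree_edges[OF tree(1)] K
    by (subst card_Diff_subset) (auto intro: finite_subset[OF _ finite_complete_edges])
  have fin: "finite (?K - tree_edges (n + 1) par)" by simp
  show ?thesis
  proof (rule that[OF tree(1)])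
    show "card G \<le> n choose 2" using card_mono[OF fin sub] card by simp
    show "G = ?K - tree_edges (n + 1) par" if "card G = n choose 2"
      using card_subset_eq[OF fin sub] that card by simp
  qed
qed

lemma V_deg_above_top:
  assumes "k > n choose 2"
  shows "V_deg n k = {0}"
proof -
  have "card G \<noteq> k" if "slim n G" for G using slim_card_le[OF that] assms by fastforce
  then have "{graph_poly G |G. slim n G \<and> card G = k} = {}" by blast
  then show ?thesis by (simp only: V_deg_eq_span cpoly.span_empty)
qed

text \<open>\<open>tree_poly\<close> is the Vandermonde product divided by the \<open>x\<^bsub>par v\<^esub> - x\<^sub>v\<close>, the product of
  the edges of the tree directed away from the root.\<close>

definition tree_poly :: "nat \<Rightarrow> (nat \<Rightarrow> nat) \<Rightarrow> cpoly" where
  "tree_poly N par =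
     (\<Prod>v\<in>{2..N}. unit_sign (par v < v)) * graph_poly (complete_edges N - tree_edges N par)"

definition tree_denom :: "nat \<Rightarrow> (nat \<Rightarrow> nat) \<Rightarrow> cpoly" where
  "tree_denom N par = (\<Prod>v\<in>{2..N}. poly_var (par v) - poly_var v)"

lemma tree_poly_mult_denom:
  assumes "weighted_tree N par z"
  shows "tree_poly N par * tree_denom N par = vandermonde N"
proof -
  have "(\<Prod>v\<in>{2..N}. unit_sign (par v < v)) * tree_denom N par = (\<Prod>v\<in>{2..N}. edge_poly {v, par v})"
    unfolding tree_denom_def prod.distrib[symmetric]
  proof (rule prod.cong)
    fix v assume "v \<in> {2..N}"
    then have "par v \<noteq> v" by (rule weighted_tree_parent_neq[OF assms])
    then show "unit_sign (par v < v) * (poly_var (par v) - poly_var v) = edge_poly {v, par v}"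
      using edge_poly_pair[of "par v" v] by (simp add: insert_commute)
  qed simp
  also have "\<dots> = graph_poly (tree_edges N par)"
    unfolding graph_poly_def tree_edges_def using inj_on_tree_edges[OF assms] by (simp add: prod.reindex)
  finally have signs: "(\<Prod>v\<in>{2..N}. unit_sign (par v < v)) * tree_denom N par = graph_poly (tree_edges N par)" .
  have "tree_poly N par * tree_denom N par = graph_poly (complete_edges N - tree_edges N par) *
      ((\<Prod>v\<in>{2..N}. unit_sign (par v < v)) * tree_denom N par)"
    unfolding tree_poly_def by (simp only: ac_simps)
  also have "\<dots> = vandermonde N"
    unfolding signs graph_poly_def
    by (rule prod.subset_diff[OF tree_edges_subset[OF assms] finite_complete_edges, symmetric])
  finally show ?thesis .
qed

lemma prod_unit_sign: "\<exists>b. (\<Prod>v\<in>A. unit_sign (P v)) = (unit_sign b :: cpoly)"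
proof (induction A rule: infinite_finite_induct)
  case (insert v A)
  then obtain b where b: "(\<Prod>v\<in>A. unit_sign (P v)) = (unit_sign b :: cpoly)" by blast
  have "unit_sign (P v) * unit_sign b = (unit_sign (P v = b) :: cpoly)" by (auto simp: unit_sign_def)
  then show ?case using insert.hyps b by auto
qed (auto simp: unit_sign_def intro: exI[of _ True])

lemma tree_poly_in_V_deg:
  assumes "weighted_tree (n + 1) par z"
  shows "tree_poly (n + 1) par \<in> V_deg n (n choose 2)"
proof -
  let ?K = "complete_edges (n + 1)" and ?T = "tree_edges (n + 1) par"
  have "?K - (?K - ?T) = ?T" using tree_edges_subset[OF assms] by blast
  then have "slim n (?K - ?T)" using connected_tree_edges[OF assms] by (auto simp: slim_def)
  moreover have "card (?K - ?T) = n choose 2"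
    using tree_edges_subset[OF assms] card_tree_edges[OF assms]
    by (subst card_Diff_subset)
      (auto intro: finite_subset[OF _ finite_complete_edges] simp: card_complete_edges numeral_2_eq_2)
  ultimately have "graph_poly (?K - ?T) \<in> V_deg n (n choose 2)" using graph_poly_in_V_deg by metis
  then show ?thesis
    unfolding tree_poly_def using prod_unit_sign[of "\<lambda>v. par v < v" "{2..n + 1}"]
    by (auto simp: V_deg_eq_span intro: unit_sign_mult_in_span)
qed

lemma V_deg_top_eq_span:
  "V_deg n (n choose 2) = cpoly.span {tree_poly (n + 1) par |par z. weighted_tree (n + 1) par z}"
proof
  let ?P = "{tree_poly (n + 1) par |par z. weighted_tree (n + 1) par z}"
  have "graph_poly G \<in> cpoly.span ?P" if G: "slim n G" "card G = n choose 2" for G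
  proof -
    obtain par z where tree: "weighted_tree (n + 1) par z"
      and G': "G = complete_edges (n + 1) - tree_edges (n + 1) par"
      using slim_card_le[OF G(1)] G(2) by metis
    obtain b where b: "(\<Prod>v\<in>{2..n + 1}. unit_sign (par v < v)) = (unit_sign b :: cpoly)"
      using prod_unit_sign[of "\<lambda>v. par v < v" "{2..n + 1}"] by blast
    then have "graph_poly G = unit_sign b * tree_poly (n + 1) par"
      by (simp only: tree_poly_def b flip: G') simp
    moreover have "tree_poly (n + 1) par \<in> cpoly.span ?P"
      using tree by (intro cpoly.span_base) blast
    ultimately show ?thesis by (simp add: unit_sign_mult_in_span)
  qed
  then show "V_deg n (n choose 2) \<subseteq> cpoly.span ?P"
    unfolding V_deg_eq_span by (intro cpoly.span_minimal cpoly.subspace_span) blast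
  show "cpoly.span ?P \<subseteq> V_deg n (n choose 2)"
    using tree_poly_in_V_deg by (intro cpoly.span_minimal subspace_V_deg) blast
qed

section \<open>Straightening trees into paths\<close>

text \<open>Hanging the subtree of \<open>c\<close> below its sibling \<open>b\<close> enlarges only
  the weight of \<open>b\<close>: the common parent still counts the descendants of
  \<open>c\<close>, now through \<open>b\<close>.\<close>

lemma weighted_tree_rehang:
  assumes tree: "weighted_tree N par z"
    and b: "b \<in> {2..N}" and c: "c \<in> {2..N}" and bc: "b \<noteq> c" "par b = par c"
  shows "weighted_tree N (par(c := b)) (z(b := z b + z c))"
  unfolding weighted_tree_def
proof (intro conjI ballI)
  let ?par = "par(c := b)" and ?z = "z(b := z b + z c)"
  show "?par v \<in> {1..N}" if "v \<in> {2..N}" for v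
    using weighted_tree_parent[OF tree that] b by auto
  fix x assume x: "x \<in> {1..N}"
  let ?C = "{u \<in> {2..N}. par u = x}" and ?C' = "{u \<in> {2..N}. ?par u = x}"
  have zx: "z x = 1 + (\<Sum>u\<in>?C. z u)" using tree x unfolding weighted_tree_def by blast
  have ne: "par b \<noteq> b" "par c \<noteq> c" using weighted_tree_parent_neq[OF tree] b c by auto
  consider "x = b" | "x = par b" | "x \<noteq> b" "x \<noteq> par b" by blast
  then show "?z x = 1 + (\<Sum>u\<in>?C'. ?z u)"
  proof cases
    case 1
    have "?C' = insert c ?C" "c \<notin> ?C" using 1 c bc ne by auto
    then have "(\<Sum>u\<in>?C'. ?z u) = z c + (\<Sum>u\<in>?C. ?z u)" using bc by simp
    also have "(\<Sum>u\<in>?C. ?z u) = (\<Sum>u\<in>?C. z u)" using 1 ne by (intro sum.cong) auto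
    finally have "(\<Sum>u\<in>?C'. ?z u) = z c + (\<Sum>u\<in>?C. z u)" .
    moreover have "?z x = z x + z c" using 1 by simp
    ultimately show ?thesis using zx by linarith
  next
    case 2
    define D where "D = ?C - {b, c}"
    have C: "?C = insert b (insert c D)" "?C' = insert b D" using 2 b c bc ne by (auto simp: D_def)
    have "finite D" "b \<notin> D" "c \<notin> D" by (auto simp: D_def)
    then have "(\<Sum>u\<in>?C. z u) = z b + (z c + (\<Sum>u\<in>D. z u))" "(\<Sum>u\<in>?C'. ?z u) = z b + z c + (\<Sum>u\<in>D. ?z u)"
      unfolding C using bc by simp_all
    moreover have "(\<Sum>u\<in>D. ?z u) = (\<Sum>u\<in>D. z u)" by (intro sum.cong) (auto simp: D_def)
    moreover have "?z x = z x" using 2 ne by simp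
    ultimately show ?thesis using zx by linarith
  next
    case 3
    then have "?C' = ?C" using bc by auto
    moreover have "(\<Sum>u\<in>?C. ?z u) = (\<Sum>u\<in>?C. z u)" using 3 by (intro sum.cong) auto
    ultimately show ?thesis using zx 3 by simp
  qed
qed

text \<open>The partial fraction identity
  \<open>1/((v - b)(v - c)) = 1/((v - b)(b - c)) + 1/((v - c)(c - b))\<close>, multiplied by the
  Vandermonde product.\<close>

lemma tree_poly_rehang:
  assumes tree: "weighted_tree N par z"
    and b: "b \<in> {2..N}" and c: "c \<in> {2..N}" and bc: "b \<noteq> c" "par b = par c"
  shows "tree_poly N par = tree_poly N (par(c := b)) + tree_poly N (par(b := c))"
proof -
  have tree1: "weighted_tree N (par(c := b)) (z(b := z b + z c))"
    using assms by (rule weighted_tree_rehang)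
  have tree2: "weighted_tree N (par(b := c)) (z(c := z c + z b))"
    using assms by (intro weighted_tree_rehang) auto
  let ?x = poly_var and ?v = "par b"
  define Q where "Q = (\<Prod>u\<in>{2..N} - {b, c}. ?x (par u) - ?x u)"
  have denom: "tree_denom N p = (?x (p b) - ?x b) * ((?x (p c) - ?x c) * Q)"
    if "\<And>u. u \<notin> {b, c} \<Longrightarrow> p u = par u" for p
  proof -
    have "tree_denom N p = (?x (p b) - ?x b) * (\<Prod>u\<in>{2..N} - {b}. ?x (p u) - ?x u)"
      unfolding tree_denom_def using b by (intro prod.remove) auto
    also have "(\<Prod>u\<in>{2..N} - {b}. ?x (p u) - ?x u)
        = (?x (p c) - ?x c) * (\<Prod>u\<in>{2..N} - {b} - {c}. ?x (p u) - ?x u)"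
      using c bc by (intro prod.remove) auto
    also have "{2..N} - {b} - {c} = {2..N} - {b, c}" by blast
    also have "(\<Prod>u\<in>{2..N} - {b, c}. ?x (p u) - ?x u) = Q"
      unfolding Q_def using that by (intro prod.cong) auto
    finally show ?thesis .
  qed
  have d: "tree_poly N par * ((?x ?v - ?x b) * ((?x ?v - ?x c) * Q)) = vandermonde N"
    using tree_poly_mult_denom[OF tree] denom[of par] bc by simp
  have d1: "tree_poly N (par(c := b)) * ((?x ?v - ?x b) * ((?x b - ?x c) * Q)) = vandermonde N"
    using tree_poly_mult_denom[OF tree1] denom[of "par(c := b)"] bc by simp
  have d2: "tree_poly N (par(b := c)) * ((?x c - ?x b) * ((?x ?v - ?x c) * Q)) = vandermonde N"
    using tree_poly_mult_denom[OF tree2] denom[of "par(b := c)"] bc by simp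
  \<comment> \<open>A common multiple, up to sign, of the three denominators. Multiplying by it and
    cancelling in the integral domain of polynomials replaces a computation with fractions.\<close>
  let ?W = "(?x ?v - ?x b) * (?x ?v - ?x c) * (?x b - ?x c) * Q"
  have "?v \<noteq> b" "?v \<noteq> c" using weighted_tree_parent_neq[OF tree] b c bc by metis+
  moreover have "Q \<noteq> 0" using weighted_tree_parent_neq[OF tree] by (auto simp: Q_def)
  ultimately have W: "?W \<noteq> 0" using bc by simp
  have "tree_poly N par * ?W = vandermonde N * (?x b - ?x c)"
    using d[symmetric] by (simp only: ac_simps)
  also have "\<dots> = vandermonde N * (?x ?v - ?x c) - vandermonde N * (?x ?v - ?x b)"
    by (simp add: algebra_simps)
  also have "vandermonde N * (?x ?v - ?x c) = tree_poly N (par(c := b)) * ?W"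
    using d1[symmetric] by (simp only: ac_simps)
  also have "vandermonde N * (?x ?v - ?x b) = - (tree_poly N (par(b := c)) * ?W)"
  proof -
    have "vandermonde N * (?x ?v - ?x b)
        = tree_poly N (par(b := c)) * ((?x ?v - ?x b) * (?x ?v - ?x c) * (?x c - ?x b) * Q)"
      using d2[symmetric] by (simp only: ac_simps)
    also have "?x c - ?x b = - (?x b - ?x c)" by simp
    finally show ?thesis by (simp only: mult_minus_left mult_minus_right)
  qed
  finally have "tree_poly N par * ?W = (tree_poly N (par(c := b)) + tree_poly N (par(b := c))) * ?W"
    by (simp only: distrib_right diff_minus_eq_add)
  then show ?thesis by (simp only: mult_right_cancel[OF W])
qed

text \<open>Each rehanging raises the total weight of the non-root vertices, which is bounded by
  \<open>N * N\<close>; the process stops at trees without siblings, that is, paths starting at the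
  root. The same induction expands tree polynomials in paths and evaluates the functional on
  trees.\<close>

lemma weighted_tree_induct [consumes 1, case_names path rehang]:
  assumes "weighted_tree N par z"
    and path: "\<And>par z. weighted_tree N par z \<Longrightarrow> inj_on par {2..N} \<Longrightarrow> P par z"
    and rehang: "\<And>par z b c. weighted_tree N par z \<Longrightarrow> b \<in> {2..N} \<Longrightarrow> c \<in> {2..N} \<Longrightarrow> b \<noteq> c \<Longrightarrow>
      par b = par c \<Longrightarrow> P (par(c := b)) (z(b := z b + z c)) \<Longrightarrow>
      P (par(b := c)) (z(c := z c + z b)) \<Longrightarrow> P par z"
  shows "P par z"
  using assms(1)
proof (induction "N * N - (\<Sum>v=2..N. z v)" arbitrary: par z rule: less_induct)
  case less
  show ?case
  proof (cases "inj_on par {2..N}")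
    case False
    then obtain b c where bc: "b \<in> {2..N}" "c \<in> {2..N}" "b \<noteq> c" "par b = par c"
      by (auto simp: inj_on_def)
    have *: "P (par(c := b)) (z(b := z b + z c))"
      if bc: "b \<in> {2..N}" "c \<in> {2..N}" "b \<noteq> c" "par b = par c" for b c
    proof (rule less.hyps)
      let ?z = "z(b := z b + z c)"
      show tree: "weighted_tree N (par(c := b)) ?z" using less.prems bc by (rule weighted_tree_rehang)
      have "(\<Sum>v=2..N. z v) < (\<Sum>v=2..N. ?z v)"
        using bc weighted_tree_bounds(1)[OF less.prems bc(2)] by (intro sum_strict_mono_ex1) auto
      moreover have "(\<Sum>v=2..N. ?z v) \<le> (\<Sum>v=2..N. N)"
        using weighted_tree_bounds(2)[OF tree] by (intro sum_mono less_imp_le)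
      then have "(\<Sum>v=2..N. ?z v) \<le> N * N" by (rule order_trans) simp
      ultimately show "N * N - (\<Sum>v=2..N. ?z v) < N * N - (\<Sum>v=2..N. z v)" by linarith
    qed
    show ?thesis
      using *[of b c] *[of c b] bc by (intro rehang[OF less.prems, of b c]) auto
  qed (rule path[OF less.prems])
qed

section \<open>Path polynomials\<close>

text \<open>The word is read as the path \<open>w 1\<close>, ..., \<open>w N\<close> and rooted at
  \<open>1\<close>, wherever that letter stands: parents lie to the right before it and to the left
  after it. Accordingly \<open>path_weight\<close> counts the positions from the end of the path on
  the far side of the root.\<close>

definition path_parent :: "(nat \<Rightarrow> nat) \<Rightarrow> nat \<Rightarrow> nat" where
  "path_parent w v = (if inv' w v < inv' w 1 then w (inv' w v + 1) else w (inv' w v - 1))"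

definition path_weight :: "nat \<Rightarrow> (nat \<Rightarrow> nat) \<Rightarrow> nat \<Rightarrow> nat" where
  "path_weight N w v =
     (if inv' w v < inv' w 1 then inv' w v else if v = 1 then N else N + 1 - inv' w v)"

text \<open>Turns a product over non-root vertices into one over the steps of the path, split where
  the orientation of the edges changes. It is generic in \<open>f\<close> because denominators and
  edge weights both need it.\<close>

lemma prod_path:
  fixes f :: "nat \<Rightarrow> nat \<Rightarrow> nat \<Rightarrow> 'a::comm_monoid_mult"
  assumes w: "w permutes {1..N}" and N: "N \<ge> 1"
  defines "m \<equiv> inv' w 1"
  shows "(\<Prod>v\<in>{2..N}. f (path_parent w v) v (path_weight N w v)) =
    (\<Prod>i\<in>{1..<m}. f (w (i + 1)) (w i) i) * (\<Prod>i\<in>{m..<N}. f (w i) (w (i + 1)) (N - i))"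
proof -
  let ?g = "\<lambda>v. f (path_parent w v) v (path_weight N w v)"
  have inv [simp]: "inv' w (w i) = i" for i using w by (rule permutes_inverses)
  have wm: "w m = 1" unfolding m_def using w by (rule permutes_inverses)
  have m: "m \<in> {1..N}" unfolding m_def using permutes_in_image[OF permutes_inv[OF w]] N by simp
  have inj: "inj w" using w by (rule permutes_inj)
  have "w ` ({1..N} - {m}) = {1..N} - {1}"
    using permutes_image[OF w] wm by (simp add: image_set_diff[OF inj])
  then have "(\<Prod>v\<in>{2..N}. ?g v) = (\<Prod>v\<in>w ` ({1..N} - {m}). ?g v)"
    by (intro prod.cong) auto
  also have "\<dots> = (\<Prod>i\<in>{1..N} - {m}. ?g (w i))"
    by (subst prod.reindex) (auto intro: inj_on_subset[OF inj])
  also have "{1..N} - {m} = {1..<m} \<union> {Suc m..<Suc N}" using m by auto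
  also have "(\<Prod>i\<in>{1..<m} \<union> {Suc m..<Suc N}. ?g (w i)) = (\<Prod>i\<in>{1..<m}. ?g (w i)) * (\<Prod>i\<in>{Suc m..<Suc N}. ?g (w i))"
    by (subst prod.union_disjoint) auto
  also have "(\<Prod>i\<in>{1..<m}. ?g (w i)) = (\<Prod>i\<in>{1..<m}. f (w (i + 1)) (w i) i)"
    by (intro prod.cong) (auto simp: path_parent_def path_weight_def m_def)
  also have "(\<Prod>i\<in>{Suc m..<Suc N}. ?g (w i)) = (\<Prod>i\<in>{m..<N}. ?g (w (Suc i)))"
    by (rule prod.shift_bounds_Suc_ivl)
  also have "\<dots> = (\<Prod>i\<in>{m..<N}. f (w i) (w (i + 1)) (N - i))"
  proof (rule prod.cong)
    fix i assume i: "i \<in> {m..<N}"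
    have "w (Suc i) \<noteq> 1"
    proof
      assume "w (Suc i) = 1"
      then have "m = Suc i" using inv[of "Suc i"] by (simp only: m_def)
      then show False using i by simp
    qed
    then show "?g (w (Suc i)) = f (w i) (w (i + 1)) (N - i)"
      using i by (simp add: path_parent_def path_weight_def m_def)
  qed simp
  finally show ?thesis .
qed

lemma weighted_tree_path:
  assumes w: "w permutes {1..N}" and N: "N \<ge> 1"
  shows "weighted_tree N (path_parent w) (path_weight N w)"
  unfolding weighted_tree_def
proof (intro conjI ballI)
  define m where "m = inv' w 1"
  have inv: "inv' w (w i) = i" "w (inv' w i) = i" for i using w by (simp_all add: permutes_inverses)
  have wm: "w m = 1" unfolding m_def by (rule inv)
  have in_iff: "w i \<in> {1..N} \<longleftrightarrow> i \<in> {1..N}" "inv' w i \<in> {1..N} \<longleftrightarrow> i \<in> {1..N}" for i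
    using permutes_in_image[OF w] permutes_in_image[OF permutes_inv[OF w]] by auto
  have m: "m \<in> {1..N}" unfolding m_def in_iff using N by simp
  have eq_iff: "w i = w j \<longleftrightarrow> i = j" for i j using permutes_inj[OF w] by (auto dest: injD)
  have par: "path_parent w (w i) = (if i < m then w (i + 1) else w (i - 1))" for i
    unfolding path_parent_def inv m_def[symmetric] by (rule refl)
  have w1: "w i = 1 \<longleftrightarrow> i = m" for i using eq_iff[of i m] wm by simp
  have wgt: "path_weight N w (w i) = (if i < m then i else if i = m then N else N + 1 - i)" for i
    unfolding path_weight_def inv m_def[symmetric] w1 by (rule refl)
  show "path_parent w v \<in> {1..N}" if "v \<in> {2..N}" for v
  proof -
    define i where "i = inv' w v"
    have v: "v = w i" by (simp add: i_def inv)
    have "i \<in> {1..N}" using that by (subst i_def, subst in_iff) auto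
    moreover have "i \<noteq> m" using v wm that by auto
    ultimately have "i < m \<Longrightarrow> i + 1 \<in> {1..N}" "\<not> i < m \<Longrightarrow> i - 1 \<in> {1..N}" using m by auto
    then show ?thesis unfolding v par by (cases "i < m") (simp_all only: in_iff if_True if_False not_False_eq_True)
  qed
  fix x assume x: "x \<in> {1..N}"
  define i where "i = inv' w x"
  have xi: "x = w i" by (simp add: i_def inv)
  have i: "i \<in> {1..N}" using x by (simp only: i_def in_iff)
  define S where "S = {j \<in> {1..N} - {m}. (if j < m then j + 1 else j - 1) = i}"
  have "{u \<in> {2..N}. path_parent w u = x} = w ` S"
  proof (intro subset_antisym subsetI)
    fix u assume u: "u \<in> {u \<in> {2..N}. path_parent w u = x}"
    define j where "j = inv' w u"
    have uj: "u = w j" by (simp add: j_def inv)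
    have "j \<in> {1..N}" using u by (subst j_def, subst in_iff) auto
    moreover have "j \<noteq> m" using u wm uj by auto
    moreover have "(if j < m then j + 1 else j - 1) = i"
      using u unfolding uj xi by (auto simp: par eq_iff split: if_splits)
    ultimately show "u \<in> w ` S" using uj by (auto simp: S_def)
  next
    fix u assume "u \<in> w ` S"
    then obtain j where j: "u = w j" "j \<in> {1..N}" "j \<noteq> m" "(if j < m then j + 1 else j - 1) = i"
      by (auto simp: S_def)
    have "w j \<in> {1..N}" "w j \<noteq> 1" using j(2,3) by (simp_all only: in_iff w1 not_False_eq_True)
    then show "u \<in> {u \<in> {2..N}. path_parent w u = x}"
      using j by (auto simp: par xi)
  qed
  then have "(\<Sum>u\<in>{u \<in> {2..N}. path_parent w u = x}. path_weight N w u) = (\<Sum>j\<in>S. path_weight N w (w j))"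
    by (simp add: sum.reindex[OF inj_on_subset[OF permutes_inj[OF w] subset_UNIV]])
  also have "\<dots> = (\<Sum>j\<in>S. if j < m then j else N + 1 - j)"
    unfolding wgt by (rule sum.cong) (auto simp: S_def)
  also have "1 + \<dots> = path_weight N w x"
  proof -
    consider "i < m" | "i = m" | "i > m" by linarith
    then show ?thesis
    proof cases
      case 1
      then have "S = (if i = 1 then {} else {i - 1})" using i m by (auto simp: S_def)
      then show ?thesis using 1 i by (auto simp: xi wgt)
    next
      case 2
      then have "S = (if m = 1 then {} else {m - 1}) \<union> (if m = N then {} else {m + 1})"
        using m by (auto simp: S_def)
      then show ?thesis using 2 m by (auto simp: xi wgt)
    next
      case 3
      then have "S = (if i = N then {} else {i + 1})" using i m by (auto simp: S_def)
      then show ?thesis using 3 i by (auto simp: xi wgt)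
    qed
  qed
  finally show "path_weight N w x = 1 + (\<Sum>u\<in>{u \<in> {2..N}. path_parent w u = x}. path_weight N w u)"
    by simp
qed

definition path_denom :: "nat \<Rightarrow> (nat \<Rightarrow> nat) \<Rightarrow> cpoly" where
  "path_denom N w = (\<Prod>i\<in>{1..<N}. poly_var (w i) - poly_var (w (i + 1)))"

text \<open>In \<open>tree_poly\<close> the edges before the letter \<open>1\<close> are oriented
  against the direction of reading. The sign undoes this, so that \<open>path_poly\<close> is the
  Vandermonde product divided by the consecutive differences along \<open>w\<close>, and permuting
  variables becomes composition of words up to the sign character.\<close>

definition path_poly :: "nat \<Rightarrow> (nat \<Rightarrow> nat) \<Rightarrow> cpoly" where
  "path_poly N w = (- 1) ^ (inv' w 1 - 1) * tree_poly N (path_parent w)"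

lemma path_poly_mult_denom:
  assumes w: "w permutes {1..N}" and N: "N \<ge> 1"
  shows "path_poly N w * path_denom N w = vandermonde N"
proof -
  let ?m = "inv' w 1"
  have m: "?m \<in> {1..N}" using permutes_in_image[OF permutes_inv[OF w], of 1] N by simp
  have "{1..<N} = {1..<?m} \<union> {?m..<N}" using m by auto
  then have split: "path_denom N w = (\<Prod>i\<in>{1..<?m}. poly_var (w i) - poly_var (w (i + 1)))
      * (\<Prod>i\<in>{?m..<N}. poly_var (w i) - poly_var (w (i + 1)))"
    unfolding path_denom_def by (subst prod.union_disjoint[symmetric]) auto
  have "tree_denom N (path_parent w) = (\<Prod>i\<in>{1..<?m}. - 1 * (poly_var (w i) - poly_var (w (i + 1))))
      * (\<Prod>i\<in>{?m..<N}. poly_var (w i) - poly_var (w (i + 1)))"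
    unfolding tree_denom_def using prod_path[OF w N, of "\<lambda>a b _. poly_var a - poly_var b"] by simp
  also have "\<dots> = (- 1) ^ (?m - 1) * path_denom N w"
    unfolding prod.distrib split by (simp add: mult.assoc)
  finally show ?thesis
    using tree_poly_mult_denom[OF weighted_tree_path[OF w N]] by (simp add: path_poly_def ac_simps)
qed

lemma path_denom_nonzero: "w permutes {1..N} \<Longrightarrow> path_denom N w \<noteq> 0"
  using inj_eq[OF permutes_inj[of w]] by (simp add: path_denom_def)

lemma permute_vars_path_poly:
  assumes \<sigma>: "\<sigma> permutes {1..N}" and w: "w permutes {1..N}" and N: "N \<ge> 1"
  shows "permute_vars \<sigma> (path_poly N w) = poly_scale (sign_char \<sigma>) (path_poly N (\<sigma> \<circ> w))"
proof -
  have \<sigma>w: "(\<sigma> \<circ> w) permutes {1..N}" using w \<sigma> by (rule permutes_compose)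
  have "permute_vars \<sigma> (path_denom N w) = path_denom N (\<sigma> \<circ> w)"
    by (simp add: path_denom_def permute_vars_hom)
  then have "permute_vars \<sigma> (path_poly N w) * path_denom N (\<sigma> \<circ> w) = permute_vars \<sigma> (vandermonde N)"
    using path_poly_mult_denom[OF w N] by (metis permute_vars_hom(4))
  also have "\<dots> = poly_scale (sign_char \<sigma>) (path_poly N (\<sigma> \<circ> w)) * path_denom N (\<sigma> \<circ> w)"
    by (simp only: permute_vars_vandermonde[OF \<sigma>] poly_scale_def mult.assoc path_poly_mult_denom[OF \<sigma>w N])
  finally show ?thesis using path_denom_nonzero[OF \<sigma>w] by simp
qed

lemma path_poly_in_V_deg:
  assumes "w permutes {1..n + 1}"
  shows "path_poly (n + 1) w \<in> V_deg n (n choose 2)"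
proof -
  have "tree_poly (n + 1) (path_parent w) \<in> V_deg n (n choose 2)"
    using weighted_tree_path[OF assms] by (intro tree_poly_in_V_deg) simp
  then show ?thesis
    by (cases "even (inv' w 1 - 1)") (auto simp: path_poly_def intro: cpoly.subspace_neg[OF subspace_V_deg])
qed

definition root_words :: "nat \<Rightarrow> (nat \<Rightarrow> nat) set" where
  "root_words N = {w. w permutes {1..N} \<and> w 1 = 1}"

lemma root_words_permutes: "w \<in> root_words N \<Longrightarrow> w permutes {1..N}"
  by (simp add: root_words_def)

lemma finite_root_words [simp]: "finite (root_words N)"
  by (rule finite_subset[OF _ finite_permutations[of "{1..N}"]]) (auto simp: root_words_def)

text \<open>Without siblings the weight grows by exactly one towards the parent, so \<open>z\<close>
  is a bijection onto \<open>{1..N}\<close>, and the vertex of weight \<open>s\<close> is put at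
  position \<open>N + 1 - s\<close>.\<close>

lemma path_tree_word:
  assumes tree: "weighted_tree N par z" and inj: "inj_on par {2..N}" and N: "N \<ge> 1"
  obtains w where "w \<in> root_words N" "\<And>v. v \<in> {2..N} \<Longrightarrow> path_parent w v = par v"
    "\<And>v. v \<in> {2..N} \<Longrightarrow> path_weight N w v = z v"
proof -
  have root: "z 1 = N" using tree N by (rule weighted_tree_root)
  have bounds: "z v \<in> {1..N}" if "v \<in> {1..N}" for v
  proof (cases "v = 1")
    case False
    then have "v \<in> {2..N}" using that by auto
    from weighted_tree_bounds[OF tree this] show ?thesis by simp
  qed (use root N in auto)
  have Suc: "z (par v) = Suc (z v)" if v: "v \<in> {2..N}" for v
  proof -
    have "{u \<in> {2..N}. par u = par v} = {v}" using v inj by (auto dest: inj_onD)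
    moreover have "z (par v) = 1 + (\<Sum>u\<in>{u \<in> {2..N}. par u = par v}. z u)"
      using tree weighted_tree_parent[OF tree v] unfolding weighted_tree_def by blast
    ultimately show ?thesis by simp
  qed
  have inj_z: "u = v" if "u \<in> {1..N}" "v \<in> {1..N}" "z u = z v" for u v
    using that
  proof (induction "N - z u" arbitrary: u v rule: less_induct)
    case less
    show ?case
    proof (cases "u = 1 \<or> v = 1")
      case True
      then have "z u = N" "z v = N" using root less.prems by auto
      moreover have "x = 1" if "z x = N" "x \<in> {1..N}" for x
        using weighted_tree_bounds(2)[OF tree, of x] that by force
      ultimately show ?thesis using less.prems by metis
    next
      case False
      then have uv: "u \<in> {2..N}" "v \<in> {2..N}" using less.prems by auto
      have "N - z (par u) < N - z u" "z (par u) = z (par v)"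
        using less.prems(3) weighted_tree_bounds(2)[OF tree uv(1)] Suc[OF uv(1)] Suc[OF uv(2)] by simp_all
      then have "par u = par v"
        using less.hyps[OF _ weighted_tree_parent[OF tree uv(1)] weighted_tree_parent[OF tree uv(2)]]
        by blast
      then show ?thesis by (rule inj_onD[OF inj _ uv])
    qed
  qed
  have "inj_on z {1..N}" by (rule inj_onI) (rule inj_z)
  moreover have "z ` {1..N} \<subseteq> {1..N}" using bounds by blast
  ultimately have img: "z ` {1..N} = {1..N}" using endo_inj_surj[OF finite_atLeastAtMost] by blast
  define w where "w i = (if i \<in> {1..N} then inv_into {1..N} z (N + 1 - i) else i)" for i
  have zw: "z (w i) = N + 1 - i" "w i \<in> {1..N}" if "i \<in> {1..N}" for i
  proof -
    have *: "N + 1 - i \<in> z ` {1..N}" unfolding img using that by auto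
    have "w i = inv_into {1..N} z (N + 1 - i)" using that by (simp add: w_def)
    then show "z (w i) = N + 1 - i" "w i \<in> {1..N}"
      using f_inv_into_f[OF *] inv_into_into[OF *] by simp_all
  qed
  have wz: "w (N + 1 - z v) = v" if "v \<in> {1..N}" for v
  proof (rule inj_z)
    have "N + 1 - z v \<in> {1..N}" using bounds[OF that] by auto
    then show "w (N + 1 - z v) \<in> {1..N}" "z (w (N + 1 - z v)) = z v"
      using zw[of "N + 1 - z v"] bounds[OF that] by auto
  qed (rule that)
  have perm: "w permutes {1..N}"
  proof (rule bij_imp_permutes)
    show "bij_betw w {1..N} {1..N}"
    proof (rule bij_betw_byWitness[where f' = "\<lambda>v. N + 1 - z v"])
      show "\<forall>i\<in>{1..N}. N + 1 - z (w i) = i" using zw by auto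
      show "\<forall>v\<in>{1..N}. w (N + 1 - z v) = v" using wz by blast
      show "w ` {1..N} \<subseteq> {1..N}" using zw by blast
      show "(\<lambda>v. N + 1 - z v) ` {1..N} \<subseteq> {1..N}" using bounds by fastforce
    qed
  qed (auto simp: w_def)
  have inv: "inv' w v = N + 1 - z v" if "v \<in> {1..N}" for v
    using wz[OF that] perm by (simp add: permutes_inv_eq)
  have inv1: "inv' w 1 = 1" using inv[of 1] root N by simp
  show ?thesis
  proof
    show "w \<in> root_words N" using perm wz[of 1] root N by (simp add: root_words_def)
    fix v assume v: "v \<in> {2..N}"
    then have v1: "v \<in> {1..N}" "v \<noteq> 1" by auto
    show "path_weight N w v = z v"
      unfolding path_weight_def inv1 inv[OF v1(1)] using v1 bounds[OF v1(1)] by auto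
    have "path_parent w v = w (N + 1 - z v - 1)"
      unfolding path_parent_def inv1 inv[OF v1(1)] using bounds[OF v1(1)] by auto
    also have "\<dots> = w (N + 1 - z (par v))" using Suc[OF v] by simp
    also have "\<dots> = par v" by (rule wz[OF weighted_tree_parent[OF tree v]])
    finally show "path_parent w v = par v" .
  qed
qed

lemma tree_poly_cong:
  assumes "\<And>v. v \<in> {2..N} \<Longrightarrow> p v = q v"
  shows "tree_poly N p = tree_poly N q"
proof -
  have "tree_edges N p = tree_edges N q" unfolding tree_edges_def using assms by (intro image_cong) auto
  moreover have "(\<Prod>v\<in>{2..N}. unit_sign (p v < v)) = (\<Prod>v\<in>{2..N}. unit_sign (q v < v) :: cpoly)"
    using assms by (intro prod.cong) auto
  ultimately show ?thesis by (simp add: tree_poly_def)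
qed

lemma path_poly_root_word: "w \<in> root_words N \<Longrightarrow> path_poly N w = tree_poly N (path_parent w)"
  using permutes_inv_eq[of w "{1..N}" 1 1] by (simp add: path_poly_def root_words_def)

lemma tree_poly_in_span_paths:
  assumes "weighted_tree N par z" "N \<ge> 1"
  shows "tree_poly N par \<in> cpoly.span (path_poly N ` root_words N)"
  using assms(1)
proof (induction rule: weighted_tree_induct)
  case (path par z)
  then obtain w where "w \<in> root_words N" "\<And>v. v \<in> {2..N} \<Longrightarrow> path_parent w v = par v"
    using path_tree_word[OF path assms(2)] by metis
  then have "tree_poly N par = path_poly N w" "w \<in> root_words N"
    using tree_poly_cong[of N "path_parent w" par] by (simp_all add: path_poly_root_word)
  then show ?case by (simp add: cpoly.span_base)
next
  case (rehang par z b c)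
  then show ?case
    unfolding tree_poly_rehang[OF rehang(1-5)] by (intro cpoly.span_add)
qed

lemma V_deg_top_eq_span_paths:
  "V_deg n (n choose 2) = cpoly.span (path_poly (n + 1) ` root_words (n + 1))"
proof
  show "V_deg n (n choose 2) \<subseteq> cpoly.span (path_poly (n + 1) ` root_words (n + 1))"
    unfolding V_deg_top_eq_span
    using tree_poly_in_span_paths[of "n + 1"] by (intro cpoly.span_minimal cpoly.subspace_span) auto
  show "cpoly.span (path_poly (n + 1) ` root_words (n + 1)) \<subseteq> V_deg n (n choose 2)"
    using path_poly_in_V_deg root_words_permutes by (intro cpoly.span_minimal subspace_V_deg) blast
qed

section \<open>Linear independence of the path polynomials\<close>

lemma (in vector_space) independent_family:
  assumes "finite I"
    and "\<And>a i. (\<Sum>i\<in>I. scale (a i) (f i)) = 0 \<Longrightarrow> i \<in> I \<Longrightarrow> a i = 0"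
  shows "inj_on f I" "independent (f ` I)"
proof -
  show inj: "inj_on f I"
  proof (rule inj_onI, rule ccontr)
    fix i j assume ij: "i \<in> I" "j \<in> I" "f i = f j" "i \<noteq> j"
    let ?a = "\<lambda>k. if k = i then 1 else if k = j then - 1 else 0"
    have "(\<Sum>k\<in>I. scale (?a k) (f k)) = (\<Sum>k\<in>{i, j}. scale (?a k) (f k))"
      using ij assms(1) by (intro sum.mono_neutral_right) auto
    also have "\<dots> = 0" using ij by simp
    finally show False using assms(2)[of ?a i] ij(1) by simp
  qed
  show "independent (f ` I)"
  proof (rule independent_if_scalars_zero)
    fix g x assume g: "(\<Sum>x\<in>f ` I. scale (g x) x) = 0" "x \<in> f ` I"
    then obtain i where i: "i \<in> I" "x = f i" by blast
    have "(\<Sum>i\<in>I. scale (g (f i)) (f i)) = 0" using g(1) by (simp add: sum.reindex[OF inj])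
    from assms(2)[OF this i(1)] show "g x = 0" using i by simp
  qed (use assms(1) in simp)
qed

lemma increasing_permutes_id:
  fixes v :: "nat \<Rightarrow> nat"
  assumes "v permutes {1..N}" "\<And>i. i \<in> {1..<N} \<Longrightarrow> v i < v (i + 1)"
  shows "v = id"
proof (rule permutes_natset_ge[OF assms(1)], rule ballI)
  fix i assume "i \<in> {1..N}"
  then have "1 \<le> i" "i \<le> N" by auto
  then show "i \<le> v i"
  proof (induction i rule: dec_induct)
    case base
    then show ?case using permutes_in_image[OF assms(1), of 1] by simp
  next
    case (step i)
    then show ?case using assms(2)[of i] by simp
  qed
qed

lemma tendsto_power_ratio:
  assumes "i \<noteq> j"
  shows "((\<lambda>t::real. of_real t ^ j / (of_real t ^ i - of_real t ^ j)) \<longlongrightarrow> (if i < j then - 1 else 0 :: complex)) at_top"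
proof -
  have inv: "((\<lambda>t::real. inverse t ^ k) \<longlongrightarrow> 0) at_top" if "k > 0" for k
  proof -
    have "((\<lambda>t::real. inverse t ^ k) \<longlongrightarrow> 0 ^ k) at_top"
      by (intro tendsto_power tendsto_inverse_0_at_top filterlim_ident)
    then show ?thesis by (simp only: zero_power[OF that])
  qed
  have "((\<lambda>t::real. t ^ j / (t ^ i - t ^ j)) \<longlongrightarrow> (if i < j then - 1 else 0)) at_top"
  proof (cases "i < j")
    case True
    define k where "k = j - i"
    have k: "k > 0" "j = i + k" using True by (auto simp: k_def)
    have "((\<lambda>t::real. 1 / (inverse t ^ k - 1)) \<longlongrightarrow> 1 / (0 - 1)) at_top"
      by (intro tendsto_intros inv k) simp
    moreover have "\<forall>\<^sub>F t::real in at_top. 1 / (inverse t ^ k - 1) = t ^ j / (t ^ i - t ^ j)"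
      using eventually_gt_at_top[of 0]
    proof eventually_elim
      case (elim t)
      have "t ^ i - t ^ j = t ^ j * (inverse t ^ k - 1)"
        using elim by (simp add: k(2) power_add power_inverse field_simps)
      moreover have "t ^ j / (t ^ j * (inverse t ^ k - 1)) = 1 / (inverse t ^ k - 1)"
        using elim by simp
      ultimately show ?case by (simp only:)
    qed
    ultimately have "((\<lambda>t::real. t ^ j / (t ^ i - t ^ j)) \<longlongrightarrow> 1 / (0 - 1)) at_top"
      by (rule Lim_transform_eventually)
    then show ?thesis using True by simp
  next
    case False
    define k where "k = i - j"
    have k: "k > 0" "i = j + k" using False assms by (auto simp: k_def)
    have "((\<lambda>t::real. inverse t ^ k / (1 - inverse t ^ k)) \<longlongrightarrow> 0 / (1 - 0)) at_top"
      by (intro tendsto_intros inv k) simp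
    moreover have "\<forall>\<^sub>F t::real in at_top. inverse t ^ k / (1 - inverse t ^ k) = t ^ j / (t ^ i - t ^ j)"
      using eventually_gt_at_top[of 0]
    proof eventually_elim
      case (elim t)
      have "t ^ i - t ^ j = t ^ i * (1 - inverse t ^ k)" "t ^ j = t ^ i * inverse t ^ k"
        using elim by (simp_all add: k(2) power_add power_inverse field_simps)
      moreover have "t ^ i * inverse t ^ k / (t ^ i * (1 - inverse t ^ k)) = inverse t ^ k / (1 - inverse t ^ k)"
        using elim by simp
      ultimately show ?case by (simp only:)
    qed
    ultimately have "((\<lambda>t::real. t ^ j / (t ^ i - t ^ j)) \<longlongrightarrow> 0 / (1 - 0)) at_top"
      by (rule Lim_transform_eventually)
    then show ?thesis using False by simp
  qed
  from tendsto_of_real[OF this, where ?'a = complex] show ?thesis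
    by (cases "i < j") simp_all
qed

text \<open>Along \<open>x\<^sub>v = t\<^bsup>k\<^esup>\<close>, \<open>k\<close> the position of \<open>v\<close> in \<open>u\<close>, the rational function \<open>x\<^sub>2 \<cdots> x\<^sub>N\<close> divided
  by the denominator of \<open>w\<close> tends for \<open>t \<rightarrow> \<infinity>\<close> to \<open>\<plusminus>1\<close> if \<open>w = u\<close> and to \<open>0\<close> otherwise.\<close>

lemma path_poly_coefficients_zero:
  assumes N: "N \<ge> 1" and zero: "(\<Sum>w\<in>root_words N. poly_scale (a w) (path_poly N w)) = 0"
    and u: "u \<in> root_words N"
  shows "a u = 0"
proof -
  have up: "u permutes {1..N}" using u by (rule root_words_permutes)
  define x :: "real \<Rightarrow> nat \<Rightarrow> complex" where "x t v = of_real t ^ inv' u v" for t v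
  define R where "R w t = (\<Prod>i\<in>{1..<N}. x t (w (i + 1)) / (x t (w i) - x t (w (i + 1))))" for w t
  have x_eq: "x t i = x t j \<longleftrightarrow> i = j" if "t > 1" for t i j
  proof -
    have "x t i = of_real (t ^ inv' u i)" "x t j = of_real (t ^ inv' u j)" by (simp_all add: x_def)
    then have "x t i = x t j \<longleftrightarrow> t ^ inv' u i = t ^ inv' u j" by (simp only: of_real_eq_iff)
    also have "\<dots> \<longleftrightarrow> inv' u i = inv' u j" using that by simp
    also have "\<dots> \<longleftrightarrow> i = j" using inj_eq[OF permutes_inj[OF permutes_inv[OF up]]] .
    finally show ?thesis .
  qed
  have sum_zero: "(\<Sum>w\<in>root_words N. a w * R w t) = 0" if t: "t > 1" for t
  proof -
    let ?ev = "poly_subst (\<lambda>a. a) (x t)"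
    \<comment> \<open>For a word starting with \<open>1\<close>, every other vertex is the later end
      of exactly one step. So the same factor \<open>X\<close>, distributed over the steps, bounds
      the quotients of all these paths as \<open>t\<close> grows.\<close>
    define X where "X = (\<Prod>v\<in>{2..N}. x t v)"
    have V: "?ev (vandermonde N) \<noteq> 0"
      unfolding graph_poly_def eval_hom.subst_prod
      by (auto elim!: complete_edgesE simp: edge_poly_pair unit_sign_def eval_hom.subst_diff x_eq[OF t])
    have "R w t * ?ev (vandermonde N) = X * ?ev (path_poly N w)" if w: "w \<in> root_words N" for w
    proof -
      have wp: "w permutes {1..N}" using w by (rule root_words_permutes)
      have diff: "{1..N} - {1} = {2..N}" by auto
      have "w ` ({1..N} - {1}) = {1..N} - {1}"
        using permutes_image[OF wp] w by (simp add: image_set_diff[OF permutes_inj[OF wp]] root_words_def)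
      then have "w ` {2..N} = {2..N}" by (simp only: diff)
      then have "X = (\<Prod>v\<in>w ` {2..N}. x t v)" by (simp add: X_def)
      also have "\<dots> = (\<Prod>i\<in>{2..N}. x t (w i))"
        by (simp add: prod.reindex[OF inj_on_subset[OF permutes_inj[OF wp] subset_UNIV]])
      also have "{2..N} = {Suc 1..<Suc N}" by auto
      also have "(\<Prod>i\<in>{Suc 1..<Suc N}. x t (w i)) = (\<Prod>i\<in>{1..<N}. x t (w (i + 1)))"
        by (subst prod.shift_bounds_Suc_ivl) simp
      finally have X: "X = (\<Prod>i\<in>{1..<N}. x t (w (i + 1)))" .
      have "?ev (path_denom N w) = (\<Prod>i\<in>{1..<N}. x t (w i) - x t (w (i + 1)))"
        by (simp add: path_denom_def eval_hom.subst_prod eval_hom.subst_diff)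
      moreover have "(\<Prod>i\<in>{1..<N}. x t (w i) - x t (w (i + 1))) \<noteq> 0"
        using inj_eq[OF permutes_inj[OF wp]] by (simp add: x_eq[OF t])
      moreover have "?ev (path_poly N w) * ?ev (path_denom N w) = ?ev (vandermonde N)"
        unfolding eval_hom.subst_mult[symmetric] path_poly_mult_denom[OF wp N] by (rule refl)
      ultimately show ?thesis unfolding R_def X prod_dividef by (simp add: field_simps)
    qed
    then have "(\<Sum>w\<in>root_words N. a w * R w t) * ?ev (vandermonde N)
        = X * ?ev (\<Sum>w\<in>root_words N. poly_scale (a w) (path_poly N w))"
      unfolding eval_hom.subst_sum eval_hom.subst_scale sum_distrib_left sum_distrib_right
      by (intro sum.cong) (simp_all add: ac_simps)
    then show ?thesis using V zero by simp
  qed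
  define L :: "(nat \<Rightarrow> nat) \<Rightarrow> complex" where
    "L w = (\<Prod>i\<in>{1..<N}. if inv' u (w i) < inv' u (w (i + 1)) then - 1 else 0)" for w
  have "(R w \<longlongrightarrow> L w) at_top" if "w \<in> root_words N" for w
    unfolding R_def L_def x_def
  proof (intro tendsto_prod tendsto_power_ratio)
    fix i
    show "inv' u (w i) \<noteq> inv' u (w (i + 1))"
      using inj_eq[OF permutes_inj[OF permutes_inv[OF up]]] inj_eq[OF permutes_inj[OF root_words_permutes[OF that]]]
      by simp
  qed
  then have "((\<lambda>t. \<Sum>w\<in>root_words N. a w * R w t) \<longlongrightarrow> (\<Sum>w\<in>root_words N. a w * L w)) at_top"
    by (intro tendsto_sum tendsto_mult tendsto_const)
  moreover have "((\<lambda>t. \<Sum>w\<in>root_words N. a w * R w t) \<longlongrightarrow> 0) at_top"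
    by (intro tendsto_eventually eventually_mono[OF eventually_gt_at_top[of "1::real"]] sum_zero)
  ultimately have "(\<Sum>w\<in>root_words N. a w * L w) = 0"
    using tendsto_unique trivial_limit_at_top_linorder by blast
  \<comment> \<open>A nonzero limit needs every step of \<open>w\<close> to move forward in
    \<open>u\<close>, that is, \<open>inv' u \<circ> w\<close> to be increasing and hence the
    identity.\<close>
  moreover have "L w = 0" if w: "w \<in> root_words N" "w \<noteq> u" for w
  proof (rule ccontr)
    assume "L w \<noteq> 0"
    then have "(inv' u \<circ> w) i < (inv' u \<circ> w) (i + 1)" if "i \<in> {1..<N}" for i
      using that by (auto simp: L_def split: if_splits)
    then have "inv' u \<circ> w = id"
      by (rule increasing_permutes_id[OF permutes_compose[OF root_words_permutes[OF w(1)] permutes_inv[OF up]]])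
    then have "u \<circ> (inv' u \<circ> w) = u" by simp
    then show False using w(2) permutes_inv_o(1)[OF up] by (simp add: o_assoc)
  qed
  then have "(\<Sum>w\<in>root_words N. a w * L w) = a u * L u"
    using u by (subst sum.remove[OF _ u]) auto
  moreover have "L u \<noteq> 0" using permutes_inverses(2)[OF up] by (simp add: L_def)
  ultimately show ?thesis by simp
qed

section \<open>The major index functional\<close>

definition unity_root :: "nat \<Rightarrow> complex" where
  "unity_root N = exp (2 * of_real pi * \<i> / of_nat N)"

lemma unity_root_power: "unity_root N ^ k = cis (2 * pi * real k / real N)"
  by (simp add: unity_root_def cis_conv_exp flip: exp_of_nat_mult) (simp add: field_simps)

lemma unity_root_nonzero [simp]: "unity_root N \<noteq> 0"
  by (simp add: unity_root_def)

lemma unity_root_power_N: "N \<ge> 1 \<Longrightarrow> unity_root N ^ N = 1"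
  by (simp add: unity_root_power)

lemma unity_root_power_neq_1:
  assumes "0 < k" "k < N"
  shows "unity_root N ^ k \<noteq> 1"
proof
  assume "unity_root N ^ k = 1"
  then have "cos (2 * pi * real k / real N) = 1"
    unfolding unity_root_power by (metis cis.sel(1) one_complex.sel(1))
  then obtain m :: int where "2 * pi * real k / real N = of_int m * 2 * pi"
    using cos_one_2pi_int by blast
  then have "real k = of_int m * real N" using assms by (simp add: field_simps)
  then have "int k = m * int N" by (metis of_int_eq_iff of_int_mult of_int_of_nat_eq)
  then have "int N dvd int k" by simp
  then show False using assms by (auto dest!: zdvd_imp_le)
qed

text \<open>The factor of one edge in the hook length formula for the major index: \<open>s\<close>
  is the size of the subtree below the child \<open>b\<close>, and the numerator records a descent
  from the parent \<open>a\<close>.\<close>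

definition edge_weight :: "nat \<Rightarrow> nat \<Rightarrow> nat \<Rightarrow> nat \<Rightarrow> complex" where
  "edge_weight N a b s = (if b < a then unity_root N ^ s else 1) / (1 - unity_root N ^ s)"

text \<open>The counterpart of the partial fraction identity. For each of the six orders of
  \<open>v\<close>, \<open>b\<close>, \<open>c\<close> it is an identity of rational functions in X
  and Y; \<open>r + s < N\<close> keeps the denominator 1 - XY nonzero.\<close>

lemma edge_weight_rehang:
  assumes "v \<noteq> b" "v \<noteq> c" "b \<noteq> c" "0 < r" "0 < s" "r + s < N"
  shows "edge_weight N v b r * edge_weight N v c s =
    edge_weight N v b (r + s) * edge_weight N b c s + edge_weight N v c (r + s) * edge_weight N c b r"
proof -
  define X Y where "X = unity_root N ^ r" and "Y = unity_root N ^ s"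
  have "X \<noteq> 1" "Y \<noteq> 1" "X * Y \<noteq> 1"
    using unity_root_power_neq_1[of _ N] assms unfolding X_def Y_def power_add[symmetric] by auto
  then have nz: "1 - X \<noteq> 0" "1 - Y \<noteq> 0" "1 - X * Y \<noteq> 0" by auto
  have [simp]: "unity_root N ^ (r + s) = X * Y" by (simp add: X_def Y_def power_add)
  consider "v < b" "b < c" | "v < c" "c < b" | "b < v" "v < c" | "c < v" "v < b" | "b < c" "c < v" | "c < b" "b < v"
    using assms(1-3) by linarith
  then show ?thesis
    by cases (use nz in \<open>simp_all add: edge_weight_def divide_simps flip: X_def Y_def\<close>;
      simp add: algebra_simps)+
qed

definition tree_weight :: "nat \<Rightarrow> (nat \<Rightarrow> nat) \<Rightarrow> (nat \<Rightarrow> nat) \<Rightarrow> complex" where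
  "tree_weight N par z = (\<Prod>v\<in>{2..N}. edge_weight N (par v) v (z v))"

lemma tree_weight_rehang:
  assumes tree: "weighted_tree N par z"
    and b: "b \<in> {2..N}" and c: "c \<in> {2..N}" and bc: "b \<noteq> c" "par b = par c"
  shows "tree_weight N par z = tree_weight N (par(c := b)) (z(b := z b + z c))
    + tree_weight N (par(b := c)) (z(c := z c + z b))"
proof -
  define Q where "Q = (\<Prod>u\<in>{2..N} - {b, c}. edge_weight N (par u) u (z u))"
  have split: "tree_weight N p y = edge_weight N (p b) b (y b) * (edge_weight N (p c) c (y c) * Q)"
    if "\<And>u. u \<notin> {b, c} \<Longrightarrow> p u = par u \<and> y u = z u" for p y
  proof -
    have "tree_weight N p y = edge_weight N (p b) b (y b) * (\<Prod>u\<in>{2..N} - {b}. edge_weight N (p u) u (y u))"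
      unfolding tree_weight_def using b by (intro prod.remove) auto
    also have "(\<Prod>u\<in>{2..N} - {b}. edge_weight N (p u) u (y u))
        = edge_weight N (p c) c (y c) * (\<Prod>u\<in>{2..N} - {b} - {c}. edge_weight N (p u) u (y u))"
      using c bc by (intro prod.remove) auto
    also have "{2..N} - {b} - {c} = {2..N} - {b, c}" by blast
    also have "(\<Prod>u\<in>{2..N} - {b, c}. edge_weight N (p u) u (y u)) = Q"
      unfolding Q_def using that by (intro prod.cong) auto
    finally show ?thesis .
  qed
  have ne: "par b \<noteq> b" "par b \<noteq> c" using weighted_tree_parent_neq[OF tree] b c bc by metis+
  have "0 < z b" "0 < z c" using weighted_tree_bounds(1)[OF tree] b c by auto
  \<comment> \<open>This sum is the weight of \<open>b\<close> after rehanging, so it is bounded by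
    the same lemma.\<close>
  moreover have "z b + z c < N"
    using weighted_tree_bounds(2)[OF weighted_tree_rehang[OF assms] b] by simp
  ultimately have "edge_weight N (par b) b (z b) * edge_weight N (par b) c (z c) =
      edge_weight N (par b) b (z b + z c) * edge_weight N b c (z c)
      + edge_weight N (par b) c (z b + z c) * edge_weight N c b (z b)"
    using ne bc by (intro edge_weight_rehang)
  then have "edge_weight N (par b) b (z b) * (edge_weight N (par c) c (z c) * Q) =
      edge_weight N (par b) b (z b + z c) * (edge_weight N b c (z c) * Q)
      + edge_weight N c b (z b) * (edge_weight N (par c) c (z c + z b) * Q)"
    using bc(2) by (simp add: distrib_right add.commute flip: mult.assoc)
  then show ?thesis
    using split[of par z] split[of "par(c := b)" "z(b := z b + z c)"]
      split[of "par(b := c)" "z(c := z c + z b)"] bc by simp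
qed

text \<open>The functional is extended from the basis of paths starting at \<open>1\<close>. Tree
  polynomials and tree weights obey the same rehanging relation, so the formula spreads from paths
  to all trees, in particular to paths with \<open>1\<close> in their interior.\<close>

lemma exists_tree_functional:
  assumes N: "N \<ge> 1"
  obtains \<Lambda> where "Vector_Spaces.linear poly_scale (*) \<Lambda>"
    "\<And>par z. weighted_tree N par z \<Longrightarrow> \<Lambda> (tree_poly N par) = tree_weight N par z"
proof -
  interpret C: vector_space "(*) :: complex \<Rightarrow> complex \<Rightarrow> complex"
    by unfold_locales (simp_all add: algebra_simps)
  interpret P: vector_space_pair poly_scale "(*) :: complex \<Rightarrow> complex \<Rightarrow> complex" ..
  let ?W = "root_words N"
  have fam: "inj_on (path_poly N) ?W" "cpoly.independent (path_poly N ` ?W)"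
    by (rule cpoly.independent_family[OF finite_root_words], erule (1) path_poly_coefficients_zero[OF N])+
  define t where "t p = (let w = inv_into ?W (path_poly N) p in tree_weight N (path_parent w) (path_weight N w))" for p
  obtain \<Lambda> where lin: "Vector_Spaces.linear poly_scale (*) \<Lambda>"
    and \<Lambda>: "\<forall>p\<in>path_poly N ` ?W. \<Lambda> p = t p"
    using P.linear_independent_extend[OF fam(2), where f = t] by blast
  interpret \<Lambda>: Vector_Spaces.linear poly_scale "(*)" \<Lambda> by (rule lin)
  have "\<Lambda> (tree_poly N par) = tree_weight N par z" if "weighted_tree N par z" for par z
    using that
  proof (induction rule: weighted_tree_induct)
    case (path par z)
    then obtain w where w: "w \<in> ?W" "\<And>v. v \<in> {2..N} \<Longrightarrow> path_parent w v = par v"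
      "\<And>v. v \<in> {2..N} \<Longrightarrow> path_weight N w v = z v"
      using path_tree_word[OF path N] by metis
    have "tree_poly N par = path_poly N w"
      using tree_poly_cong[of N "path_parent w" par] w by (simp add: path_poly_root_word)
    then have "\<Lambda> (tree_poly N par) = t (path_poly N w)" using w(1) \<Lambda> by simp
    also have "\<dots> = tree_weight N (path_parent w) (path_weight N w)"
      using inv_into_f_f[OF fam(1) w(1)] by (simp add: t_def)
    also have "\<dots> = tree_weight N par z"
      unfolding tree_weight_def using w by (intro prod.cong) auto
    finally show ?case .
  next
    case (rehang par z b c)
    show ?case
      unfolding tree_poly_rehang[OF rehang(1-5)] tree_weight_rehang[OF rehang(1-5)] \<Lambda>.add rehang(6,7)
      by (rule refl)
  qed
  then show ?thesis using lin that by blast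
qed

section \<open>Values of the functional on arbitrary paths\<close>

definition path_factor :: "nat \<Rightarrow> (nat \<Rightarrow> nat) \<Rightarrow> complex" where
  "path_factor N w = (\<Prod>i\<in>{1..<N}. edge_weight N (w i) (w (i + 1)) (N - i))"

text \<open>The powers of \<omega> with exponents \<open>i\<close> and \<open>N - i\<close> are
  inverse to each other, and inverting X exchanges 1/(1 - X) with -X/(1 - X), that is, ascents with
  descents. The minus sign cancels the one in \<open>path_poly\<close>.\<close>

lemma edge_weight_reverse:
  assumes "a \<noteq> b" "0 < i" "i < N"
  shows "- edge_weight N b a i = edge_weight N a b (N - i)"
proof -
  define X Y where "X = unity_root N ^ i" and "Y = unity_root N ^ (N - i)"
  have XY: "X * Y = 1"
    using assms unity_root_power_N[of N] by (simp add: X_def Y_def flip: power_add)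
  have nz: "X \<noteq> 1" "Y \<noteq> 1" "X \<noteq> 0"
    using unity_root_power_neq_1[of _ N] assms unfolding X_def Y_def by auto
  have "Y = 1 / X" using XY nz by (simp add: field_simps)
  then show ?thesis
    using assms(1) nz unfolding edge_weight_def X_def[symmetric] Y_def[symmetric]
    by (cases "a < b") (auto simp: field_simps)
qed

lemma path_functional:
  assumes lin: "Vector_Spaces.linear poly_scale (*) \<Lambda>"
    and \<Lambda>: "\<And>par z. weighted_tree N par z \<Longrightarrow> \<Lambda> (tree_poly N par) = tree_weight N par z"
    and w: "w permutes {1..N}" and N: "N \<ge> 1"
  shows "\<Lambda> (path_poly N w) = path_factor N w"
proof -
  interpret \<Lambda>: Vector_Spaces.linear poly_scale "(*)" \<Lambda> by (rule lin)
  let ?m = "inv' w 1"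
  have m: "?m \<in> {1..N}" using permutes_in_image[OF permutes_inv[OF w], of 1] N by simp
  have "\<Lambda> ((- 1) ^ k * p) = (- 1) ^ k * \<Lambda> p" for k p
    by (cases "even k") (simp_all add: \<Lambda>.neg)
  then have "\<Lambda> (path_poly N w) = (- 1) ^ (?m - 1) * tree_weight N (path_parent w) (path_weight N w)"
    by (simp only: path_poly_def \<Lambda>[OF weighted_tree_path[OF w N]])
  also have "\<dots> = (\<Prod>i\<in>{1..<?m}. - edge_weight N (w (i + 1)) (w i) i) *
      (\<Prod>i\<in>{?m..<N}. edge_weight N (w i) (w (i + 1)) (N - i))"
    unfolding tree_weight_def prod_path[OF w N] by (simp add: prod_uminus)
  also have "(\<Prod>i\<in>{1..<?m}. - edge_weight N (w (i + 1)) (w i) i)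
      = (\<Prod>i\<in>{1..<?m}. edge_weight N (w i) (w (i + 1)) (N - i))"
    using m inj_eq[OF permutes_inj[OF w]] by (intro prod.cong edge_weight_reverse) auto
  also have "\<dots> * (\<Prod>i\<in>{?m..<N}. edge_weight N (w i) (w (i + 1)) (N - i)) = path_factor N w"
  proof -
    have "{1..<N} = {1..<?m} \<union> {?m..<N}" using m by auto
    then show ?thesis unfolding path_factor_def by (subst prod.union_disjoint[symmetric]) auto
  qed
  finally show ?thesis .
qed

section \<open>Rotations and the major index\<close>

lemma long_cycle_permutes: "long_cycle N permutes {1..N}"
proof -
  have "set [1..<Suc N] = {1..N}" by auto
  then show ?thesis using cycle_permutes[of "[1..<Suc N]"] unfolding long_cycle_def by metis
qed

lemma long_cycle_apply:
  assumes "i \<in> {1..N}"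
  shows "long_cycle N i = Suc (i mod N)"
proof -
  let ?c = "[1..<Suc N]"
  have "map (long_cycle N ^^ 1) ?c = rotate 1 ?c"
    unfolding long_cycle_def by (rule cyclic_rotation) simp
  then have "map (long_cycle N) ?c ! (i - 1) = rotate 1 ?c ! (i - 1)" by (simp del: upt_Suc)
  moreover have "rotate 1 ?c ! (i - 1) = Suc (i mod N)"
    using assms by (subst nth_rotate) (auto simp del: upt_Suc)
  moreover have "map (long_cycle N) ?c ! (i - 1) = long_cycle N i"
    using assms by (subst nth_map) (auto simp del: upt_Suc)
  ultimately show ?thesis by (simp only:)
qed

lemma long_cycle_funpow_1:
  assumes "N \<ge> 1"
  shows "(long_cycle N ^^ k) 1 = Suc (k mod N)"
proof (induction k)
  case (Suc k)
  have "Suc (k mod N) \<in> {1..N}" using assms by (simp add: Suc_leI)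
  then show ?case using Suc by (simp add: long_cycle_apply mod_Suc_eq)
qed simp

lemma permutes_funpow: "p permutes S \<Longrightarrow> (p ^^ k) permutes S"
  by (induction k) (auto simp: permutes_id intro: permutes_compose)

text \<open>Since \<omega>^N = 1, a descent at position \<open>i\<close> contributes \<omega>^(-i).
  Reading the word around a circle gives \<omega>^(-maj) in a form that can be rotated without
  boundary cases.\<close>

definition cyclic_factor :: "nat \<Rightarrow> (nat \<Rightarrow> nat) \<Rightarrow> complex" where
  "cyclic_factor N w =
     (\<Prod>i\<in>{1..N}. if w (long_cycle N i) < w i then unity_root N ^ (N - i) else 1)"

definition cyclic_descents :: "nat \<Rightarrow> (nat \<Rightarrow> nat) \<Rightarrow> nat" where
  "cyclic_descents N w = card {i \<in> {1..N}. w (long_cycle N i) < w i}"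

text \<open>The product of 1 - \<eta> over all N-th roots of unity \<eta> other than 1, which is N
  for N >= 1.\<close>

definition path_norm :: "nat \<Rightarrow> complex" where
  "path_norm N = (\<Prod>i\<in>{1..<N}. 1 - unity_root N ^ (N - i))"

lemma path_norm_nonzero: "path_norm N \<noteq> 0"
  using unity_root_power_neq_1[of "N - i" N for i] by (auto simp: path_norm_def)

text \<open>A cyclic descent in the last position has weight \<open>\<omega>\<^sup>0 = 1\<close>, so it may be added for free.\<close>

lemma path_factor_eq:
  assumes "N \<ge> 1"
  shows "path_factor N w = cyclic_factor N w / path_norm N"
proof -
  have "{1..N} = insert N {1..<N}" using assms by auto
  then have "cyclic_factor N w = (\<Prod>i\<in>{1..<N}. if w (long_cycle N i) < w i then unity_root N ^ (N - i) else 1)"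
    by (simp add: cyclic_factor_def)
  also have "\<dots> = (\<Prod>i\<in>{1..<N}. if w (i + 1) < w i then unity_root N ^ (N - i) else 1)"
    by (intro prod.cong) (auto simp: long_cycle_apply)
  finally show ?thesis
    by (simp add: path_factor_def path_norm_def edge_weight_def prod_dividef)
qed

lemma unity_root_shift:
  assumes "i \<in> {1..N}"
  shows "unity_root N ^ (N - i) = unity_root N * unity_root N ^ (N - long_cycle N i)"
proof (cases "i = N")
  case True
  have N: "N \<ge> 1" using assms by simp
  have "unity_root N * unity_root N ^ (N - 1) = unity_root N ^ Suc (N - 1)" by simp
  also have "\<dots> = 1" using unity_root_power_N[OF N] N by simp
  finally show ?thesis using True N by (simp add: long_cycle_apply)
next
  case False
  then have "i < N" using assms by simp
  then show ?thesis using assms by (simp add: long_cycle_apply flip: power_Suc) (simp add: Suc_diff_Suc)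
qed

text \<open>Only comparisons with the largest letter change. At its position \<open>p\<close> it is
  followed by a descent; once it becomes the smallest letter, this descent moves to the preceding
  position \<open>q\<close>, whose weight is \<omega> times that of \<open>p\<close>.\<close>

lemma cyclic_factor_letters:
  assumes w: "w permutes {1..N}" and N: "N \<ge> 2"
  shows "cyclic_factor N (long_cycle N \<circ> w) = unity_root N * cyclic_factor N w"
proof -
  let ?c = "long_cycle N" and ?\<rho> = "\<lambda>i. unity_root N ^ (N - i)"
  define p where "p = inv' w N"
  define q where "q = inv' ?c p"
  have c: "?c permutes {1..N}" by (rule long_cycle_permutes)
  have wp: "w i = N \<longleftrightarrow> i = p" for i using w by (auto simp: p_def permutes_inverses)
  have cq: "?c i = p \<longleftrightarrow> i = q" for i using c by (auto simp: q_def permutes_inverses)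
  have p: "p \<in> {1..N}" unfolding p_def using permutes_in_image[OF permutes_inv[OF w]] N by simp
  then have q: "q \<in> {1..N}" unfolding q_def using permutes_in_image[OF permutes_inv[OF c]] by simp
  \<comment> \<open>The extra factors restore the lost descent at \<open>p\<close> on one side and
    add the gained one at \<open>q\<close> on the other, which gives an equality position by
    position.\<close>
  have "(if (?c \<circ> w) (?c i) < (?c \<circ> w) i then ?\<rho> i else 1) * (if i = p then ?\<rho> i else 1)
      = (if w (?c i) < w i then ?\<rho> i else 1) * (if i = q then ?\<rho> i else 1)"
    if i: "i \<in> {1..N}" for i
  proof -
    have wi: "w i \<in> {1..N}" "w (?c i) \<in> {1..N}"
      using i permutes_in_image[OF w] permutes_in_image[OF c] by auto
    have ne: "w i \<noteq> w (?c i)"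
    proof
      assume "w i = w (?c i)"
      then have "i = ?c i" using inj_eq[OF permutes_inj[OF w]] by simp
      then show False using i N by (cases "i = N") (auto simp: long_cycle_apply)
    qed
    have c_val: "?c j = (if j = N then 1 else Suc j)" if "j \<in> {1..N}" for j
      using that by (auto simp: long_cycle_apply)
    show ?thesis
      unfolding comp_def wp[symmetric, of i] cq[symmetric, of i] wp[symmetric, of "?c i"]
        c_val[OF wi(1)] c_val[OF wi(2)] using wi ne by auto
  qed
  then have "(\<Prod>i\<in>{1..N}. (if (?c \<circ> w) (?c i) < (?c \<circ> w) i then ?\<rho> i else 1) * (if i = p then ?\<rho> i else 1))
      = (\<Prod>i\<in>{1..N}. (if w (?c i) < w i then ?\<rho> i else 1) * (if i = q then ?\<rho> i else 1))"
    by (intro prod.cong) auto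
  then have "cyclic_factor N (?c \<circ> w) * ?\<rho> p = cyclic_factor N w * ?\<rho> q"
    using p q by (simp add: prod.distrib cyclic_factor_def prod.delta)
  also have "?\<rho> q = unity_root N * ?\<rho> p" using unity_root_shift[OF q] cq[of q] by simp
  finally have "cyclic_factor N (?c \<circ> w) * ?\<rho> p = (unity_root N * cyclic_factor N w) * ?\<rho> p"
    by (simp only: ac_simps)
  moreover have nz: "?\<rho> p \<noteq> 0" by simp
  ultimately show ?thesis by (simp only: mult_right_cancel[OF nz])
qed

text \<open>Rotation only shifts the set of cyclic descents by one position, and each shifted
  descent gains one factor \<omega> by \<open>unity_root_shift\<close>.\<close>

lemma cyclic_factor_positions:
  "cyclic_factor N (w \<circ> long_cycle N) = unity_root N ^ cyclic_descents N w * cyclic_factor N w"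
proof -
  let ?c = "long_cycle N" and ?\<omega> = "unity_root N"
  have c: "?c permutes {1..N}" by (rule long_cycle_permutes)
  define f where "f i = (if w (?c i) < w i then ?\<omega> else 1) * (if w (?c i) < w i then ?\<omega> ^ (N - i) else 1)" for i
  have "cyclic_factor N (w \<circ> ?c) = (\<Prod>i\<in>{1..N}. f (?c i))"
    unfolding cyclic_factor_def f_def by (intro prod.cong) (auto simp: unity_root_shift)
  also have "\<dots> = (\<Prod>i\<in>{1..N}. f i)" using prod.permute[OF c, of f] by (simp add: comp_def)
  also have "\<dots> = (\<Prod>i\<in>{1..N}. if w (?c i) < w i then ?\<omega> else 1) * cyclic_factor N w"
    by (simp add: f_def prod.distrib cyclic_factor_def)
  also have "(\<Prod>i\<in>{1..N}. if w (?c i) < w i then ?\<omega> else 1) = ?\<omega> ^ cyclic_descents N w"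
    by (simp add: prod.If_cases cyclic_descents_def Int_def)
  finally show ?thesis .
qed

lemma cyclic_descents_positions: "cyclic_descents N (w \<circ> long_cycle N) = cyclic_descents N w"
proof -
  let ?c = "long_cycle N"
  have c: "?c permutes {1..N}" by (rule long_cycle_permutes)
  have img: "?c ` {i \<in> {1..N}. w (?c (?c i)) < w (?c i)} = {i \<in> {1..N}. w (?c i) < w i}"
  proof (intro subset_antisym subsetI)
    fix j assume j: "j \<in> {i \<in> {1..N}. w (?c i) < w i}"
    show "j \<in> ?c ` {i \<in> {1..N}. w (?c (?c i)) < w (?c i)}"
    proof
      show "j = ?c (inv' ?c j)" using c by (simp add: permutes_inverses)
      show "inv' ?c j \<in> {i \<in> {1..N}. w (?c (?c i)) < w (?c i)}"
        using j permutes_in_image[OF permutes_inv[OF c], of j] by (simp add: permutes_inverses[OF c])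
    qed
  qed (use permutes_in_image[OF c] in auto)
  show ?thesis
    unfolding cyclic_descents_def comp_def img[symmetric]
    by (rule card_image[OF inj_on_subset[OF permutes_inj[OF c] subset_UNIV], symmetric])
qed

lemma cyclic_factor_positions_funpow:
  "cyclic_factor N (w \<circ> long_cycle N ^^ k) = (unity_root N ^ cyclic_descents N w) ^ k * cyclic_factor N w"
  "cyclic_descents N (w \<circ> long_cycle N ^^ k) = cyclic_descents N w"
proof (induction k)
  case (Suc k)
  have "w \<circ> long_cycle N ^^ Suc k = (w \<circ> long_cycle N ^^ k) \<circ> long_cycle N"
    by (simp only: funpow_Suc_right o_assoc)
  then show "cyclic_factor N (w \<circ> long_cycle N ^^ Suc k) = (unity_root N ^ cyclic_descents N w) ^ Suc k * cyclic_factor N w"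
    and "cyclic_descents N (w \<circ> long_cycle N ^^ Suc k) = cyclic_descents N w"
    using Suc by (simp_all only: cyclic_factor_positions cyclic_descents_positions power_Suc mult.assoc)
qed simp_all

lemma cyclic_descents_less:
  assumes w: "w permutes {1..N}" and N: "N \<ge> 1"
  shows "cyclic_descents N w < N"
proof -
  let ?A = "{i \<in> {1..N}. w (long_cycle N i) < w i}"
  have "inv' w 1 \<in> {1..N}" using permutes_in_image[OF permutes_inv[OF w], of 1] N by simp
  moreover have "inv' w 1 \<notin> ?A"
  proof
    assume "inv' w 1 \<in> ?A"
    then have "w (long_cycle N (inv' w 1)) < 1" using permutes_inverses(1)[OF w, of 1] by simp
    moreover have "w (long_cycle N (inv' w 1)) \<in> {1..N}"
      using \<open>inv' w 1 \<in> {1..N}\<close> permutes_in_image[OF w] permutes_in_image[OF long_cycle_permutes] by blast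
    ultimately show False by simp
  qed
  ultimately have "?A \<subset> {1..N}" by blast
  then have "card ?A < card {1..N}" by (intro psubset_card_mono) auto
  then show ?thesis by (simp add: cyclic_descents_def)
qed

text \<open>Cut the circular word just after its only descent: what remains increases from beginning
  to end.\<close>

lemma cyclic_descents_1_rotation:
  assumes w: "w permutes {1..N}" and N: "N \<ge> 1" and one: "cyclic_descents N w = 1"
  obtains k where "w \<circ> long_cycle N ^^ k = id"
proof -
  let ?c = "long_cycle N"
  obtain d where d: "{i \<in> {1..N}. w (?c i) < w i} = {d}"
    using one unfolding cyclic_descents_def by (rule card_1_singletonE)
  then have dN: "d \<in> {1..N}" by blast
  define v where "v = w \<circ> ?c ^^ d"
  have ck: "(?c ^^ d) permutes {1..N}" by (intro permutes_funpow long_cycle_permutes)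
  \<comment> \<open>After the rotation the descent sits at the last position, so it is met by no
    step from \<open>i\<close> to \<open>i + 1\<close> with \<open>i < N\<close>.\<close>
  have "(?c ^^ d) N = d"
  proof -
    have "(?c ^^ (d + (N - 1))) 1 = Suc ((d + (N - 1)) mod N)" by (rule long_cycle_funpow_1[OF N])
    also have "(d + (N - 1)) mod N = ((d - 1) + N) mod N" using dN N by (simp add: algebra_simps)
    also have "\<dots> = d - 1" using dN by (subst mod_add_self2, subst mod_less) auto
    also have "Suc \<dots> = d" using dN by simp
    finally have "(?c ^^ d) ((?c ^^ (N - 1)) 1) = d" by (simp add: funpow_add)
    then show ?thesis using long_cycle_funpow_1[OF N, of "N - 1"] N by simp
  qed
  have "v i < v (i + 1)" if i: "i \<in> {1..<N}" for i
  proof -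
    have ci: "?c i = i + 1" using i by (simp add: long_cycle_apply)
    have comm: "(?c ^^ d) (?c i) = ?c ((?c ^^ d) i)" by (simp add: funpow_swap1)
    have "(?c ^^ d) i \<noteq> d"
      using \<open>(?c ^^ d) N = d\<close> inj_eq[OF permutes_inj[OF ck], of i N] i by auto
    moreover have "(?c ^^ d) i \<in> {1..N}" using permutes_in_image[OF ck, of i] i by auto
    ultimately have "\<not> w (?c ((?c ^^ d) i)) < w ((?c ^^ d) i)" using d by blast
    then have "\<not> v (i + 1) < v i" unfolding v_def comp_apply ci[symmetric] comm .
    moreover have "v i \<noteq> v (i + 1)"
      using inj_eq[OF permutes_inj[OF permutes_compose[OF ck w]], of i "i + 1"] by (simp add: v_def)
    ultimately show ?thesis by simp
  qed
  then have "v = id" using increasing_permutes_id[OF permutes_compose[OF ck w]] by (simp add: v_def)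
  then show ?thesis using that by (simp add: v_def)
qed

section \<open>The isomorphism in top degree\<close>

lemma cyclic_subgroup_eq:
  assumes "N \<ge> 1"
  shows "cyclic_subgroup N = range (\<lambda>k. long_cycle N ^^ k)"
proof -
  let ?c = "long_cycle N" and ?G = "sym_group N"
  interpret group ?G by (rule sym_group_is_group)
  have c: "?c \<in> carrier ?G" unfolding sym_group_carrier by (rule long_cycle_permutes)
  have cN: "?c ^^ (N * k) = id" for k using long_cycle_funpow_eq_iff[OF assms, of "N * k" 0] by simp
  have "h \<in> range (\<lambda>k. ?c ^^ k)" if "h \<in> generate ?G {?c}" for h
    using that
  proof (induction rule: generate.induct)
    case one
    show ?case by (rule image_eqI[of _ _ 0]) (simp_all add: sym_group_one)
  next
    case (incl h)
    then show ?case by (intro image_eqI[of _ _ 1]) auto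
  next
    case (inv h)
    have "?c ^^ (N - 1) \<circ> ?c = ?c ^^ (N * 1)" using assms by (simp flip: funpow_Suc_right)
    then have "inv\<^bsub>?G\<^esub> ?c = ?c ^^ (N - 1)"
      unfolding cN using c permutes_funpow[OF long_cycle_permutes]
      by (intro inv_equality) (simp_all add: sym_group_mult sym_group_one sym_group_carrier)
    then show ?case using inv by auto
  next
    case (eng h1 h2)
    then obtain i j where "h1 = ?c ^^ i" "h2 = ?c ^^ j" by auto
    then have "h1 \<otimes>\<^bsub>?G\<^esub> h2 = ?c ^^ (i + j)" by (simp add: sym_group_mult funpow_add)
    then show ?case by blast
  qed
  moreover have "?c ^^ k \<in> generate ?G {?c}" for k
  proof (induction k)
    case 0
    then show ?case using generate.one[of ?G "{?c}"] by (simp add: sym_group_one id_def)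
  next
    case (Suc k)
    then show ?case
      using generate.eng[OF generate.incl[of ?c "{?c}" ?G] Suc]
      by (simp only: sym_group_mult funpow.simps singletonI)
  qed
  ultimately show ?thesis by (auto simp: cyclic_subgroup_def)
qed

text \<open>\<open>zeta\<close> is evaluated on natural powers of the long cycle, so the inverse is
  rewritten as the power with exponent \<open>(N - 1) * k\<close>.\<close>

lemma zeta_inv_long_cycle:
  assumes "N \<ge> 1"
  shows "zeta N (inv\<^bsub>sym_group N\<^esub> (long_cycle N ^^ k)) = inverse (unity_root N) ^ k"
proof -
  let ?c = "long_cycle N" and ?G = "sym_group N"
  interpret group ?G by (rule sym_group_is_group)
  have "?c ^^ ((N - 1) * k) \<circ> ?c ^^ k = ?c ^^ (N * k)"
    using assms by (simp flip: funpow_add) (simp add: algebra_simps)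
  also have "\<dots> = id" using long_cycle_funpow_eq_iff[OF assms, of "N * k" 0] by simp
  finally have "inv\<^bsub>?G\<^esub> (?c ^^ k) = ?c ^^ ((N - 1) * k)"
    using permutes_funpow[OF long_cycle_permutes]
    by (intro inv_equality) (simp_all add: sym_group_mult sym_group_one sym_group_carrier)
  then have "zeta N (inv\<^bsub>?G\<^esub> (?c ^^ k)) = (unity_root N ^ (N - 1)) ^ k"
    using zeta_long_cycle_funpow[OF assms] by (simp add: unity_root_def power_mult)
  moreover have "unity_root N ^ (N - 1) * unity_root N = 1"
    using unity_root_power_N[OF assms] assms by (simp flip: power_Suc2)
  then have "unity_root N ^ (N - 1) = inverse (unity_root N)"
    by (simp add: field_simps)
  ultimately show ?thesis by simp
qed

text \<open>Covariance under the generator implies it for all powers. The inverse of \<omega> comes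
  from the inverse in the model of the induced representation; twisting by the sign changes the
  action but not the space.\<close>

lemma tensor_Lie_space:
  "f \<in> rep_space (tensor_char (Lie_rep n) sign_char) \<longleftrightarrow>
    (\<forall>g. \<not> g permutes {1..n + 1} \<longrightarrow> f g = 0) \<and>
    (\<forall>g. g permutes {1..n + 1} \<longrightarrow>
      f (g \<circ> long_cycle (n + 1)) = inverse (unity_root (n + 1)) * f g)" (is "_ \<longleftrightarrow> ?A \<and> ?B")
proof -
  let ?N = "n + 1" and ?\<omega> = "unity_root (n + 1)"
  have N: "?N \<ge> 1" by simp
  have range: "(\<forall>h\<in>range (\<lambda>k. long_cycle ?N ^^ k). P h) \<longleftrightarrow> (\<forall>k. P (long_cycle ?N ^^ k))" for P
    by blast
  have "f \<in> rep_space (tensor_char (Lie_rep n) sign_char) \<longleftrightarrow> ?A \<and>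
    (\<forall>g. g permutes {1..?N} \<longrightarrow> (\<forall>k. f (g \<circ> long_cycle ?N ^^ k) = inverse ?\<omega> ^ k * f g))"
    unfolding tensor_char_def Lie_rep_def induced_rep_def char_rep_def rep.simps cyclic_subgroup_eq[OF N] range
    by (simp only: mem_Collect_eq sym_group_carrier sym_group_mult zeta_inv_long_cycle[OF N]
        UNIV_I simp_thms Ball_def)
  also have "(\<forall>g. g permutes {1..?N} \<longrightarrow> (\<forall>k. f (g \<circ> long_cycle ?N ^^ k) = inverse ?\<omega> ^ k * f g)) \<longleftrightarrow> ?B"
  proof (intro iffI allI impI)
    fix g assume "\<forall>g. g permutes {1..?N} \<longrightarrow> (\<forall>k. f (g \<circ> long_cycle ?N ^^ k) = inverse ?\<omega> ^ k * f g)"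
      "g permutes {1..?N}"
    then have "f (g \<circ> long_cycle ?N ^^ 1) = inverse ?\<omega> ^ 1 * f g" by blast
    then show "f (g \<circ> long_cycle ?N) = inverse ?\<omega> * f g" by simp
  next
    fix g k assume B: ?B and g: "g permutes {1..?N}"
    show "f (g \<circ> long_cycle ?N ^^ k) = inverse ?\<omega> ^ k * f g"
    proof (induction k)
      case (Suc k)
      have "(g \<circ> long_cycle ?N ^^ k) permutes {1..?N}"
        by (intro permutes_compose permutes_funpow long_cycle_permutes g)
      then have "f ((g \<circ> long_cycle ?N ^^ k) \<circ> long_cycle ?N) = inverse ?\<omega> * f (g \<circ> long_cycle ?N ^^ k)"
        using B by blast
      then show ?case using Suc by (simp only: funpow_Suc_right o_assoc power_Suc mult.assoc)
    qed simp
  qed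
  finally show ?thesis .
qed

text \<open>Rotating positions until the letter \<open>1\<close> comes first: every coset of the
  cyclic subgroup contains a root word, so an element of the induced space is determined by its
  values on root words.\<close>

lemma rotate_to_root_word:
  assumes g: "g permutes {1..N}" and N: "N \<ge> 1"
  obtains k where "g \<circ> long_cycle N ^^ k \<in> root_words N"
proof
  have "inv' g 1 \<in> {1..N}" using permutes_in_image[OF permutes_inv[OF g], of 1] N by simp
  then have "(long_cycle N ^^ (inv' g 1 - 1)) 1 = inv' g 1"
    by (subst long_cycle_funpow_1[OF N]) auto
  then have "(g \<circ> long_cycle N ^^ (inv' g 1 - 1)) 1 = 1"
    using permutes_inverses(1)[OF g] by (simp only: comp_apply)
  then show "g \<circ> long_cycle N ^^ (inv' g 1 - 1) \<in> root_words N"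
    unfolding root_words_def
    using permutes_compose[OF permutes_funpow[OF long_cycle_permutes] g] by simp
qed

lemma tensor_Lie_space_eqI:
  assumes f: "f \<in> rep_space (tensor_char (Lie_rep n) sign_char)"
    and h: "h \<in> rep_space (tensor_char (Lie_rep n) sign_char)"
    and eq: "\<And>w. w \<in> root_words (n + 1) \<Longrightarrow> f w = h w"
  shows "f = h"
proof
  fix g
  show "f g = h g"
  proof (cases "g permutes {1..n + 1}")
    case True
    have step: "f (g \<circ> long_cycle (n + 1) ^^ k) = inverse (unity_root (n + 1)) ^ k * f g"
      if "f \<in> rep_space (tensor_char (Lie_rep n) sign_char)" for f k
    proof (induction k)
      case (Suc k)
      have "(g \<circ> long_cycle (n + 1) ^^ k) permutes {1..n + 1}"
        by (intro permutes_compose permutes_funpow long_cycle_permutes True)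
      then have "f ((g \<circ> long_cycle (n + 1) ^^ k) \<circ> long_cycle (n + 1))
          = inverse (unity_root (n + 1)) * f (g \<circ> long_cycle (n + 1) ^^ k)"
        using that unfolding tensor_Lie_space by blast
      then show ?case using Suc by (simp only: funpow_Suc_right o_assoc power_Suc mult.assoc)
    qed simp
    obtain k where "g \<circ> long_cycle (n + 1) ^^ k \<in> root_words (n + 1)"
      using rotate_to_root_word[OF True] by auto
    then have "inverse (unity_root (n + 1)) ^ k * f g = inverse (unity_root (n + 1)) ^ k * h g"
      using eq step[OF f] step[OF h] by metis
    then show ?thesis by simp
  next
    case False
    have "f g = 0" "h g = 0" using f h False unfolding tensor_Lie_space by blast+
    then show ?thesis by simp
  qed
qed

lemma permutation_of_permutes: "\<sigma> permutes {1..N::nat} \<Longrightarrow> permutation \<sigma>"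
  by (auto simp: permutation_permutes)

lemma sign_char_comp:
  assumes "\<sigma> permutes {1..N::nat}" "\<tau> permutes {1..N}"
  shows "sign_char (\<sigma> \<circ> \<tau>) = sign_char \<sigma> * sign_char \<tau>"
  using assms[THEN permutation_of_permutes] by (simp add: sign_char_def sign_compose)

lemma sign_char_inv: "\<sigma> permutes {1..N::nat} \<Longrightarrow> sign_char (inv' \<sigma>) = sign_char \<sigma>"
  using permutation_of_permutes[of \<sigma> N] by (simp add: sign_char_def sign_inverse)

lemma sign_char_square [simp]: "sign_char \<sigma> * sign_char \<sigma> = 1" "sign_char \<sigma> * (sign_char \<sigma> * x) = x"
proof -
  show "sign_char \<sigma> * sign_char \<sigma> = 1"
    unfolding sign_char_def by (simp only: sign_idempotent of_int_1 flip: of_int_mult)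
  then show "sign_char \<sigma> * (sign_char \<sigma> * x) = x" by (simp flip: mult.assoc)
qed

lemma rep_isomorphic_top:
  assumes n: "n \<ge> 1"
  shows "rep_isomorphic (sym_group (n + 1)) (V_rep n (n choose 2)) (tensor_char (Lie_rep n) sign_char)"
proof -
  define N where "N = n + 1"
  have N: "N \<ge> 1" "N \<ge> 2" using n by (auto simp: N_def)
  let ?c = "long_cycle N" and ?\<omega> = "unity_root N" and ?W = "root_words N"
  let ?V = "V_deg n (n choose 2)" and ?S = "tensor_char (Lie_rep n) sign_char"
  have c: "?c permutes {1..N}" by (rule long_cycle_permutes)
  have V: "?V = cpoly.span (path_poly N ` ?W)" by (simp only: V_deg_top_eq_span_paths N_def)
  have perm_V: "permute_vars \<sigma> p \<in> ?V" if "\<sigma> permutes {1..N}" "p \<in> ?V" for \<sigma> p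
    using that permute_vars_V_deg by (simp only: N_def)
  have path_V: "path_poly N w \<in> ?V" if "w permutes {1..N}" for w
    using that path_poly_in_V_deg by (simp only: N_def)
  note S_space = tensor_Lie_space[of _ n, folded N_def]
  note perm_path = permute_vars_path_poly[OF _ _ N(1)]
  obtain \<Lambda> where lin: "Vector_Spaces.linear poly_scale (*) \<Lambda>"
    and tree: "\<And>par z. weighted_tree N par z \<Longrightarrow> \<Lambda> (tree_poly N par) = tree_weight N par z"
    using exists_tree_functional[OF N(1)] by blast
  interpret \<Lambda>: Vector_Spaces.linear poly_scale "(*)" \<Lambda> by (rule lin)
  have \<Lambda>_path: "\<Lambda> (path_poly N w) = cyclic_factor N w / path_norm N" if "w permutes {1..N}" for w
    using path_functional[OF lin tree that N(1)] path_factor_eq[OF N(1)] by simp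
  \<comment> \<open>The functional is an eigenvector of the long cycle on the top degree: adding 1
    cyclically to the letters gives \<omega>, and the Vandermonde product gives the sign.\<close>
  have \<Lambda>_rot: "\<Lambda> (permute_vars ?c p) = sign_char ?c * ?\<omega> * \<Lambda> p" if "p \<in> ?V" for p
    using that unfolding V
  proof (induction rule: cpoly.span_induct_alt)
    case base
    then show ?case by (simp add: permute_vars_hom)
  next
    case (step a x y)
    then obtain w where "w \<in> ?W" and w: "x = path_poly N w" by blast
    then have wp: "w permutes {1..N}" by (simp only: root_words_permutes)
    have x: "\<Lambda> (permute_vars ?c x) = sign_char ?c * ?\<omega> * \<Lambda> x"
      unfolding w perm_path[OF c wp] \<Lambda>.scale \<Lambda>_path[OF wp] \<Lambda>_path[OF permutes_compose[OF wp c]]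
        cyclic_factor_letters[OF wp N(2)] by simp
    have "\<Lambda> (permute_vars ?c (poly_scale a x + y)) = a * \<Lambda> (permute_vars ?c x) + \<Lambda> (permute_vars ?c y)"
      by (simp only: permute_vars_hom \<Lambda>.add \<Lambda>.scale)
    also have "\<dots> = sign_char ?c * ?\<omega> * (a * \<Lambda> x + \<Lambda> y)"
      unfolding x step(2) by (simp only: distrib_left mult_ac)
    also have "a * \<Lambda> x + \<Lambda> y = \<Lambda> (poly_scale a x + y)" by (simp only: \<Lambda>.add \<Lambda>.scale)
    finally show ?case .
  qed
  \<comment> \<open>Frobenius reciprocity sends \<open>p\<close> to the function with value
    \<Lambda>(g^-1 p) at g; the factor \<open>sign_char g\<close> accounts for the twist by the
    sign.\<close>
  define \<phi> where "\<phi> p g = (if g permutes {1..N} then sign_char g * \<Lambda> (permute_vars (inv' g) p) else 0)" for p g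
  have \<phi>_lin: "Vector_Spaces.linear poly_scale (\<lambda>(a::complex) (f::(nat \<Rightarrow> nat) \<Rightarrow> complex) g. a * f g) \<phi>"
  proof -
    interpret vector_space "\<lambda>(a::complex) (f::(nat \<Rightarrow> nat) \<Rightarrow> complex) g. a * f g"
      by (rule vector_space_fun_scale)
    have "\<phi> (p + q) g = \<phi> p g + \<phi> q g" "\<phi> (poly_scale a p) g = a * \<phi> p g" for p q a g
      unfolding \<phi>_def permute_vars_hom \<Lambda>.add \<Lambda>.scale
      by (cases "g permutes {1..N}"; simp only: if_True if_False distrib_left mult.left_commute; simp)+
    then show ?thesis by (unfold_locales; intro ext; simp only: plus_fun_apply)
  qed
  interpret \<phi>: Vector_Spaces.linear poly_scale "\<lambda>(a::complex) (f::(nat \<Rightarrow> nat) \<Rightarrow> complex) g. a * f g" \<phi>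
    by (rule \<phi>_lin)
  have \<phi>_sum: "\<phi> (\<Sum>i\<in>I. poly_scale (a i) (f i)) g = (\<Sum>i\<in>I. a i * \<phi> (f i) g)" for I :: "'i set" and a f g
    by (induction I rule: infinite_finite_induct) (simp_all add: \<phi>.add \<phi>.scale \<phi>.zero)
  have \<phi>_space: "\<phi> p \<in> rep_space ?S" if p: "p \<in> ?V" for p
    unfolding S_space
  proof (intro conjI allI impI)
    fix g assume g: "g permutes {1..N}"
    define q where "q = permute_vars (inv' (g \<circ> ?c)) p"
    have gc: "(g \<circ> ?c) permutes {1..N}" by (rule permutes_compose[OF c g])
    have "?c \<circ> inv' (g \<circ> ?c) = inv' g"
      using c g by (simp add: o_inv_distrib permutes_bij o_assoc permutes_inv_o)
    then have "permute_vars (inv' g) p = permute_vars ?c q" by (simp only: q_def flip: permute_vars_comp)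
    moreover have "q \<in> ?V" unfolding q_def using gc by (intro perm_V permutes_inv p)
    ultimately have "\<Lambda> (permute_vars (inv' g) p) = sign_char ?c * ?\<omega> * \<Lambda> q" using \<Lambda>_rot by simp
    then have "inverse ?\<omega> * \<phi> p g = (inverse ?\<omega> * ?\<omega>) * (sign_char g * sign_char ?c * \<Lambda> q)"
      using g by (simp only: \<phi>_def if_True mult_ac)
    moreover have "\<phi> p (g \<circ> ?c) = sign_char g * sign_char ?c * \<Lambda> q"
      using gc by (simp only: \<phi>_def if_True sign_char_comp[OF g c] q_def)
    ultimately show "\<phi> p (g \<circ> ?c) = inverse ?\<omega> * \<phi> p g" by (simp only: left_inverse[OF unity_root_nonzero] mult_1_left)
  qed (simp add: \<phi>_def)
  have \<phi>_equi: "\<phi> (permute_vars \<sigma> p) g = sign_char \<sigma> * \<phi> p (inv' \<sigma> \<circ> g)"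
    if \<sigma>: "\<sigma> permutes {1..N}" and g: "g permutes {1..N}" for \<sigma> p g
  proof -
    have \<sigma>g: "(inv' \<sigma> \<circ> g) permutes {1..N}" by (rule permutes_compose[OF g permutes_inv[OF \<sigma>]])
    have inv: "inv' (inv' \<sigma> \<circ> g) = inv' g \<circ> \<sigma>"
      unfolding o_inv_distrib[OF permutes_bij[OF permutes_inv[OF \<sigma>]] permutes_bij[OF g]] permutes_inv_inv[OF \<sigma>]
      by (rule refl)
    have "\<phi> (permute_vars \<sigma> p) g = sign_char g * \<Lambda> (permute_vars (inv' g \<circ> \<sigma>) p)"
      using g by (simp only: \<phi>_def if_True permute_vars_comp)
    moreover have "\<phi> p (inv' \<sigma> \<circ> g) = sign_char \<sigma> * sign_char g * \<Lambda> (permute_vars (inv' g \<circ> \<sigma>) p)"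
      using \<sigma>g by (simp only: \<phi>_def if_True inv sign_char_comp[OF permutes_inv[OF \<sigma>] g] sign_char_inv[OF \<sigma>])
    ultimately show ?thesis by (simp only: mult.assoc sign_char_square)
  qed
  text \<open>The element of the top degree whose image is supported on the cyclic subgroup.\<close>
  define f where "f = (\<Sum>k<N. poly_scale (inverse ?\<omega> ^ k) (path_poly N (?c ^^ k)))"
  have ck: "(?c ^^ k) permutes {1..N}" for k by (rule permutes_funpow[OF c])
  have f_V: "f \<in> ?V"
    unfolding f_def by (intro cpoly.subspace_sum cpoly.subspace_scale subspace_V_deg path_V ck)
  \<comment> \<open>Summing over the rotations gives a geometric series with ratio \<omega>^(d - 1),
    where d is the number of cyclic descents of the inverse of g. Since 0 <= d < N, it is N if d = 1
    and 0 otherwise.\<close>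
  have \<phi>_f: "\<phi> f g = cyclic_factor N (inv' g) / path_norm N * (\<Sum>k<N. (?\<omega> ^ cyclic_descents N (inv' g) * inverse ?\<omega>) ^ k)"
    if g: "g permutes {1..N}" for g
  proof -
    have ig: "inv' g permutes {1..N}" by (rule permutes_inv[OF g])
    have "\<phi> (path_poly N (?c ^^ k)) g = (?\<omega> ^ cyclic_descents N (inv' g)) ^ k * cyclic_factor N (inv' g) / path_norm N" for k
      using g by (simp only: \<phi>_def if_True perm_path[OF ig ck] \<Lambda>.scale sign_char_inv[OF g] sign_char_square
          \<Lambda>_path[OF permutes_compose[OF ck ig]] cyclic_factor_positions_funpow)
    then show ?thesis
      unfolding f_def \<phi>_sum sum_distrib_left by (intro sum.cong) (simp_all add: power_mult_distrib)
  qed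
  have \<phi>_f_id: "\<phi> f id \<noteq> 0"
  proof -
    \<comment> \<open>The identity has a single cyclic descent, at position \<open>N\<close>, and
      the weight of that position is 1.\<close>
    have desc: "{i \<in> {1..N}. id (?c i) < id i} = {N}"
      using N by (auto simp: long_cycle_apply le_less)
    have "cyclic_factor N id = (\<Prod>i\<in>{1..N}. 1)"
      unfolding cyclic_factor_def
    proof (rule prod.cong)
      fix i assume "i \<in> {1..N}"
      then have "i = N" if "id (?c i) < id i" using desc that by blast
      then show "(if id (?c i) < id i then ?\<omega> ^ (N - i) else 1) = 1" by (cases "id (?c i) < id i") simp_all
    qed simp
    then have cf: "cyclic_factor N id = 1" by simp
    have cd: "cyclic_descents N id = 1" unfolding cyclic_descents_def desc by simp
    have "\<phi> f id = 1 / path_norm N * (\<Sum>k<N. (?\<omega> ^ 1 * inverse ?\<omega>) ^ k)"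
      using \<phi>_f[OF permutes_id] unfolding inv_id cf cd .
    then show ?thesis using N by (simp add: path_norm_nonzero)
  qed
  have \<phi>_f_0: "\<phi> f g = 0" if g: "g permutes {1..N}" and notC: "g \<notin> range (\<lambda>k. ?c ^^ k)" for g
  proof -
    let ?r = "?\<omega> ^ cyclic_descents N (inv' g) * inverse ?\<omega>"
    have ig: "inv' g permutes {1..N}" by (rule permutes_inv[OF g])
    have "cyclic_descents N (inv' g) \<noteq> 1"
    proof
      assume "cyclic_descents N (inv' g) = 1"
      then obtain k where "inv' g \<circ> ?c ^^ k = id" by (rule cyclic_descents_1_rotation[OF ig N(1)])
      then have "g \<circ> (inv' g \<circ> ?c ^^ k) = g" by simp
      then have "?c ^^ k = g" by (simp add: o_assoc permutes_inv_o[OF g])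
      then show False using notC by blast
    qed
    moreover have "cyclic_descents N (inv' g) < N" by (rule cyclic_descents_less[OF ig N(1)])
    ultimately consider "cyclic_descents N (inv' g) = 0" | d where "cyclic_descents N (inv' g) = Suc d" "0 < d" "d < N"
      by (cases "cyclic_descents N (inv' g)") auto
    then have "?r \<noteq> 1"
    proof cases
      case 1
      then show ?thesis using unity_root_power_neq_1[of 1 N] N by (simp add: inverse_eq_1_iff)
    next
      case 2
      then have r: "?r = ?\<omega> ^ d" by (simp add: field_simps)
      show ?thesis unfolding r by (rule unity_root_power_neq_1[OF 2(2,3)])
    qed
    moreover have "?r ^ N = 1"
    proof -
      have "?r ^ N = (?\<omega> ^ N) ^ cyclic_descents N (inv' g) * inverse (?\<omega> ^ N)"
        by (simp add: power_mult_distrib power_inverse flip: power_mult) (simp add: mult.commute)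
      then show ?thesis by (simp add: unity_root_power_N[OF N(1)])
    qed
    ultimately have "(\<Sum>k<N. ?r ^ k) = 0" by (simp add: sum_gp_strict)
    then show ?thesis using \<phi>_f[OF g] by simp
  qed
  \<comment> \<open>The image of \<open>b w\<close> is supported on the coset of \<open>w\<close>.
    Evaluated at root words, one for each coset, these images form a diagonal matrix with nonzero
    diagonal.\<close>
  define b where "b w = permute_vars w f" for w
  have b_V: "b w \<in> ?V" if "w \<in> ?W" for w
    unfolding b_def by (rule perm_V[OF root_words_permutes[OF that] f_V])
  have \<phi>_b: "\<phi> (b w) v = (if v = w then sign_char w * \<phi> f id else 0)" if w: "w \<in> ?W" and v: "v \<in> ?W" for w v
  proof -
    have wv: "w permutes {1..N}" "v permutes {1..N}" using w v by (simp_all only: root_words_permutes)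
    have iv: "(inv' w \<circ> v) permutes {1..N}" by (rule permutes_compose[OF wv(2) permutes_inv[OF wv(1)]])
    have eq: "\<phi> (b w) v = sign_char w * \<phi> f (inv' w \<circ> v)" unfolding b_def by (rule \<phi>_equi[OF wv])
    show ?thesis
    proof (cases "v = w")
      case True
      then show ?thesis using eq permutes_inv_o(2)[OF wv(1)] by simp
    next
      case False
      have "inv' w \<circ> v \<notin> range (\<lambda>k. ?c ^^ k)"
      proof
        assume "inv' w \<circ> v \<in> range (\<lambda>k. ?c ^^ k)"
        then obtain k where k: "inv' w \<circ> v = ?c ^^ k" by blast
        have "inv' w 1 = 1" using w permutes_inv_eq[OF wv(1), of 1 1] by (simp add: root_words_def)
        then have "(?c ^^ k) 1 = 1" using v unfolding k[symmetric] by (simp add: root_words_def)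
        then have "k mod N = 0 mod N" using long_cycle_funpow_1[OF N(1), of k] by simp
        then have "?c ^^ k = ?c ^^ 0" using long_cycle_funpow_eq_iff[OF N(1)] by blast
        then have "w \<circ> (inv' w \<circ> v) = w" using k by simp
        then show False using False by (simp add: o_assoc permutes_inv_o[OF wv(1)])
      qed
      then show ?thesis using False eq \<phi>_f_0[OF iv] by simp
    qed
  qed
  have sign_nz: "sign_char w \<noteq> 0" for w by (simp add: sign_char_def)
  have \<phi>_comb: "\<phi> (\<Sum>w\<in>?W. poly_scale (a w) (b w)) v = a v * (sign_char v * \<phi> f id)" if v: "v \<in> ?W" for a v
  proof -
    have "\<phi> (\<Sum>w\<in>?W. poly_scale (a w) (b w)) v = (\<Sum>w\<in>?W. if w = v then a w * (sign_char w * \<phi> f id) else 0)"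
      unfolding \<phi>_sum using v by (intro sum.cong) (auto simp: \<phi>_b)
    then show ?thesis using v by (simp add: sum.delta')
  qed
  have b_zero: "a v = 0" if "(\<Sum>w\<in>?W. poly_scale (a w) (b w)) = 0" "v \<in> ?W" for a v
    using \<phi>_comb[OF that(2), of a] that(1) \<phi>_f_id sign_nz by (simp add: \<phi>.zero)
  have inj_b: "inj_on b ?W" and indep_b: "cpoly.independent (b ` ?W)"
    by (rule cpoly.independent_family[OF finite_root_words], erule (1) b_zero)+
  \<comment> \<open>The translates are as many independent vectors as there are path polynomials
    spanning the space; a path polynomial outside their span would make one independent vector too
    many.\<close>
  have "path_poly N ` ?W \<subseteq> cpoly.span (b ` ?W)"
  proof (rule ccontr)
    assume "\<not> ?thesis"
    then obtain p where p: "p \<in> path_poly N ` ?W" "p \<notin> cpoly.span (b ` ?W)" by blast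
    then have notin: "p \<notin> b ` ?W" using cpoly.span_base by blast
    then have "cpoly.independent (insert p (b ` ?W))"
      using indep_b p(2) by (simp add: cpoly.independent_insert)
    moreover have "insert p (b ` ?W) \<subseteq> cpoly.span (path_poly N ` ?W)"
      using p(1) b_V cpoly.span_base unfolding V by blast
    ultimately have "card (insert p (b ` ?W)) \<le> card (path_poly N ` ?W)"
      by (meson cpoly.independent_span_bound finite_imageI finite_root_words)
    also have "\<dots> \<le> card ?W" by (rule card_image_le) simp
    finally show False using notin card_image[OF inj_b] by simp
  qed
  then have "?V \<subseteq> cpoly.span (b ` ?W)"
    unfolding V by (rule cpoly.span_minimal[OF _ cpoly.subspace_span])
  then have expand: "\<exists>a. p = (\<Sum>w\<in>?W. poly_scale (a w) (b w))" if "p \<in> ?V" for p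
  proof -
    have "p \<in> cpoly.span (b ` ?W)" using \<open>?V \<subseteq> cpoly.span (b ` ?W)\<close> that by blast
    then obtain u where "p = (\<Sum>x\<in>b ` ?W. poly_scale (u x) x)"
      by (auto simp: cpoly.span_finite)
    then show ?thesis by (auto simp: sum.reindex[OF inj_b] intro!: exI[of _ "u \<circ> b"])
  qed
  have "inj_on \<phi> ?V"
  proof (rule inj_onI)
    fix p q assume pq: "p \<in> ?V" "q \<in> ?V" "\<phi> p = \<phi> q"
    have "p - q \<in> ?V" using pq subspace_V_deg by (intro cpoly.subspace_diff)
    then obtain a where a: "p - q = (\<Sum>w\<in>?W. poly_scale (a w) (b w))" using expand by blast
    have "a v = 0" if "v \<in> ?W" for v
      using \<phi>_comb[OF that, of a] pq(3) \<phi>_f_id sign_nz unfolding a[symmetric] by (simp add: \<phi>.diff)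
    then have "p - q = 0" unfolding a by (intro sum.neutral) simp
    then show "p = q" by simp
  qed
  moreover have "\<phi> ` ?V = rep_space ?S"
  proof
    show "\<phi> ` ?V \<subseteq> rep_space ?S" using \<phi>_space by blast
    show "rep_space ?S \<subseteq> \<phi> ` ?V"
    proof
      fix F assume F: "F \<in> rep_space ?S"
      define p where "p = (\<Sum>w\<in>?W. poly_scale (F w / (sign_char w * \<phi> f id)) (b w))"
      have p: "p \<in> ?V"
        unfolding p_def by (intro cpoly.subspace_sum cpoly.subspace_scale subspace_V_deg b_V)
      have "\<phi> p = F"
      proof (rule tensor_Lie_space_eqI[OF \<phi>_space[OF p] F])
        fix v assume "v \<in> root_words (n + 1)"
        then have "v \<in> ?W" by (simp add: N_def)
        then show "\<phi> p v = F v" using \<phi>_comb[of v] \<phi>_f_id sign_nz by (simp add: p_def)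
      qed
      then show "F \<in> \<phi> ` ?V" using p by blast
    qed
  qed
  moreover have "rep_act ?S \<sigma> (\<phi> p) = \<phi> (permute_vars \<sigma> p)" if \<sigma>: "\<sigma> permutes {1..N}" for \<sigma> p
  proof
    fix g
    have "inv\<^bsub>sym_group N\<^esub> \<sigma> = inv' \<sigma>" using \<sigma> by (simp add: sym_group_carrier)
    then have "rep_act ?S \<sigma> (\<phi> p) g = sign_char \<sigma> * (if g permutes {1..N} then \<phi> p (inv' \<sigma> \<circ> g) else 0)"
      unfolding tensor_char_def Lie_rep_def induced_rep_def char_rep_def rep.simps N_def[symmetric]
      by (simp only: sym_group_carrier sym_group_mult)
    then show "rep_act ?S \<sigma> (\<phi> p) g = \<phi> (permute_vars \<sigma> p) g"
      using \<phi>_equi[OF \<sigma>, of g p] by (cases "g permutes {1..N}") (simp, simp add: \<phi>_def)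
  qed
  moreover have "rep_scale ?S = (\<lambda>(a::complex) (f::(nat \<Rightarrow> nat) \<Rightarrow> complex) g. a * f g)"
    by (simp add: tensor_char_def Lie_rep_def induced_rep_def char_rep_def)
  ultimately show ?thesis
    using \<phi>_lin
    by (intro rep_isomorphic_of_linear[where \<phi> = \<phi>] representation_V_rep)
      (simp_all only: V_rep_def rep.simps sym_group_carrier N_def)
qed

theorem theorem2:
  fixes n :: nat
  assumes "n \<ge> 1"
  shows
    "rep_isomorphic (sym_group (n + 1)) (V_rep n 0) (char_rep (\<lambda>_. 1)) \<and>
     (n \<ge> 2 \<longrightarrow>
        rep_isomorphic (sym_group (n + 1)) (V_rep n 1) (reflection_rep (n + 1)) \<and>
        rep_isomorphic (sym_group (n + 1)) (V_rep n 1) (specht_rep [n, 1]) \<and>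
        irreducible_rep (sym_group (n + 1)) (V_rep n 1)) \<and>
     (\<forall>k<n. V_deg n k =
        module.span poly_scale {(\<Prod>i<k. f i) |f. \<forall>i<k. f i \<in> V_deg n 1}) \<and>
     (\<forall>k>n choose 2. V_deg n k = {0}) \<and>
     rep_isomorphic (sym_group (n + 1)) (V_rep n (n choose 2))
       (tensor_char (Lie_rep n) sign_char)"
proof (intro conjI allI impI)
  \<comment> \<open>For \<open>n = 1\<close> the empty graph is the only slim one, so degree one
    vanishes while the reflection representation has dimension 1.\<close>
  assume n: "n \<ge> 2"
  show refl: "rep_isomorphic (sym_group (n + 1)) (V_rep n 1) (reflection_rep (n + 1))"
    by (rule rep_isomorphic_sym[OF rep_isomorphic_reflection_V_rep[OF n]])
  show "rep_isomorphic (sym_group (n + 1)) (V_rep n 1) (specht_rep [n, 1])"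
    by (rule rep_isomorphic_trans[OF refl rep_isomorphic_reflection_specht[OF assms]])
  show "irreducible_rep (sym_group (n + 1)) (V_rep n 1)"
    by (rule irreducible_rep_transfer[OF refl irreducible_reflection_rep]) (use n in simp)
next
  show "rep_isomorphic (sym_group (n + 1)) (V_rep n 0) (char_rep (\<lambda>_. 1))"
    by (rule rep_isomorphic_V_rep_0[OF assms])
  show "rep_isomorphic (sym_group (n + 1)) (V_rep n (n choose 2)) (tensor_char (Lie_rep n) sign_char)"
    by (rule rep_isomorphic_top[OF assms])
qed (erule V_deg_eq_span_products V_deg_above_top)+

end
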